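(* Let $\mathbb{K}=\mathbb{R}$ or $\mathbb{C}$, let $(X,x)\hookrightarrow(\mathbb{K}^n,0)$ be an embedded germ of $\mathbb{K}$-analytic space and $i\in\mathbb{N}^*$. There exists a partition $$\overline{\Pi^i(\mathcal{A}_{(X,x)})}=\bigcup_{1\le j\le l_i}S_{i,j}$$ where $S_{i,j}=U_{i,j}-W_{i,j}$, $U_{i,j}$ and $W_{i,j}$ are algebraic subvarieties of $\mathcal{A}^i_{(\mathbb{K}^n,0)}\simeq\mathbb{K}^{ni}$, and $\mathcal{M}^i_{X,\varphi^i}$, $\mathcal{H}^i_{X,\varphi^i}$, $\mathcal{N}^i_{X,\varphi^i}$ are constant for $\varphi^i\in S_{i,j}$. Moreover, for $j\ne j'$ the values of $\mathcal{N}^i_{X,\varphi^i}$ on $S_{i,j}$ and $S_{i,j'}$ are distinct.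
   Context: $\mathcal{A}_{(X,x)}$ is the set of germs of analytic arcs $(\mathbb{K},0)\to(X,x)$, i.e. local $\mathbb{K}$-algebra morphisms $\mathcal{O}_{X,x}\to\mathbb{K}\{t\}$; $\mathcal{A}^i_{(X,x)}$ is the set of local $\mathbb{K}$-algebra morphisms $\mathcal{O}_{X,x}\to\mathbb{K}\{t\}/(t)^{i+1}$, and $\Pi^i:\mathcal{A}_{(X,x)}\to\mathcal{A}^i_{(X,x)}\subset\mathcal{A}^i_{(\mathbb{K}^n,0)}$ is truncation. Writing elements of $\mathcal{A}^i_{(\mathbb{K}^n,0)}$ as $\varphi^i=\sum_{k=1}^iA_kt^k$, $A_k\in\mathbb{K}^n$, identifies $\mathcal{A}^i_{(\mathbb{K}^n,0)}$ with $\mathbb{K}^{ni}$. The overline denotes closure (Zariski closure in $\mathbb{K}^{ni}$). Nash sequences. Let $X=(X_1,\dots,X_n)$ be coordinates on $\mathbb{K}^n$, and let $\varphi(t)=\sum_{k\ge1}A_kt^k$ be an arc in $(\mathbb{K}^n,0)$. Put $(E_0,O_0)=(\mathbb{K},0)\times(\mathbb{K}^n,0)$, $(Z_0,O_0)=(\mathbb{K},0)\times(X,x)$, $\Gamma_0(t)=(t,\varphi(t))$, and inductively for $j\ge1$ let $\Pi_j:E_j\to E_{j-1}$ be the blowing-up of center the point $O_{j-1}$, $\Gamma_j$ the lifting of $\Gamma_{j-1}$ through $\Pi_j$, $O_j=\Gamma_j(0)$, $Z_j$ the strict transform of $Z_{j-1}$. There are local isomorphisms $\theta_j:(\mathbb{K},0)\times(\mathbb{K}^n,0)\to(E_j,O_j)$,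 $\theta_0=\mathrm{id}$, in which $\Pi_j$ becomes $(t,X)\mapsto(t,t(A_j+X))$ and $\Gamma_j$ becomes $t\mapsto(t,\sum_{k>j}A_kt^{k-j})$. Let $(Z'_j,0)=\theta_j^{-1}(Z_j,O_j)$, with defining ideal $I_{j,A^j}\subset\mathbb{K}\{t,X_1,\dots,X_n\}$, $A^j=(A_1,\dots,A_j)$ ($I_{j,A^j}=\mathbb{K}\{t,X\}$ if $O_j\notin Z_j$). Let $m_{j,\varphi}$ be the multiplicity of $Z_j$ at $O_j$ ($0$ if $O_j\notin Z_j$); $H_{j,\varphi}(k)=\dim_{\mathbb{K}}\mathcal{O}_{Z_j,O_j}/\mathcal{M}^{k+1}$ the Hilbert–Samuel function of $(Z_j,O_j)$ ($0$ if $O_j\notin Z_j$); $N_{j,\varphi}=N(I_{j,A^j})\subset\mathbb{N}^{n+1}$. The truncated sequences $\mathcal{M}^i_{X,\varphi^i}=(m_{0,\varphi},\dots,m_{i,\varphi})$, $\mathcal{H}^i_{X,\varphi^i}=(H_{0,\varphi},\dots,H_{i,\varphi})$, $\mathcal{N}^i_{X,\varphi^i}=(N_{0,\varphi},\dots,N_{i,\varphi})$ depend only on $\varphi^i=\sum_{k=1}^iA_kt^k$. Diagram of initial exponents. $\mathbb{N}^{n+1}$, with elements $\alpha=(\alpha_0,\dots,\alpha_n)$ ($\alpha_0$ is the exponent of $t$), is totally ordered by the lexicographic order on $(|\alpha|,\alpha_0,\dots,\alpha_n)$. For a nonzero power series $f=\sum a_\alpha (t,X)^\alpha$, $\nu(f)=\min\{\alpha: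 a_\alpha\ne0\}$; for an ideal $I$, $N(I)=\{\nu(g): g\in I,\ g\neq0\}$. *)

theory Defs
  imports
    "HOL-Analysis.Infinite_Sum"
    "HOL-Library.Poly_Mapping"
    "HOL-Library.Disjoint_Sets"
    "HOL-Computational_Algebra.Polynomial"
    "HOL-Algebra.QuotRing"
    "HOL-Algebra.Ideal_Product"
    "HOL-Algebra.Embedded_Algebras"
begin

text \<open>
  The ground field is a type \<open>'k :: {real_normed_field, banach}\<close>: by the theorems of Ostrowski and
  Mazur such a field is, as a normed field, the reals or the complex numbers, and \<^typ>\<open>real\<close> and
  \<^typ>\<open>complex\<close> are instances.

  The variables of power series are numbered by natural numbers: variable \<open>0\<close> is \<open>t\<close> and variable
  \<open>l \<ge> 1\<close> is the coordinate \<open>X\<^sub>l\<close>. Hence \<open>{0}\<close>, \<open>{1..n}\<close>, \<open>{0..n}\<close> are the sets of variables of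
  \<open>K{t}\<close>, \<open>K{X}\<close>, \<open>K{t,X}\<close>, and \<open>K{X}\<close> is literally a subset of \<open>K{t,X}\<close>.
\<close>

type_synonym expo = "nat \<Rightarrow>\<^sub>0 nat"

definition expo_deg :: "expo \<Rightarrow> nat" where
  "expo_deg \<alpha> = (\<Sum>v\<in>Poly_Mapping.keys \<alpha>. Poly_Mapping.lookup \<alpha> v)"


section \<open>Convergent power series\<close>

definition convergent_series :: "(expo \<Rightarrow> 'k::real_normed_field) \<Rightarrow> bool" where
  "convergent_series f \<longleftrightarrow> (\<exists>r>0. (\<lambda>\<alpha>. norm (f \<alpha>) * r ^ expo_deg \<alpha>) summable_on UNIV)"

definition cps :: "nat set \<Rightarrow> (expo \<Rightarrow> 'k::real_normed_field) ring" where
  "cps V = \<lparr>carrier = {f. (\<forall>\<alpha>. f \<alpha> \<noteq> 0 \<longrightarrow> Poly_Mapping.keys \<alpha> \<subseteq> V) \<and> convergent_series f},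
            monoid.mult = (\<lambda>f g \<gamma>. \<Sum>(\<alpha>, \<beta>) | \<alpha> + \<beta> = \<gamma>. f \<alpha> * g \<beta>),
            one = (\<lambda>\<alpha>. if \<alpha> = 0 then 1 else 0),
            zero = (\<lambda>\<alpha>. 0),
            add = (\<lambda>f g \<alpha>. f \<alpha> + g \<alpha>)\<rparr>"

definition cps_const :: "'k::real_normed_field \<Rightarrow> expo \<Rightarrow> 'k" where
  "cps_const c = (\<lambda>\<alpha>. if \<alpha> = 0 then c else 0)"

definition cps_var :: "nat \<Rightarrow> expo \<Rightarrow> 'k::real_normed_field" where
  "cps_var v = (\<lambda>\<alpha>. if \<alpha> = Poly_Mapping.single v 1 then 1 else 0)"

text \<open>
  Substitution \<open>f(g\<^sub>v : v \<in> V)\<close> for \<open>V\<close> finite and series \<open>g\<^sub>v\<close> without constant term: the coefficient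
  of exponent \<open>\<gamma>\<close> then receives contributions only from the \<open>\<alpha>\<close> with \<open>|\<alpha>| \<le> |\<gamma>|\<close>.
\<close>

definition cps_subst ::
    "nat set \<Rightarrow> (expo \<Rightarrow> 'k::real_normed_field) \<Rightarrow> (nat \<Rightarrow> expo \<Rightarrow> 'k) \<Rightarrow> expo \<Rightarrow> 'k" where
  "cps_subst V f g = (\<lambda>\<gamma>. \<Sum>\<alpha> | Poly_Mapping.keys \<alpha> \<subseteq> V \<and> expo_deg \<alpha> \<le> expo_deg \<gamma>.
     f \<alpha> * (\<Otimes>\<^bsub>cps V\<^esub>v\<in>V. g v [^]\<^bsub>cps V\<^esub> Poly_Mapping.lookup \<alpha> v) \<gamma>)"


section \<open>Arcs and the Zariski topology on the space of truncated arcs\<close>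

text \<open>The maximal ideal of a local ring.\<close>

definition nonunits :: "('a, 'b) ring_scheme \<Rightarrow> 'a set" where
  "nonunits R = carrier R - Units R"

text \<open>
  An embedded germ \<open>(X,x)\<close> in \<open>(K\<^sup>n,0)\<close> is given by its defining ideal \<open>I\<close>, a proper ideal of
  \<open>K{X}\<close>; its local ring is \<open>K{X}/I\<close>. An arc is a local morphism of \<open>K\<close>-algebras \<open>K{X}/I \<rightarrow> K{t}\<close>.
\<close>

definition arcs ::
    "nat \<Rightarrow> (expo \<Rightarrow> 'k::real_normed_field) set \<Rightarrow> ((expo \<Rightarrow> 'k) set \<Rightarrow> (expo \<Rightarrow> 'k)) set" where
  "arcs n I = {h \<in> ring_hom (cps {1..n} Quot I) (cps {0}).
     (\<forall>c. h (I +>\<^bsub>cps {1..n}\<^esub> cps_const c) = cps_const c) \<and>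
     h ` nonunits (cps {1..n} Quot I) \<subseteq> nonunits (cps {0})}"

text \<open>
  The affine space \<open>K\<^bsup>ni\<^esup>\<close> of truncated arcs \<open>\<Sum>\<^bsub>k=1..i\<^esub> A\<^sub>k t\<^sup>k\<close> in \<open>(K\<^sup>n,0)\<close>: the value of \<open>A\<close> at \<open>(k,l)\<close>
  is the \<open>l\<close>-th coordinate of \<open>A\<^sub>k\<close>.
\<close>

definition arc_space :: "nat \<Rightarrow> nat \<Rightarrow> (nat \<times> nat \<Rightarrow> 'k) set" where
  "arc_space n i = ({1..i} \<times> {1..n}) \<rightarrow>\<^sub>E UNIV"

text \<open>
  The components of the arc \<open>h\<close> are the images of the classes of the coordinates \<open>X\<^sub>l\<close>.
\<close>

definition truncate_arc ::
    "nat \<Rightarrow> nat \<Rightarrow> (expo \<Rightarrow> 'k::real_normed_field) set \<Rightarrow> ((expo \<Rightarrow> 'k) set \<Rightarrow> (expo \<Rightarrow> 'k))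
      \<Rightarrow> nat \<times> nat \<Rightarrow> 'k" where
  "truncate_arc n i I h = (\<lambda>(k, l) \<in> {1..i} \<times> {1..n}.
     h (I +>\<^bsub>cps {1..n}\<^esub> cps_var l) (Poly_Mapping.single 0 k))"

definition mpoly_eval :: "(('v \<Rightarrow>\<^sub>0 nat) \<Rightarrow>\<^sub>0 'k::comm_semiring_1) \<Rightarrow> ('v \<Rightarrow> 'k) \<Rightarrow> 'k" where
  "mpoly_eval p a = (\<Sum>m\<in>Poly_Mapping.keys p. Poly_Mapping.lookup p m *
     (\<Prod>v\<in>Poly_Mapping.keys m. a v ^ Poly_Mapping.lookup m v))"

definition algebraic_subvariety :: "nat \<Rightarrow> nat \<Rightarrow> (nat \<times> nat \<Rightarrow> 'k::field) set \<Rightarrow> bool" where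
  "algebraic_subvariety n i Z \<longleftrightarrow>
     (\<exists>P :: ((nat \<times> nat \<Rightarrow>\<^sub>0 nat) \<Rightarrow>\<^sub>0 'k) set.
        (\<forall>p\<in>P. \<forall>m\<in>Poly_Mapping.keys p. Poly_Mapping.keys m \<subseteq> {1..i} \<times> {1..n}) \<and>
        Z = {a \<in> arc_space n i. \<forall>p\<in>P. mpoly_eval p a = 0})"

definition zariski_closure ::
    "nat \<Rightarrow> nat \<Rightarrow> (nat \<times> nat \<Rightarrow> 'k::field) set \<Rightarrow> (nat \<times> nat \<Rightarrow> 'k) set" where
  "zariski_closure n i S = \<Inter>{Z. algebraic_subvariety n i Z \<and> S \<subseteq> Z}"


section \<open>Multiplicity, Hilbert--Samuel function, diagram of initial exponents\<close>

primrec ideal_pow :: "('a, 'b) ring_scheme \<Rightarrow> 'a set \<Rightarrow> nat \<Rightarrow> 'a set" where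
  "ideal_pow R J 0 = carrier R"
| "ideal_pow R J (Suc k) = J \<cdot>\<^bsub>R\<^esub> ideal_pow R J k"

text \<open>
  \<open>k \<mapsto> dim\<^sub>K L/M\<^bsup>k+1\<^esup>\<close> for a local ring \<open>L\<close> with maximal ideal \<open>M\<close> which is a \<open>K\<close>-algebra through the
  map \<open>s\<close> from \<open>K\<close> to \<open>L\<close>.
\<close>

definition hilbert_samuel :: "('a, 'b) ring_scheme \<Rightarrow> ('k \<Rightarrow> 'a) \<Rightarrow> nat \<Rightarrow> nat" where
  "hilbert_samuel L s k = (let J = ideal_pow L (nonunits L) (k + 1) in
     ring.dim (L Quot J) (range (\<lambda>c. J +>\<^bsub>L\<^esub> s c)) (carrier (L Quot J)))"

text \<open>
  The multiplicity is \<open>d!\<close> times the leading coefficient of the Hilbert--Samuel polynomial, \<open>d\<close> being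
  the degree of that polynomial, which is the dimension of the local ring.
\<close>

definition hs_multiplicity :: "(nat \<Rightarrow> nat) \<Rightarrow> nat" where
  "hs_multiplicity H = (THE m. \<exists>p :: real poly.
     (\<forall>\<^sub>F k in sequentially. poly p (real k) = real (H k)) \<and>
     real m = fact (Polynomial.degree p) * Polynomial.coeff p (Polynomial.degree p))"

text \<open>The order on exponents: lexicographic on \<open>(|\<alpha>|, \<alpha>\<^sub>0, \<dots>, \<alpha>\<^sub>n)\<close>.\<close>

definition expo_key :: "nat \<Rightarrow> expo \<Rightarrow> nat list" where
  "expo_key n \<alpha> = expo_deg \<alpha> # map (Poly_Mapping.lookup \<alpha>) [0..<Suc n]"

definition expo_less :: "nat \<Rightarrow> expo \<Rightarrow> expo \<Rightarrow> bool" where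
  "expo_less n \<alpha> \<beta> \<longleftrightarrow> (expo_key n \<alpha>, expo_key n \<beta>) \<in> lexord less_than"

definition initial_exponent :: "nat \<Rightarrow> (expo \<Rightarrow> 'k::zero) \<Rightarrow> expo" where
  "initial_exponent n f =
     (THE \<alpha>. f \<alpha> \<noteq> 0 \<and> (\<forall>\<beta>. f \<beta> \<noteq> 0 \<longrightarrow> \<alpha> = \<beta> \<or> expo_less n \<alpha> \<beta>))"

definition initial_diagram :: "nat \<Rightarrow> (expo \<Rightarrow> 'k::zero) set \<Rightarrow> expo set" where
  "initial_diagram n J = {initial_exponent n f | f. f \<in> J \<and> f \<noteq> (\<lambda>\<alpha>. 0)}"


section \<open>Nash sequences\<close>

text \<open>
  The components of the chart \<open>(t, X) \<mapsto> (t, t(a + X))\<close> of the blowing-up of the origin of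
  \<open>K \<times> K\<^sup>n\<close>, centred at the point \<open>a\<close> of the exceptional divisor \<open>t = 0\<close>.
\<close>

definition blowup_chart :: "nat \<Rightarrow> (nat \<Rightarrow> 'k::real_normed_field) \<Rightarrow> nat \<Rightarrow> expo \<Rightarrow> 'k" where
  "blowup_chart n a v = (if v = 0 then cps_var 0
     else cps_var 0 \<otimes>\<^bsub>cps {0..n}\<^esub> (cps_const (a v) \<oplus>\<^bsub>cps {0..n}\<^esub> cps_var v))"

text \<open>
  The ideal of the strict transform is the saturation of the ideal of the total transform with
  respect to the exceptional divisor; it is the whole ring iff the strict transform does not pass
  through the chosen point.
\<close>

definition strict_transform ::
    "nat \<Rightarrow> (nat \<Rightarrow> 'k::real_normed_field) \<Rightarrow> (expo \<Rightarrow> 'k) set \<Rightarrow> (expo \<Rightarrow> 'k) set" where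
  "strict_transform n a J = {g \<in> carrier (cps {0..n}).
     \<exists>k::nat. (cps_var 0 [^]\<^bsub>cps {0..n}\<^esub> k) \<otimes>\<^bsub>cps {0..n}\<^esub> g
       \<in> genideal (cps {0..n}) ((\<lambda>f. cps_subst {0..n} f (blowup_chart n a)) ` J)}"

primrec nash_ideal ::
    "nat \<Rightarrow> (expo \<Rightarrow> 'k::real_normed_field) set \<Rightarrow> (nat \<times> nat \<Rightarrow> 'k) \<Rightarrow> nat \<Rightarrow> (expo \<Rightarrow> 'k) set" where
  "nash_ideal n I A 0 = genideal (cps {0..n}) I"
| "nash_ideal n I A (Suc j) = strict_transform n (\<lambda>l. A (Suc j, l)) (nash_ideal n I A j)"

definition nash_H ::
    "nat \<Rightarrow> (expo \<Rightarrow> 'k::real_normed_field) set \<Rightarrow> (nat \<times> nat \<Rightarrow> 'k) \<Rightarrow> nat \<Rightarrow> nat \<Rightarrow> nat" where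
  "nash_H n I A j = (let R = cps {0..n}; J = nash_ideal n I A j in
     if J = carrier R then (\<lambda>k. 0)
     else hilbert_samuel (R Quot J) (\<lambda>c. J +>\<^bsub>R\<^esub> cps_const c))"

definition nash_m ::
    "nat \<Rightarrow> (expo \<Rightarrow> 'k::real_normed_field) set \<Rightarrow> (nat \<times> nat \<Rightarrow> 'k) \<Rightarrow> nat \<Rightarrow> nat" where
  "nash_m n I A j = (if nash_ideal n I A j = carrier (cps {0..n}) then 0
     else hs_multiplicity (nash_H n I A j))"

definition nash_N ::
    "nat \<Rightarrow> (expo \<Rightarrow> 'k::real_normed_field) set \<Rightarrow> (nat \<times> nat \<Rightarrow> 'k) \<Rightarrow> nat \<Rightarrow> expo set" where
  "nash_N n I A j = initial_diagram n (nash_ideal n I A j)"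

definition nash_M_seq ::
    "nat \<Rightarrow> nat \<Rightarrow> (expo \<Rightarrow> 'k::real_normed_field) set \<Rightarrow> (nat \<times> nat \<Rightarrow> 'k) \<Rightarrow> nat list" where
  "nash_M_seq n i I A = map (nash_m n I A) [0..<Suc i]"

definition nash_H_seq ::
    "nat \<Rightarrow> nat \<Rightarrow> (expo \<Rightarrow> 'k::real_normed_field) set \<Rightarrow> (nat \<times> nat \<Rightarrow> 'k) \<Rightarrow> (nat \<Rightarrow> nat) list" where
  "nash_H_seq n i I A = map (nash_H n I A) [0..<Suc i]"

definition nash_N_seq ::
    "nat \<Rightarrow> nat \<Rightarrow> (expo \<Rightarrow> 'k::real_normed_field) set \<Rightarrow> (nat \<times> nat \<Rightarrow> 'k) \<Rightarrow> expo set list" where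
  "nash_N_seq n i I A = map (nash_N n I A) [0..<Suc i]"

end

theory Submission
  imports Defs
begin

text \<open>
  Only the fact that the closure \<open>T\<close> is closed matters. Stage by stage, \<open>T\<close> is cut into the sets on
  which \<open>N\<^sub>0, \<dots>, N\<^sub>j\<close> are constant, carrying along the following regularity of the family of ideals
  \<open>I\<^sub>j\<close> on each piece: every element of an ideal of the family is, up to any given order, the value of
  a section whose coefficients are polynomials in \<open>A\<close>. Gaussian elimination with such sections shows
  that the number of initial exponents in a finite initial segment is lower semicontinuous. With
  Dickson's lemma and the Hilbert basis theorem, the diagram takes finitely many values, on locally
  closed sets.

  On a piece where the diagram of \<open>I\<^sub>j\<close> is constant, a section of order \<open>D\<close> at one point can be
  corrected to have order \<open>D\<close> everywhere; then its pull-back to the blowing-up can be divided by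
  \<open>t\<^sup>D\<close> everywhere. As the strict transform is the adic closure of such quotients, its family is regular
  on the same piece. The Hilbert--Samuel function at \<open>k\<close> counts the exponents of degree at most \<open>k\<close>
  outside the diagram, so the diagram determines it, and with it the multiplicity.
\<close>

section \<open>Exponents\<close>

text \<open>The obstacle is that membership in a strict transform gives no control over its
  dependence on A: it involves some power of t and some combination of pull-backs with series as
  coefficients. Truncation to finite order makes the problem finite. An initial exponent is visible
  in a truncation, and up to any order an element of the strict transform is t^(-D) times the
  pull-back of a single element f of I_j, so that it suffices to let f move with A. When A moves,
  the order of f may drop below D, and t^D then no longer divides the pull-back; for this reason the
  diagram of I_j has to be constant beforehand. Passing from the ideal generated by pull-backs to
  such single quotients requires that their closure be saturated with respect to t: a division by t
  must not lose an uncontrolled amount of precision. The loss is bounded by a constant from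
  Dickson's lemma, in which the coordinate of t is used to record the gap between D and the degree
  of the initial exponent on t = 0.\<close>

abbreviation lk :: "expo \<Rightarrow> nat \<Rightarrow> nat" where
  "lk \<equiv> Poly_Mapping.lookup"

abbreviation sg :: "nat \<Rightarrow> nat \<Rightarrow> expo" where
  "sg \<equiv> Poly_Mapping.single"

definition expos :: "nat set \<Rightarrow> expo set" where
  "expos V = {\<alpha>. Poly_Mapping.keys \<alpha> \<subseteq> V}"

text \<open>Divisibility of the monomials with these exponents, as opposed to the total order
  \<open>expo_less\<close>.\<close>

definition expo_le :: "expo \<Rightarrow> expo \<Rightarrow> bool" where
  "expo_le \<alpha> \<beta> \<longleftrightarrow> (\<forall>v. lk \<alpha> v \<le> lk \<beta> v)"

lemma expos_iff: "\<alpha> \<in> expos V \<longleftrightarrow> (\<forall>v. v \<notin> V \<longrightarrow> lk \<alpha> v = 0)"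
  by (auto simp: expos_def in_keys_iff)

lemma expos_add_iff [simp]: "\<alpha> + \<beta> \<in> expos V \<longleftrightarrow> \<alpha> \<in> expos V \<and> \<beta> \<in> expos V"
  by (auto simp: expos_iff lookup_add)

lemma expos_zero [simp]: "0 \<in> expos V"
  by (simp add: expos_def)

lemma expos_single [simp]: "v \<in> V \<Longrightarrow> sg v k \<in> expos V"
  by (auto simp: expos_iff lookup_single when_def)

lemma expos_diff [simp]: "\<alpha> \<in> expos V \<Longrightarrow> \<alpha> - \<beta> \<in> expos V"
  by (auto simp: expos_iff lookup_minus)

lemma expo_le_add [simp]: "expo_le \<alpha> (\<alpha> + \<beta>)" "expo_le \<alpha> (\<beta> + \<alpha>)"
  by (auto simp: expo_le_def lookup_add)

lemma expo_le_diff_add: "expo_le \<alpha> \<beta> \<Longrightarrow> \<alpha> + (\<beta> - \<alpha>) = \<beta>"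
  by (rule poly_mapping_eqI) (auto simp: expo_le_def lookup_add lookup_minus)

lemma expo_le_iff: "expo_le \<alpha> \<beta> \<longleftrightarrow> (\<exists>\<gamma>. \<beta> = \<alpha> + \<gamma>)"
  by (metis expo_le_diff_add expo_le_add(1))

lemma expo_add_diff [simp]: "(\<alpha> + \<beta>) - \<alpha> = (\<beta> :: expo)"
  by (rule poly_mapping_eqI) (auto simp: lookup_add lookup_minus)

lemma expo_le_refl [simp]: "expo_le \<alpha> \<alpha>"
  by (simp add: expo_le_def)

lemma expo_le_trans: "expo_le \<alpha> \<beta> \<Longrightarrow> expo_le \<beta> \<gamma> \<Longrightarrow> expo_le \<alpha> \<gamma>"
  unfolding expo_le_def using order_trans by blast

lemma expo_le_antisym: "expo_le \<alpha> \<beta> \<Longrightarrow> expo_le \<beta> \<alpha> \<Longrightarrow> \<alpha> = \<beta>"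
  by (rule poly_mapping_eqI) (simp add: expo_le_def order_antisym)

lemma expo_le_zero [simp]: "expo_le 0 \<alpha>"
  by (simp add: expo_le_def)

lemma expo_le_expos: "expo_le \<alpha> \<beta> \<Longrightarrow> \<beta> \<in> expos V \<Longrightarrow> \<alpha> \<in> expos V"
  by (auto simp: expo_le_iff)

lemma expo_le_single_iff: "expo_le (sg v k) \<alpha> \<longleftrightarrow> k \<le> lk \<alpha> v"
  by (auto simp: expo_le_def lookup_single when_def)

lemma expo_deg_eq_sum: "finite V \<Longrightarrow> \<alpha> \<in> expos V \<Longrightarrow> expo_deg \<alpha> = (\<Sum>v\<in>V. lk \<alpha> v)"
  unfolding expo_deg_def by (rule sum.mono_neutral_left) (auto simp: expos_def in_keys_iff)

lemma expo_deg_add [simp]: "expo_deg (\<alpha> + \<beta>) = expo_deg \<alpha> + expo_deg \<beta>"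
proof -
  let ?V = "Poly_Mapping.keys \<alpha> \<union> Poly_Mapping.keys \<beta>"
  have "\<alpha> \<in> expos ?V" "\<beta> \<in> expos ?V" by (auto simp: expos_def)
  then show ?thesis
    by (simp add: expo_deg_eq_sum[of ?V] lookup_add sum.distrib)
qed

lemma expo_deg_zero [simp]: "expo_deg 0 = 0"
  by (simp add: expo_deg_def)

lemma expo_deg_single [simp]: "expo_deg (sg v k) = k"
  by (simp add: expo_deg_def)

lemma lk_le_expo_deg: "lk \<alpha> v \<le> expo_deg \<alpha>"
proof (cases "v \<in> Poly_Mapping.keys \<alpha>")
  case True
  then show ?thesis
    unfolding expo_deg_def by (intro member_le_sum) auto
qed (simp add: in_keys_iff)

lemma expo_deg_eq_0_iff [simp]: "expo_deg \<alpha> = 0 \<longleftrightarrow> \<alpha> = 0"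
  by (metis expo_deg_zero lk_le_expo_deg le_zero_eq lookup_zero poly_mapping_eqI)

lemma expo_deg_mono: "expo_le \<alpha> \<beta> \<Longrightarrow> expo_deg \<alpha> \<le> expo_deg \<beta>"
  by (auto simp: expo_le_iff)

lemma expo_le_deg_eq: "expo_le \<alpha> \<beta> \<Longrightarrow> expo_deg \<beta> \<le> expo_deg \<alpha> \<Longrightarrow> \<alpha> = \<beta>"
  by (auto simp: expo_le_iff)

lemma expo_split: "\<alpha> \<noteq> 0 \<Longrightarrow> \<exists>v \<beta>. v \<in> Poly_Mapping.keys \<alpha> \<and> \<alpha> = sg v 1 + \<beta>"
proof -
  assume "\<alpha> \<noteq> 0"
  then obtain v where v: "v \<in> Poly_Mapping.keys \<alpha>"
    by (metis lookup_zero not_in_keys_iff_lookup_eq_zero poly_mapping_eqI)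
  then have "expo_le (sg v 1) \<alpha>"
    by (auto simp: expo_le_single_iff in_keys_iff)
  with v show ?thesis by (auto simp: expo_le_iff)
qed

lemma expos_induct [consumes 1, case_names zero step]:
  assumes "\<alpha> \<in> expos V" and "P 0"
    and step: "\<And>v \<alpha>. v \<in> V \<Longrightarrow> \<alpha> \<in> expos V \<Longrightarrow> P \<alpha> \<Longrightarrow> P (sg v 1 + \<alpha>)"
  shows "P (\<alpha> :: expo)"
  using assms(1)
proof (induction "expo_deg \<alpha>" arbitrary: \<alpha>)
  case 0
  then show ?case using assms(2) by simp
next
  case (Suc d)
  then have "\<alpha> \<noteq> 0" by auto
  then obtain v \<beta> where v: "v \<in> Poly_Mapping.keys \<alpha>" and \<alpha>: "\<alpha> = sg v 1 + \<beta>"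
    using expo_split by blast
  have "v \<in> V" using v Suc.prems by (auto simp: expos_def)
  moreover have "\<beta> \<in> expos V" using Suc.prems \<alpha> by simp
  moreover have "d = expo_deg \<beta>" using Suc.hyps(2) \<alpha> by simp
  ultimately show ?case using step Suc.hyps(1) \<alpha> by blast
qed

section \<open>Counting exponents of bounded degree\<close>

lemma expo_box_inj: "inj_on (\<lambda>\<alpha>. restrict (lk \<alpha>) V) (expos V)"
proof (rule inj_onI)
  fix \<alpha> \<beta> :: "expo"
  assume "\<alpha> \<in> expos V" "\<beta> \<in> expos V" and eq: "restrict (lk \<alpha>) V = restrict (lk \<beta>) V"
  show "\<alpha> = \<beta>"
  proof (rule poly_mapping_eqI)
    fix v show "lk \<alpha> v = lk \<beta> v"
      using fun_cong[OF eq, of v] \<open>\<alpha> \<in> expos V\<close> \<open>\<beta> \<in> expos V\<close>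
      by (cases "v \<in> V") (auto simp: expos_iff)
  qed
qed

text \<open>A finite \<open>G\<close> lies in a box, over which the sum is a product of truncated
  geometric series. The bound is uniform in \<open>G\<close>: it serves as a convergence proof, as a
  count of exponents and as a majorant for inverses.\<close>

lemma sum_expo_power_le:
  fixes q :: real
  assumes V: "finite V" and G: "finite G" "G \<subseteq> expos V" and q: "0 \<le> q" "q < 1"
  shows "(\<Sum>\<alpha>\<in>G. q ^ expo_deg \<alpha>) \<le> (1 / (1 - q)) ^ card V"
proof -
  define d where "d = Max (insert 0 (expo_deg ` G))"
  have d: "expo_deg \<alpha> \<le> d" if "\<alpha> \<in> G" for \<alpha>
    unfolding d_def using that G by (intro Max_ge) auto
  let ?r = "\<lambda>\<alpha>. restrict (lk \<alpha>) V"
  have "(\<Sum>\<alpha>\<in>G. q ^ expo_deg \<alpha>) = (\<Sum>\<alpha>\<in>G. \<Prod>v\<in>V. q ^ ?r \<alpha> v)"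
    using V G by (intro sum.cong refl) (auto simp: expo_deg_eq_sum[of V] power_sum subset_iff)
  also have "\<dots> = (\<Sum>g\<in>?r ` G. \<Prod>v\<in>V. q ^ g v)"
    using inj_on_subset[OF expo_box_inj G(2)] by (simp add: sum.reindex)
  also have "\<dots> \<le> (\<Sum>g\<in>V \<rightarrow>\<^sub>E {..d}. \<Prod>v\<in>V. q ^ g v)"
  proof (rule sum_mono2)
    show "?r ` G \<subseteq> V \<rightarrow>\<^sub>E {..d}"
      using d lk_le_expo_deg by (fastforce intro: order_trans)
  qed (use V q in \<open>auto intro: finite_PiE prod_nonneg\<close>)
  also have "\<dots> = (\<Prod>v\<in>V. \<Sum>k\<in>{..d}. q ^ k)"
    using V by (subst prod_sum_PiE) auto
  also have "\<dots> \<le> (\<Prod>v\<in>V. 1 / (1 - q))"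
  proof (rule prod_mono, safe)
    have "(\<Sum>k\<in>{..d}. q ^ k) \<le> suminf (\<lambda>k. q ^ k)"
      using q by (intro sum_le_suminf) (auto intro: summable_geometric)
    then show "(\<Sum>k\<le>d. q ^ k) \<le> 1 / (1 - q)"
      using q by (simp add: suminf_geometric)
  qed (use q in \<open>auto intro: sum_nonneg\<close>)
  finally show ?thesis by simp
qed

lemma finite_expos_deg_le: "finite V \<Longrightarrow> finite {\<alpha> \<in> expos V. expo_deg \<alpha> \<le> d}"
proof -
  assume V: "finite V"
  have "finite ((\<lambda>\<alpha>. restrict (lk \<alpha>) V) ` {\<alpha> \<in> expos V. expo_deg \<alpha> \<le> d})"
  proof (rule finite_subset)
    show "(\<lambda>\<alpha>. restrict (lk \<alpha>) V) ` {\<alpha> \<in> expos V. expo_deg \<alpha> \<le> d} \<subseteq> V \<rightarrow>\<^sub>E {..d}"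
      using lk_le_expo_deg by (fastforce intro: order_trans)
  qed (use V in \<open>auto intro: finite_PiE\<close>)
  then show ?thesis
    by (rule finite_imageD) (auto intro: inj_on_subset[OF expo_box_inj])
qed

text \<open>Each exponent of \<open>G\<close> contributes at least \<open>(1/2) ^ d\<close> to the
  sum of \<open>sum_expo_power_le\<close> at q = 1/2. Exponential growth in \<open>d\<close> is good
  enough, since geometric bounds absorb it.\<close>

lemma card_expos_deg_le:
  assumes V: "finite V" and G: "G \<subseteq> {\<alpha> \<in> expos V. expo_deg \<alpha> \<le> d}"
  shows "real (card G) \<le> 2 ^ card V * 2 ^ d"
proof -
  have fin: "finite G" using finite_expos_deg_le[OF V] G finite_subset by blast
  have "real (card G) * (1/2) ^ d = (\<Sum>\<alpha>\<in>G. (1/2) ^ d)" by simp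
  also have "\<dots> \<le> (\<Sum>\<alpha>\<in>G. (1/2) ^ expo_deg \<alpha>)"
    using G by (intro sum_mono power_decreasing) auto
  also have "\<dots> \<le> (1 / (1 - 1/2)) ^ card V"
    using G by (intro sum_expo_power_le fin V) auto
  finally show ?thesis by (simp add: field_simps power_divide)
qed

lemma finite_expo_le: "finite {\<beta>. expo_le \<beta> \<alpha>}"
proof (rule finite_subset)
  show "{\<beta>. expo_le \<beta> \<alpha>} \<subseteq> {\<beta> \<in> expos (Poly_Mapping.keys \<alpha>). expo_deg \<beta> \<le> expo_deg \<alpha>}"
    by (auto simp: expo_deg_mono intro: expo_le_expos simp: expos_def[of "Poly_Mapping.keys \<alpha>"])
      (metis expo_le_expos expos_def mem_Collect_eq order_refl subsetD)
qed (simp add: finite_expos_deg_le)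

lemma finite_expo_splits: "finite {(\<alpha>, \<beta>). \<alpha> + \<beta> = (\<gamma> :: expo)}"
proof (rule finite_subset)
  show "{(\<alpha>, \<beta>). \<alpha> + \<beta> = \<gamma>} \<subseteq> {\<beta>. expo_le \<beta> \<gamma>} \<times> {\<beta>. expo_le \<beta> \<gamma>}"
    by auto
qed (use finite_expo_le in auto)


subsection \<open>Dickson's lemma\<close>

text \<open>A decreasing sequence of natural numbers attains its minimum and is constant from there
  on, so the monotone subsequence can always be taken increasing.\<close>

lemma nat_seq_incseq_subseq:
  fixes s :: "nat \<Rightarrow> nat"
  shows "\<exists>r. strict_mono r \<and> incseq (s \<circ> r)"
proof -
  obtain r where r: "strict_mono r" "monoseq (\<lambda>k. s (r k))"
    using seq_monosub[of s] by auto
  show ?thesis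
  proof (cases "incseq (\<lambda>k. s (r k))")
    case True
    then show ?thesis using r by (auto simp: comp_def)
  next
    case False
    with r have dec: "decseq (\<lambda>k. s (r k))" by (auto simp: monoseq_iff)
    define m where "m = (LEAST x. x \<in> range (\<lambda>k. s (r k)))"
    have "m \<in> range (\<lambda>k. s (r k))" unfolding m_def by (rule LeastI) auto
    then obtain k0 where k0: "m = s (r k0)" by auto
    have "s (r (k0 + k)) = m" for k
      using decseqD[OF dec, of k0 "k0 + k"] k0 Least_le[of "\<lambda>x. x \<in> range (\<lambda>k. s (r k))" "s (r (k0 + k))"]
      by (auto simp: m_def)
    then have "incseq (s \<circ> (\<lambda>k. r (k0 + k)))" by (auto simp: incseq_def)
    moreover have "strict_mono (\<lambda>k. r (k0 + k))" using r by (simp add: strict_mono_def)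
    ultimately show ?thesis by blast
  qed
qed

lemma dickson_subseq:
  fixes s :: "nat \<Rightarrow> expo"
  assumes "finite V"
  shows "\<exists>r. strict_mono r \<and> (\<forall>v\<in>V. incseq (\<lambda>k. lk (s (r k)) v))"
  using assms
proof (induction V)
  case empty
  show ?case using strict_mono_id by blast
next
  case (insert w V)
  then obtain r where r: "strict_mono r" "\<forall>v\<in>V. incseq (\<lambda>k. lk (s (r k)) v)" by blast
  obtain r' where r': "strict_mono r'" "incseq ((\<lambda>k. lk (s (r k)) w) \<circ> r')"
    using nat_seq_incseq_subseq by blast
  have "strict_mono (r \<circ> r')" using r r' by (simp add: strict_mono_def)
  moreover have "incseq (\<lambda>k. lk (s ((r \<circ> r') k)) v)" if "v \<in> insert w V" for v
  proof (cases "v = w")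
    case True
    then show ?thesis using r'(2) by (simp add: comp_def)
  next
    case False
    with that r have "incseq (\<lambda>k. lk (s (r k)) v)" by auto
    then show ?thesis using r'(1)
      by (auto simp: incseq_def comp_def strict_mono_less_eq)
  qed
  ultimately show ?case by blast
qed

lemma dickson:
  fixes S :: "expo set"
  assumes "finite V" and "S \<subseteq> expos V"
  shows "\<exists>B. finite B \<and> B \<subseteq> S \<and> (\<forall>\<alpha>\<in>S. \<exists>\<beta>\<in>B. expo_le \<beta> \<alpha>)"
proof -
  \<comment> \<open>The minimal elements for divisibility. An injective sequence in \<open>B\<close>
    would have a subsequence increasing in every coordinate, and two distinct minimal elements would
    be comparable.\<close>
  define B where "B = {\<beta> \<in> S. \<forall>\<alpha>\<in>S. expo_le \<alpha> \<beta> \<longrightarrow> \<alpha> = \<beta>}"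
  have "finite B"
  proof (rule ccontr)
    assume "infinite B"
    then obtain s :: "nat \<Rightarrow> expo" where s: "inj s" "range s \<subseteq> B"
      using infinite_countable_subset by blast
    obtain r where r: "strict_mono r" "\<forall>v\<in>V. incseq (\<lambda>k. lk (s (r k)) v)"
      using dickson_subseq[OF assms(1)] by blast
    have in_B: "s k \<in> B" for k using s(2) by auto
    then have "s k \<in> expos V" for k using assms(2) by (auto simp: B_def)
    then have "expo_le (s (r 0)) (s (r 1))"
      unfolding expo_le_def using r(2) by (metis (no_types, lifting) expos_iff incseq_def le0 order_refl)
    then have "s (r 0) = s (r 1)" using in_B unfolding B_def by blast
    then have "r 0 = r 1" using s(1) by (simp add: inj_eq)
    then show False using r(1) by (metis less_numeral_extra(1) order_less_irrefl strict_mono_less)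
  qed
  moreover have "\<exists>\<beta>\<in>B. expo_le \<beta> \<alpha>" if "\<alpha> \<in> S" for \<alpha>
    using that
  proof (induction "card {\<beta>. expo_le \<beta> \<alpha>}" arbitrary: \<alpha> rule: less_induct)
    case less
    show ?case
    proof (cases "\<alpha> \<in> B")
      case False
      with less.prems obtain \<beta> where \<beta>: "\<beta> \<in> S" "expo_le \<beta> \<alpha>" "\<beta> \<noteq> \<alpha>"
        by (auto simp: B_def)
      then have "{\<gamma>. expo_le \<gamma> \<beta>} \<subset> {\<gamma>. expo_le \<gamma> \<alpha>}"
        using expo_le_trans expo_le_antisym expo_le_refl by blast
      then have "card {\<gamma>. expo_le \<gamma> \<beta>} < card {\<gamma>. expo_le \<gamma> \<alpha>}"
        by (intro psubset_card_mono finite_expo_le)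
      then show ?thesis using less.hyps[of \<beta>] \<beta> expo_le_trans by blast
    qed (use expo_le_refl in blast)
  qed
  ultimately show ?thesis by (auto simp: B_def)
qed


subsection \<open>The order on exponents\<close>

text \<open>Position in the total order. As degrees are compared first, every exponent has finitely
  many predecessors, so arguments along this order become inductions on natural numbers.\<close>

definition rank :: "nat \<Rightarrow> expo \<Rightarrow> nat" where
  "rank n \<alpha> = card {\<beta> \<in> expos {0..n}. expo_less n \<beta> \<alpha>}"

lemma lexord_pointwise_add:
  assumes "length xs = length ys" "length ys = length zs"
  shows "(map2 (+) xs zs, map2 (+) ys zs) \<in> lexord less_than \<longleftrightarrow> (xs, ys) \<in> lexord (less_than :: (nat \<times> nat) set)"
  using assms by (induction xs ys zs rule: list_induct3) auto

lemma expo_key_add: "expo_key n (\<alpha> + \<beta>) = map2 (+) (expo_key n \<alpha>) (expo_key n \<beta>)"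
  unfolding expo_key_def by (simp add: lookup_add map2_map_map del: upt_Suc)

lemma expo_less_add_iff: "expo_less n (\<alpha> + \<gamma>) (\<beta> + \<gamma>) \<longleftrightarrow> expo_less n \<alpha> \<beta>"
  unfolding expo_less_def expo_key_add
  by (rule lexord_pointwise_add) (auto simp: expo_key_def)

lemma expo_less_deg: "expo_deg \<alpha> < expo_deg \<beta> \<Longrightarrow> expo_less n \<alpha> \<beta>"
  by (simp add: expo_less_def expo_key_def)

lemma expo_less_imp_deg_le: "expo_less n \<alpha> \<beta> \<Longrightarrow> expo_deg \<alpha> \<le> expo_deg \<beta>"
  by (auto simp: expo_less_def expo_key_def)

lemma expo_key_inj:
  assumes "\<alpha> \<in> expos {0..n}" "\<beta> \<in> expos {0..n}" "expo_key n \<alpha> = expo_key n \<beta>"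
  shows "\<alpha> = \<beta>"
proof (rule poly_mapping_eqI)
  fix v show "lk \<alpha> v = lk \<beta> v"
    using assms by (cases "v \<le> n") (auto simp: expos_iff expo_key_def simp del: upt_Suc)
qed

lemma expo_less_linear:
  assumes "\<alpha> \<in> expos {0..n}" "\<beta> \<in> expos {0..n}"
  shows "expo_less n \<alpha> \<beta> \<or> \<alpha> = \<beta> \<or> expo_less n \<beta> \<alpha>"
proof -
  have "(expo_key n \<alpha>, expo_key n \<beta>) \<in> lexord less_than \<or> expo_key n \<alpha> = expo_key n \<beta> \<or>
    (expo_key n \<beta>, expo_key n \<alpha>) \<in> lexord less_than"
    by (rule lexord_linear) auto
  then show ?thesis using expo_key_inj[OF assms] by (auto simp: expo_less_def)
qed

lemma expo_less_trans: "expo_less n \<alpha> \<beta> \<Longrightarrow> expo_less n \<beta> \<gamma> \<Longrightarrow> expo_less n \<alpha> \<gamma>"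
  unfolding expo_less_def by (erule lexord_trans) (auto simp: trans_def)

lemma expo_less_irrefl: "\<not> expo_less n \<alpha> \<alpha>"
  unfolding expo_less_def by (rule lexord_irreflexive) auto

lemma finite_expo_less: "finite {\<beta> \<in> expos {0..n}. expo_less n \<beta> \<alpha>}"
  by (rule finite_subset[OF _ finite_expos_deg_le[of "{0..n}" "expo_deg \<alpha>"]])
    (auto dest: expo_less_imp_deg_le)

lemma rank_mono: "\<alpha> \<in> expos {0..n} \<Longrightarrow> expo_less n \<alpha> \<beta> \<Longrightarrow> rank n \<alpha> < rank n \<beta>"
  unfolding rank_def
  by (rule psubset_card_mono[OF finite_expo_less]) (use expo_less_trans expo_less_irrefl in blast)

lemma rank_less_iff:
  assumes "\<alpha> \<in> expos {0..n}" "\<beta> \<in> expos {0..n}"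
  shows "rank n \<alpha> < rank n \<beta> \<longleftrightarrow> expo_less n \<alpha> \<beta>"
  using expo_less_linear[OF assms] rank_mono[OF assms(1), of \<beta>] rank_mono[OF assms(2), of \<alpha>] by auto

lemma rank_inj:
  assumes "\<alpha> \<in> expos {0..n}" "\<beta> \<in> expos {0..n}"
  shows "rank n \<alpha> = rank n \<beta> \<longleftrightarrow> \<alpha> = \<beta>"
  using expo_less_linear[OF assms] rank_mono[OF assms(1), of \<beta>] rank_mono[OF assms(2), of \<alpha>] by auto

lemma rank_add_less_iff:
  assumes "\<alpha> \<in> expos {0..n}" "\<beta> \<in> expos {0..n}" "\<gamma> \<in> expos {0..n}"
  shows "rank n (\<gamma> + \<alpha>) < rank n (\<gamma> + \<beta>) \<longleftrightarrow> rank n \<alpha> < rank n \<beta>"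
  using assms by (simp add: rank_less_iff add.commute[of \<gamma>] expo_less_add_iff)

lemma rank_less_deg:
  "\<alpha> \<in> expos {0..n} \<Longrightarrow> expo_deg \<alpha> < expo_deg \<beta> \<Longrightarrow> rank n \<alpha> < rank n \<beta>"
  by (simp add: rank_mono expo_less_deg)

lemma rank_le_imp_deg_le:
  "\<beta> \<in> expos {0..n} \<Longrightarrow> rank n \<alpha> \<le> rank n \<beta> \<Longrightarrow> expo_deg \<alpha> \<le> expo_deg \<beta>"
  using rank_less_deg[of \<beta> n \<alpha>] by linarith

lemma finite_rank_less: "finite {\<alpha> \<in> expos {0..n}. rank n \<alpha> < r}"
proof -
  have "finite (rank n ` {\<alpha> \<in> expos {0..n}. rank n \<alpha> < r})"
    by (rule finite_subset[of _ "{..<r}"]) auto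
  then show ?thesis by (rule finite_imageD) (auto simp: inj_on_def rank_inj)
qed

lemma rank_zero [simp]: "rank n 0 = 0"
proof -
  have "{\<beta> \<in> expos {0..n}. expo_less n \<beta> 0} = {}"
    using expo_less_imp_deg_le[of n _ 0] expo_less_irrefl[of n 0] by fastforce
  then show ?thesis by (simp only: rank_def card.empty)
qed


section \<open>The ring of convergent power series\<close>

lemma expo_deg_pos_iff [simp]: "0 < expo_deg \<alpha> \<longleftrightarrow> \<alpha> \<noteq> 0"
  using expo_deg_eq_0_iff[of \<alpha>] by linarith

lemma expo_le_zero_iff [simp]: "expo_le \<alpha> 0 \<longleftrightarrow> \<alpha> = 0"
  using expo_deg_mono[of \<alpha> 0] by auto

definition supp_in :: "nat set \<Rightarrow> (expo \<Rightarrow> 'k::zero) \<Rightarrow> bool" where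
  "supp_in V f \<longleftrightarrow> (\<forall>\<alpha>. f \<alpha> \<noteq> 0 \<longrightarrow> \<alpha> \<in> expos V)"

text \<open>Cauchy estimates. In finitely many variables they are equivalent to convergence, and
  they pass more easily through products, inverses and substitutions than summability does.\<close>

definition geo_bounded :: "(expo \<Rightarrow> 'k::real_normed_field) \<Rightarrow> bool" where
  "geo_bounded f \<longleftrightarrow> (\<exists>C M. 0 \<le> C \<and> 1 \<le> M \<and> (\<forall>\<alpha>. norm (f \<alpha>) \<le> C * M ^ expo_deg \<alpha>))"

lemma geo_boundedI: "(\<And>\<alpha>. norm (f \<alpha>) \<le> C * M ^ expo_deg \<alpha>) \<Longrightarrow> geo_bounded f"
proof -
  assume *: "norm (f \<alpha>) \<le> C * M ^ expo_deg \<alpha>" for \<alpha>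
  have "norm (f \<alpha>) \<le> \<bar>C\<bar> * max 1 \<bar>M\<bar> ^ expo_deg \<alpha>" for \<alpha>
  proof -
    have "C * M ^ expo_deg \<alpha> \<le> \<bar>C * M ^ expo_deg \<alpha>\<bar>" by simp
    also have "\<dots> = \<bar>C\<bar> * \<bar>M\<bar> ^ expo_deg \<alpha>" by (simp add: abs_mult power_abs)
    also have "\<dots> \<le> \<bar>C\<bar> * max 1 \<bar>M\<bar> ^ expo_deg \<alpha>"
      by (intro mult_left_mono power_mono) auto
    finally show ?thesis using *[of \<alpha>] by linarith
  qed
  then show ?thesis unfolding geo_bounded_def
    by (intro exI[of _ "\<bar>C\<bar>"] exI[of _ "max 1 \<bar>M\<bar>"]) auto
qed

lemma supp_inD: "supp_in V f \<Longrightarrow> \<alpha> \<notin> expos V \<Longrightarrow> f \<alpha> = 0"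
  by (auto simp: supp_in_def)

text \<open>One term of a sum of nonnegative numbers is at most the whole sum.\<close>

lemma convergent_imp_geo_bounded:
  assumes "convergent_series f"
  shows "geo_bounded f"
proof -
  obtain r where r: "r > 0" and s: "(\<lambda>\<alpha>. norm (f \<alpha>) * r ^ expo_deg \<alpha>) summable_on UNIV"
    using assms by (auto simp: convergent_series_def)
  let ?S = "\<Sum>\<^sub>\<infinity>\<alpha>. norm (f \<alpha>) * r ^ expo_deg \<alpha>"
  show ?thesis
  proof (rule geo_boundedI)
    fix \<alpha>
    have "norm (f \<alpha>) * r ^ expo_deg \<alpha> \<le> ?S"
      using finite_sum_le_infsum[OF s, of "{\<alpha>}"] r by simp
    then show "norm (f \<alpha>) \<le> ?S * (1/r) ^ expo_deg \<alpha>"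
      using r by (simp add: field_simps power_divide)
  qed
qed

lemma geo_bounded_imp_convergent:
  assumes V: "finite V" and f: "supp_in V f" and "geo_bounded f"
  shows "convergent_series f"
proof -
  obtain C M where CM: "0 \<le> C" "1 \<le> M" "\<And>\<alpha>. norm (f \<alpha>) \<le> C * M ^ expo_deg \<alpha>"
    using assms(3) by (auto simp: geo_bounded_def)
  \<comment> \<open>With this radius the term at \<alpha> is at most
    \<open>C * (1/2) ^ expo_deg \<alpha>\<close>, which is summable over
    \<open>expos V\<close>.\<close>
  define r where "r = 1 / (2 * M)"
  have r: "r > 0" and Mr: "M * r = 1/2" using CM(2) by (auto simp: r_def)
  have "(\<lambda>\<alpha>. norm (f \<alpha>) * r ^ expo_deg \<alpha>) summable_on UNIV"
  proof (rule nonneg_bdd_above_summable_on)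
    show "bdd_above (sum (\<lambda>\<alpha>. norm (f \<alpha>) * r ^ expo_deg \<alpha>) ` {F. F \<subseteq> UNIV \<and> finite F})"
    proof (rule bdd_aboveI2)
      fix F :: "expo set" assume "F \<in> {F. F \<subseteq> UNIV \<and> finite F}"
      then have F: "finite F" by simp
      have "(\<Sum>\<alpha>\<in>F. norm (f \<alpha>) * r ^ expo_deg \<alpha>) = (\<Sum>\<alpha>\<in>F \<inter> expos V. norm (f \<alpha>) * r ^ expo_deg \<alpha>)"
        using F f by (intro sum.mono_neutral_right) (auto simp: supp_in_def)
      also have "\<dots> \<le> (\<Sum>\<alpha>\<in>F \<inter> expos V. C * (1/2) ^ expo_deg \<alpha>)"
      proof (rule sum_mono)
        fix \<alpha>
        have "norm (f \<alpha>) * r ^ expo_deg \<alpha> \<le> C * M ^ expo_deg \<alpha> * r ^ expo_deg \<alpha>"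
          using CM(3)[of \<alpha>] r by (intro mult_right_mono) auto
        also have "\<dots> = C * (1/2) ^ expo_deg \<alpha>"
          by (simp only: mult.assoc power_mult_distrib[symmetric] Mr)
        finally show "norm (f \<alpha>) * r ^ expo_deg \<alpha> \<le> C * (1/2) ^ expo_deg \<alpha>" .
      qed
      also have "\<dots> = C * (\<Sum>\<alpha>\<in>F \<inter> expos V. (1/2) ^ expo_deg \<alpha>)"
        by (simp add: sum_distrib_left)
      also have "\<dots> \<le> C * (1 / (1 - 1/2)) ^ card V"
        using F V CM(1) by (intro mult_left_mono sum_expo_power_le) auto
      finally show "(\<Sum>\<alpha>\<in>F. norm (f \<alpha>) * r ^ expo_deg \<alpha>) \<le> C * (1 / (1 - 1/2)) ^ card V" .
    qed
  qed (use r in auto)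
  then show ?thesis using r by (auto simp: convergent_series_def)
qed

lemma carrier_cps_iff:
  "finite V \<Longrightarrow> f \<in> carrier (cps V) \<longleftrightarrow> supp_in V f \<and> geo_bounded f"
  using convergent_imp_geo_bounded geo_bounded_imp_convergent
  by (auto simp: cps_def supp_in_def expos_def)

lemma carrier_cps_mono: "V \<subseteq> W \<Longrightarrow> carrier (cps V) \<subseteq> carrier (cps W)"
  by (auto simp: cps_def)

text \<open>The product of \<open>cps V\<close> does not depend on \<open>V\<close>; a single name
  lets calculations ignore the ring in which they take place.\<close>

definition cmul :: "(expo \<Rightarrow> 'k::real_normed_field) \<Rightarrow> (expo \<Rightarrow> 'k) \<Rightarrow> expo \<Rightarrow> 'k" where
  "cmul f g = (\<lambda>\<gamma>. \<Sum>(\<alpha>, \<beta>) | \<alpha> + \<beta> = \<gamma>. f \<alpha> * g \<beta>)"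

lemma cps_simps [simp]:
  "f \<otimes>\<^bsub>cps V\<^esub> g = cmul f g"
  "\<one>\<^bsub>cps V\<^esub> = (\<lambda>\<alpha>. if \<alpha> = 0 then 1 else 0)"
  "\<zero>\<^bsub>cps V\<^esub> = (\<lambda>\<alpha>. 0)"
  "f \<oplus>\<^bsub>cps V\<^esub> g = (\<lambda>\<alpha>. f \<alpha> + g \<alpha>)"
  by (simp_all add: cps_def cmul_def)

lemma cmul_alt: "cmul f g \<gamma> = (\<Sum>\<alpha> | expo_le \<alpha> \<gamma>. f \<alpha> * g (\<gamma> - \<alpha>))"
  unfolding cmul_def
  by (rule sum.reindex_bij_witness[of _ "\<lambda>\<alpha>. (\<alpha>, \<gamma> - \<alpha>)" fst]) (auto simp: expo_le_diff_add)

lemma cmul_commute: "cmul f g = cmul g f"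
  unfolding cmul_def
  by (rule ext, rule sum.reindex_bij_witness[of _ prod.swap prod.swap]) (auto simp: ac_simps)

lemma cmul_assoc: "cmul (cmul f g) h = cmul f (cmul g h)"
proof
  fix \<delta>
  let ?s = "\<lambda>\<gamma>::expo. {(\<alpha>, \<beta>). \<alpha> + \<beta> = \<gamma>}"
  have fin: "finite (?s \<gamma>)" for \<gamma> by (rule finite_expo_splits)
  have "cmul (cmul f g) h \<delta> = (\<Sum>x\<in>?s \<delta>. \<Sum>y\<in>?s (fst x). f (fst y) * g (snd y) * h (snd x))"
    by (simp add: cmul_def sum_distrib_right case_prod_unfold)
  also have "\<dots> = (\<Sum>(x, y)\<in>(SIGMA x:?s \<delta>. ?s (fst x)). f (fst y) * g (snd y) * h (snd x))"
    using fin by (intro sum.Sigma) auto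
  also have "\<dots> = (\<Sum>(x, y)\<in>(SIGMA x:?s \<delta>. ?s (snd x)). f (fst x) * (g (fst y) * h (snd y)))"
    by (rule sum.reindex_bij_witness[of _ "\<lambda>((a, _), (b, c)). ((a + b, c), (a, b))" "\<lambda>((_, c), (a, b)). ((a, b + c), (b, c))"])
      (auto simp: ac_simps)
  also have "\<dots> = (\<Sum>x\<in>?s \<delta>. \<Sum>y\<in>?s (snd x). f (fst x) * (g (fst y) * h (snd y)))"
    using fin by (intro sum.Sigma[symmetric]) auto
  also have "\<dots> = cmul f (cmul g h) \<delta>"
    by (simp add: cmul_def sum_distrib_left case_prod_unfold)
  finally show "cmul (cmul f g) h \<delta> = cmul f (cmul g h) \<delta>" .
qed

lemma cmul_add_left: "cmul (\<lambda>\<alpha>. f \<alpha> + g \<alpha>) h = (\<lambda>\<alpha>. cmul f h \<alpha> + cmul g h \<alpha>)"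
  by (simp add: cmul_alt ring_distribs sum.distrib fun_eq_iff)

lemma cmul_monomial:
  "cmul (\<lambda>\<alpha>. if \<alpha> = \<mu> then c else 0) f \<gamma> = (if expo_le \<mu> \<gamma> then c * f (\<gamma> - \<mu>) else 0)"
proof -
  have "cmul (\<lambda>\<alpha>. if \<alpha> = \<mu> then c else 0) f \<gamma> =
    (\<Sum>\<alpha> | expo_le \<alpha> \<gamma>. if \<mu> = \<alpha> then c * f (\<gamma> - \<mu>) else 0)"
    unfolding cmul_alt by (rule sum.cong) auto
  then show ?thesis by (simp add: finite_expo_le)
qed

lemma supp_in_cmul: "supp_in V f \<Longrightarrow> supp_in V g \<Longrightarrow> supp_in V (cmul f g)"
proof -
  assume f: "supp_in V f" and g: "supp_in V g"
  have "cmul f g \<gamma> = 0" if "\<gamma> \<notin> expos V" for \<gamma>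
    unfolding cmul_def using that f g
    by (intro sum.neutral) (auto simp: supp_in_def)
  then show ?thesis by (auto simp: supp_in_def)
qed

lemma geo_bounded_common:
  assumes "geo_bounded f" "geo_bounded g"
  obtains C M where "0 \<le> C" "1 \<le> M" "\<And>\<alpha>. norm (f \<alpha>) \<le> C * M ^ expo_deg \<alpha>"
    "\<And>\<alpha>. norm (g \<alpha>) \<le> C * M ^ expo_deg \<alpha>"
proof -
  obtain C M where f: "0 \<le> C" "1 \<le> M" "\<And>\<alpha>. norm (f \<alpha>) \<le> C * M ^ expo_deg \<alpha>"
    using assms(1) by (auto simp: geo_bounded_def)
  obtain D N where g: "0 \<le> D" "1 \<le> N" "\<And>\<alpha>. norm (g \<alpha>) \<le> D * N ^ expo_deg \<alpha>"
    using assms(2) by (auto simp: geo_bounded_def)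
  have "C * M ^ expo_deg \<alpha> \<le> max C D * max M N ^ expo_deg \<alpha>"
    "D * N ^ expo_deg \<alpha> \<le> max C D * max M N ^ expo_deg \<alpha>" for \<alpha>
    using f g by (intro mult_mono power_mono; simp)+
  then have "norm (f \<alpha>) \<le> max C D * max M N ^ expo_deg \<alpha>" "norm (g \<alpha>) \<le> max C D * max M N ^ expo_deg \<alpha>" for \<alpha>
    using f(3)[of \<alpha>] g(3)[of \<alpha>] order_trans by blast+
  then show ?thesis using f g by (intro that[of "max C D" "max M N"]) auto
qed

lemma geo_bounded_add: "geo_bounded f \<Longrightarrow> geo_bounded g \<Longrightarrow> geo_bounded (\<lambda>\<alpha>. f \<alpha> + g \<alpha>)"
proof -
  assume "geo_bounded f" "geo_bounded g"
  then obtain C M where *: "0 \<le> C" "1 \<le> M" "\<And>\<alpha>. norm (f \<alpha>) \<le> C * M ^ expo_deg \<alpha>"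
    "\<And>\<alpha>. norm (g \<alpha>) \<le> C * M ^ expo_deg \<alpha>" by (metis geo_bounded_common)
  have "norm (f \<alpha> + g \<alpha>) \<le> (2 * C) * M ^ expo_deg \<alpha>" for \<alpha>
    using norm_triangle_ineq[of "f \<alpha>" "g \<alpha>"] *(3,4)[of \<alpha>] by simp
  then show ?thesis by (rule geo_boundedI)
qed

text \<open>The coefficient at \<gamma> has one term for each divisor of \<gamma>, and the number of
  divisors grows at most like \<open>2 ^ expo_deg \<gamma>\<close>; hence the ratio
  \<open>2 * M\<close>.\<close>

lemma geo_bounded_cmul:
  assumes V: "finite V" and fV: "supp_in V f" and gV: "supp_in V g"
    and "geo_bounded f" "geo_bounded g"
  shows "geo_bounded (cmul f g)"
proof -
  obtain C M where *: "0 \<le> C" "1 \<le> M" "\<And>\<alpha>. norm (f \<alpha>) \<le> C * M ^ expo_deg \<alpha>"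
    "\<And>\<alpha>. norm (g \<alpha>) \<le> C * M ^ expo_deg \<alpha>" using assms(4,5) by (metis geo_bounded_common)
  show ?thesis
  proof (rule geo_boundedI)
    fix \<gamma>
    show "norm (cmul f g \<gamma>) \<le> (C * C * 2 ^ card V) * (2 * M) ^ expo_deg \<gamma>"
    proof (cases "\<gamma> \<in> expos V")
      case False
      then have "cmul f g \<gamma> = 0" using supp_in_cmul[OF fV gV] by (simp add: supp_inD)
      then show ?thesis using * by simp
    next
      case True
      have "norm (cmul f g \<gamma>) \<le> (\<Sum>\<alpha> | expo_le \<alpha> \<gamma>. norm (f \<alpha> * g (\<gamma> - \<alpha>)))"
        unfolding cmul_alt by (rule norm_sum)
      also have "\<dots> \<le> (\<Sum>\<alpha> | expo_le \<alpha> \<gamma>. C * C * M ^ expo_deg \<gamma>)"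
      proof (rule sum_mono)
        fix \<alpha> assume "\<alpha> \<in> {\<alpha>. expo_le \<alpha> \<gamma>}"
        then have deg: "expo_deg \<gamma> = expo_deg \<alpha> + expo_deg (\<gamma> - \<alpha>)"
          by (metis expo_deg_add expo_le_diff_add mem_Collect_eq)
        have "norm (f \<alpha> * g (\<gamma> - \<alpha>)) \<le> (C * M ^ expo_deg \<alpha>) * (C * M ^ expo_deg (\<gamma> - \<alpha>))"
          unfolding norm_mult using * by (intro mult_mono) auto
        then show "norm (f \<alpha> * g (\<gamma> - \<alpha>)) \<le> C * C * M ^ expo_deg \<gamma>"
          by (simp add: deg power_add mult_ac)
      qed
      also have "\<dots> = real (card {\<alpha>. expo_le \<alpha> \<gamma>}) * (C * C * M ^ expo_deg \<gamma>)" by simp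
      also have "\<dots> \<le> (2 ^ card V * 2 ^ expo_deg \<gamma>) * (C * C * M ^ expo_deg \<gamma>)"
        using True * by (intro mult_right_mono card_expos_deg_le V) (auto intro: expo_le_expos expo_deg_mono)
      finally show ?thesis by (simp add: mult_ac power_mult_distrib)
    qed
  qed
qed

lemma cring_cps: "finite V \<Longrightarrow> cring (cps V :: (expo \<Rightarrow> 'k::real_normed_field) ring)"
proof -
  assume V: "finite V"
  note iff = carrier_cps_iff[OF V]
  have one: "(\<lambda>\<alpha>. if \<alpha> = 0 then 1 else 0) \<in> carrier (cps V :: (expo \<Rightarrow> 'k) ring)"
    unfolding iff by (auto simp: supp_in_def intro!: geo_boundedI[of _ 1 1])
  have zero: "(\<lambda>\<alpha>. 0) \<in> carrier (cps V :: (expo \<Rightarrow> 'k) ring)"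
    unfolding iff by (auto simp: supp_in_def intro!: geo_boundedI[of _ 1 1])
  have neg: "(\<lambda>\<alpha>. - f \<alpha>) \<in> carrier (cps V)" if "f \<in> carrier (cps V)" for f :: "expo \<Rightarrow> 'k"
    using that unfolding iff by (auto simp: supp_in_def geo_bounded_def)
  have add: "(\<lambda>\<alpha>. f \<alpha> + g \<alpha>) \<in> carrier (cps V)" if "f \<in> carrier (cps V)" "g \<in> carrier (cps V)"
    for f g :: "expo \<Rightarrow> 'k"
    using that unfolding iff by (auto simp: geo_bounded_add) (force simp: supp_in_def)
  have mult: "cmul f g \<in> carrier (cps V)" if "f \<in> carrier (cps V)" "g \<in> carrier (cps V)"
    for f g :: "expo \<Rightarrow> 'k"
    using that unfolding iff by (auto simp: geo_bounded_cmul[OF V] supp_in_cmul)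
  have one_mult: "cmul (\<lambda>\<alpha>. if \<alpha> = 0 then 1 else 0) f = f" for f :: "expo \<Rightarrow> 'k"
    by (rule ext) (simp add: cmul_monomial)
  show ?thesis
  proof (rule cringI)
    show "abelian_group (cps V :: (expo \<Rightarrow> 'k) ring)"
    proof (rule abelian_groupI)
      fix f :: "expo \<Rightarrow> 'k" assume "f \<in> carrier (cps V)"
      then show "\<exists>g\<in>carrier (cps V). g \<oplus>\<^bsub>cps V\<^esub> f = \<zero>\<^bsub>cps V\<^esub>"
        by (intro bexI[OF _ neg[of f]]) auto
    qed (use zero add in \<open>auto simp: ac_simps\<close>)
    show "comm_monoid (cps V :: (expo \<Rightarrow> 'k) ring)"
      by (rule comm_monoidI) (use one mult in \<open>auto simp: cmul_assoc one_mult intro: cmul_commute\<close>)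
  qed (simp add: cmul_add_left)
qed

section \<open>Inverses of series with nonzero constant term\<close>

function cinv :: "(expo \<Rightarrow> 'k::real_normed_field) \<Rightarrow> expo \<Rightarrow> 'k" where
  "cinv f \<gamma> = (if \<gamma> = 0 then 1 / f 0
     else - (\<Sum>\<alpha>\<in>{\<alpha>. expo_le \<alpha> \<gamma> \<and> \<alpha> \<noteq> 0}. f \<alpha> * cinv f (\<gamma> - \<alpha>)) / f 0)"
  by pat_completeness auto
termination
  by (relation "measure (\<lambda>(f, \<gamma>). expo_deg \<gamma>)") (auto simp: expo_le_iff)

declare cinv.simps [simp del]

lemma cmul_cinv: "f 0 \<noteq> 0 \<Longrightarrow> cmul f (cinv f) = (\<lambda>\<alpha>. if \<alpha> = 0 then 1 else 0)"
proof
  fix \<gamma> assume f: "f 0 \<noteq> 0"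
  have "{\<alpha>. expo_le \<alpha> \<gamma>} = insert 0 {\<alpha>. expo_le \<alpha> \<gamma> \<and> \<alpha> \<noteq> 0}" by auto
  moreover have "finite {\<alpha>. expo_le \<alpha> \<gamma> \<and> \<alpha> \<noteq> 0}"
    by (rule finite_subset[OF _ finite_expo_le[of \<gamma>]]) auto
  ultimately have *: "cmul f (cinv f) \<gamma> =
      f 0 * cinv f \<gamma> + (\<Sum>\<alpha> | expo_le \<alpha> \<gamma> \<and> \<alpha> \<noteq> 0. f \<alpha> * cinv f (\<gamma> - \<alpha>))"
    by (simp add: cmul_alt)
  show "cmul f (cinv f) \<gamma> = (if \<gamma> = 0 then 1 else 0)"
  proof (cases "\<gamma> = 0")
    case True
    with f show ?thesis unfolding * by (simp add: cinv.simps[of f 0])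
  next
    case False
    then show ?thesis unfolding * using f by (subst cinv.simps) simp
  qed
qed

text \<open>Majorant argument. If the coefficients of lower degree are bounded with ratio
  \<open>M / q\<close>, the recursion reproduces the bound as soon as \<open>C / norm (f 0)\<close>
  times the sum of \<open>q ^ expo_deg \<alpha>\<close> over \<alpha> \<noteq> 0 is at most
  1.\<close>

lemma cinv_carrier:
  assumes V: "finite V" and f: "f \<in> carrier (cps V)" and f0: "f 0 \<noteq> 0"
  shows "cinv f \<in> carrier (cps V)"
proof -
  have fV: "supp_in V f" and "geo_bounded f" using f carrier_cps_iff[OF V] by auto
  then obtain C M where CM: "0 \<le> C" "1 \<le> M" "\<And>\<alpha>. norm (f \<alpha>) \<le> C * M ^ expo_deg \<alpha>"
    by (auto simp: geo_bounded_def)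
  have fin: "finite {\<alpha>. expo_le \<alpha> \<gamma> \<and> \<alpha> \<noteq> 0}" for \<gamma>
    by (rule finite_subset[OF _ finite_expo_le[of \<gamma>]]) auto
  have supp: "cinv f \<gamma> = 0" if "\<gamma> \<notin> expos V" for \<gamma>
    using that
  proof (induction "expo_deg \<gamma>" arbitrary: \<gamma> rule: less_induct)
    case less
    have "f \<alpha> * cinv f (\<gamma> - \<alpha>) = 0" if "expo_le \<alpha> \<gamma>" "\<alpha> \<noteq> 0" for \<alpha>
    proof (cases "\<alpha> \<in> expos V")
      case True
      then have "\<gamma> - \<alpha> \<notin> expos V" using less.prems that expo_le_diff_add by (metis expos_add_iff)
      moreover have "expo_deg (\<gamma> - \<alpha>) < expo_deg \<gamma>" using that by (auto simp: expo_le_iff)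
      ultimately show ?thesis using less.hyps by simp
    qed (simp add: supp_inD[OF fV])
    moreover have "\<gamma> \<noteq> 0" using less.prems by auto
    ultimately show ?case by (subst cinv.simps) (simp add: sum.neutral)
  qed
  \<comment> \<open>The expression \<open>(1 / (1 - q)) ^ card V - 1\<close> bounds the sum of
    \<open>q ^ expo_deg \<alpha>\<close> over \<alpha> \<noteq> 0 and tends to 0 with q, so a
    suitable q exists.\<close>
  have "((\<lambda>q. C / norm (f 0) * ((1 / (1 - q)) ^ card V - 1)) \<longlongrightarrow> C / norm (f 0) * ((1 / (1 - 0)) ^ card V - 1)) (at_right 0)"
    by (intro tendsto_intros) auto
  then have "\<forall>\<^sub>F q in at_right 0. C / norm (f 0) * ((1 / (1 - q)) ^ card V - 1) < 1"
    by (rule order_tendstoD) simp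
  moreover have "\<forall>\<^sub>F q in at_right (0::real). 0 < q \<and> q < 1"
    using eventually_at_right_real[of 0 "1::real"] by (auto elim: eventually_mono)
  ultimately have "\<forall>\<^sub>F q in at_right 0. C / norm (f 0) * ((1 / (1 - q)) ^ card V - 1) < 1 \<and> 0 < q \<and> q < 1"
    by (rule eventually_conj)
  then obtain q where q: "0 < q" "q < 1" "C / norm (f 0) * ((1 / (1 - q)) ^ card V - 1) < 1"
    using eventually_happens'[OF trivial_limit_at_right_real] by blast
  have "norm (cinv f \<gamma>) \<le> 1 / norm (f 0) * (M / q) ^ expo_deg \<gamma>" for \<gamma>
  proof (induction "expo_deg \<gamma>" arbitrary: \<gamma> rule: less_induct)
    case less
    let ?G = "{\<alpha>. expo_le \<alpha> \<gamma> \<and> \<alpha> \<noteq> 0}"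
    consider "\<gamma> = 0" | "\<gamma> \<notin> expos V" | "\<gamma> \<noteq> 0" "\<gamma> \<in> expos V" by blast
    then show ?case
    proof cases
      case 1
      then show ?thesis by (simp add: cinv.simps[of f 0] norm_divide)
    next
      case 2
      then show ?thesis using supp CM q by simp
    next
      case 3
      have "norm (\<Sum>\<alpha>\<in>?G. f \<alpha> * cinv f (\<gamma> - \<alpha>)) \<le>
        (\<Sum>\<alpha>\<in>?G. C / norm (f 0) * (M / q) ^ expo_deg \<gamma> * q ^ expo_deg \<alpha>)"
      proof (rule order_trans[OF norm_sum], rule sum_mono)
        fix \<alpha> assume "\<alpha> \<in> ?G"
        then obtain \<beta> where \<beta>: "\<gamma> = \<alpha> + \<beta>" and \<alpha>: "\<alpha> \<noteq> 0" by (auto simp: expo_le_iff)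
        then have "norm (cinv f \<beta>) \<le> 1 / norm (f 0) * (M / q) ^ expo_deg \<beta>"
          using less.hyps[of \<beta>] by simp
        then have "norm (f \<alpha> * cinv f \<beta>) \<le> (C * M ^ expo_deg \<alpha>) * (1 / norm (f 0) * (M / q) ^ expo_deg \<beta>)"
          unfolding norm_mult using CM by (intro mult_mono) auto
        also have "\<dots> = C / norm (f 0) * (M / q) ^ expo_deg \<gamma> * q ^ expo_deg \<alpha>"
          using q by (simp add: \<beta> power_add power_divide field_simps)
        finally show "norm (f \<alpha> * cinv f (\<gamma> - \<alpha>)) \<le> C / norm (f 0) * (M / q) ^ expo_deg \<gamma> * q ^ expo_deg \<alpha>"
          by (simp add: \<beta>)
      qed
      also have "\<dots> = C / norm (f 0) * (\<Sum>\<alpha>\<in>?G. q ^ expo_deg \<alpha>) * (M / q) ^ expo_deg \<gamma>"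
        by (simp add: sum_distrib_left sum_distrib_right mult_ac)
      also have "\<dots> \<le> 1 * (M / q) ^ expo_deg \<gamma>"
      proof (rule mult_right_mono)
        have "1 + (\<Sum>\<alpha>\<in>?G. q ^ expo_deg \<alpha>) = (\<Sum>\<alpha>\<in>insert 0 ?G. q ^ expo_deg \<alpha>)"
          using fin by simp
        also have "\<dots> \<le> (1 / (1 - q)) ^ card V"
          using 3 V q fin by (intro sum_expo_power_le) (auto intro: expo_le_expos)
        finally have "C / norm (f 0) * (\<Sum>\<alpha>\<in>?G. q ^ expo_deg \<alpha>) \<le> C / norm (f 0) * ((1 / (1 - q)) ^ card V - 1)"
          using CM by (intro mult_left_mono) auto
        then show "C / norm (f 0) * (\<Sum>\<alpha>\<in>?G. q ^ expo_deg \<alpha>) \<le> 1" using q by linarith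
      qed (use CM q in auto)
      finally have "norm (\<Sum>\<alpha>\<in>?G. f \<alpha> * cinv f (\<gamma> - \<alpha>)) / norm (f 0) \<le> (M / q) ^ expo_deg \<gamma> / norm (f 0)"
        by (intro divide_right_mono) auto
      then show ?thesis using 3 by (subst cinv.simps) (simp add: norm_divide)
    qed
  qed
  then have "geo_bounded (cinv f)" by (rule geo_boundedI)
  then show ?thesis using supp carrier_cps_iff[OF V] by (auto simp: supp_in_def)
qed

text \<open>The constant term decides, so the ring is local and its maximal ideal consists of the
  series without constant term.\<close>

lemma Units_cps_iff:
  assumes V: "finite V"
  shows "f \<in> Units (cps V) \<longleftrightarrow> f \<in> carrier (cps V) \<and> f 0 \<noteq> (0 :: 'k::real_normed_field)"
proof
  assume "f \<in> Units (cps V)"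
  then obtain g where f: "f \<in> carrier (cps V)" and "cmul f g = (\<lambda>\<alpha>. if \<alpha> = 0 then 1 else 0)"
    by (auto simp: Units_def)
  then have "cmul f g 0 = 1" by simp
  then have "f 0 * g 0 = 1" by (simp add: cmul_alt)
  then show "f \<in> carrier (cps V) \<and> f 0 \<noteq> 0" using f by auto
next
  assume f: "f \<in> carrier (cps V) \<and> f 0 \<noteq> 0"
  then show "f \<in> Units (cps V)"
    using cinv_carrier[OF V, of f] cmul_cinv[of f] cmul_commute[of f "cinv f"] unfolding Units_def by auto
qed

subsection \<open>Ideals as spaces of coefficient functions\<close>

text \<open>Multiplication by the monomial with exponent \<mu>, acting on coefficients.\<close>

definition sh :: "expo \<Rightarrow> (expo \<Rightarrow> 'k::zero) \<Rightarrow> expo \<Rightarrow> 'k" where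
  "sh \<mu> f = (\<lambda>\<gamma>. if expo_le \<mu> \<gamma> then f (\<gamma> - \<mu>) else 0)"

text \<open>Submodules over the polynomials: closed under sums, scalars and monomials, without
  closure under multiplication by infinite series. Initial exponents and elimination use exactly
  this structure, and the union of the levels \<open>divided\<close> below is treated as such a
  module before its closure is taken.\<close>

definition lideal :: "nat set \<Rightarrow> (expo \<Rightarrow> 'k::real_normed_field) set \<Rightarrow> bool" where
  "lideal V J \<longleftrightarrow> J \<subseteq> carrier (cps V) \<and> (\<lambda>\<alpha>. 0) \<in> J \<and>
     (\<forall>f\<in>J. \<forall>g\<in>J. (\<lambda>\<alpha>. f \<alpha> + g \<alpha>) \<in> J) \<and> (\<forall>c. \<forall>f\<in>J. (\<lambda>\<alpha>. c * f \<alpha>) \<in> J) \<and>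
     (\<forall>\<mu>\<in>expos V. \<forall>f\<in>J. sh \<mu> f \<in> J)"

lemma sh_add [simp]: "sh \<mu> f (\<mu> + \<gamma>) = f \<gamma>"
  by (simp add: sh_def)

lemma sh_eq_0: "\<not> expo_le \<mu> \<gamma> \<Longrightarrow> sh \<mu> f \<gamma> = 0"
  by (simp add: sh_def)

lemma sh_nonzero_le: "sh \<mu> f \<gamma> \<noteq> 0 \<Longrightarrow> expo_le \<mu> \<gamma>"
  by (auto simp: sh_def split: if_splits)

lemma sh_nonzeroE: "sh \<mu> f \<gamma> \<noteq> 0 \<Longrightarrow> (\<And>\<delta>. \<gamma> = \<mu> + \<delta> \<Longrightarrow> f \<delta> \<noteq> 0 \<Longrightarrow> thesis) \<Longrightarrow> thesis"
  by (metis expo_le_iff sh_add sh_eq_0)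

lemma sh_sh: "sh \<mu> (sh \<nu> f) = sh (\<mu> + \<nu>) f"
proof
  fix \<gamma>
  show "sh \<mu> (sh \<nu> f) \<gamma> = sh (\<mu> + \<nu>) f \<gamma>"
  proof (cases "expo_le (\<mu> + \<nu>) \<gamma>")
    case True
    then obtain \<delta> where "\<gamma> = \<mu> + \<nu> + \<delta>" by (auto simp: expo_le_iff)
    then show ?thesis by (metis add.assoc sh_add)
  next
    case False
    have "sh \<mu> (sh \<nu> f) \<gamma> = 0"
    proof (rule ccontr)
      assume "sh \<mu> (sh \<nu> f) \<gamma> \<noteq> 0"
      then obtain \<delta> where "\<gamma> = \<mu> + \<delta>" "sh \<nu> f \<delta> \<noteq> 0" by (rule sh_nonzeroE)
      then obtain \<epsilon> where "\<gamma> = \<mu> + (\<nu> + \<epsilon>)" by (auto elim: sh_nonzeroE)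
      with False show False by (metis add.assoc expo_le_add(1))
    qed
    with False show ?thesis by (simp add: sh_eq_0)
  qed
qed

lemma sh_zero [simp]: "sh 0 f = f"
  by (simp add: sh_def)

lemma sh_linear: "sh \<mu> (\<lambda>\<alpha>. f \<alpha> + g \<alpha>) = (\<lambda>\<alpha>. sh \<mu> f \<alpha> + sh \<mu> g \<alpha>)"
  "sh \<mu> (\<lambda>\<alpha>. c * f \<alpha>) = (\<lambda>\<alpha>. c * (sh \<mu> f \<alpha> :: 'k::real_normed_field))"
  by (auto simp: sh_def)

lemma cmul_monom: "cmul (\<lambda>\<alpha>. if \<alpha> = \<mu> then 1 else 0) f = sh \<mu> f"
  by (rule ext) (simp add: cmul_monomial sh_def)

lemma cmul_var: "cmul (cps_var v) f = sh (sg v 1) f"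
  unfolding cps_var_def by (rule cmul_monom)

lemma cmul_const: "cmul (cps_const c) f = (\<lambda>\<alpha>. c * f \<alpha>)"
  unfolding cps_const_def by (rule ext) (simp add: cmul_monomial)

lemma monomial_carrier:
  "finite V \<Longrightarrow> \<mu> \<in> expos V \<Longrightarrow> (\<lambda>\<alpha>. if \<alpha> = \<mu> then c else 0) \<in> carrier (cps V)"
  unfolding carrier_cps_iff
  by (auto simp: supp_in_def intro!: geo_boundedI[of _ "norm c" 1])

lemma var_carrier: "finite V \<Longrightarrow> v \<in> V \<Longrightarrow> cps_var v \<in> carrier (cps V)"
  unfolding cps_var_def by (rule monomial_carrier) auto

lemma const_carrier: "finite V \<Longrightarrow> cps_const c \<in> carrier (cps V)"
  unfolding cps_const_def by (rule monomial_carrier) auto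

lemma cps_mult_closed:
  "finite V \<Longrightarrow> f \<in> carrier (cps V) \<Longrightarrow> g \<in> carrier (cps V) \<Longrightarrow> cmul f g \<in> carrier (cps V)"
  unfolding carrier_cps_iff by (auto simp: geo_bounded_cmul supp_in_cmul)

lemma lideal_carrier: "finite V \<Longrightarrow> lideal V (carrier (cps V))"
proof -
  assume V: "finite V"
  interpret R: cring "cps V" using cring_cps[OF V] .
  show ?thesis unfolding lideal_def
    using R.zero_closed R.a_closed cps_mult_closed[OF V const_carrier[OF V]]
      cps_mult_closed[OF V monomial_carrier[OF V]]
    by (auto simp: cmul_const simp flip: cmul_monom)
qed

lemma lidealD:
  assumes "lideal V J"
  shows "J \<subseteq> carrier (cps V)" "(\<lambda>\<alpha>. 0) \<in> J"
    "f \<in> J \<Longrightarrow> g \<in> J \<Longrightarrow> (\<lambda>\<alpha>. f \<alpha> + g \<alpha>) \<in> J" "f \<in> J \<Longrightarrow> (\<lambda>\<alpha>. c * f \<alpha>) \<in> J"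
    "\<mu> \<in> expos V \<Longrightarrow> f \<in> J \<Longrightarrow> sh \<mu> f \<in> J"
  using assms by (auto simp: lideal_def)

lemma lideal_diff: "lideal V J \<Longrightarrow> f \<in> J \<Longrightarrow> g \<in> J \<Longrightarrow> (\<lambda>\<alpha>. f \<alpha> - g \<alpha>) \<in> J"
  using lidealD(3)[of V J f "\<lambda>\<alpha>. (-1) * g \<alpha>"] lidealD(4)[of V J g "-1"] by simp

lemma lideal_sum:
  assumes "lideal V J" "\<And>i. i \<in> G \<Longrightarrow> f i \<in> J"
  shows "(\<lambda>\<alpha>. \<Sum>i\<in>G. f i \<alpha>) \<in> J"
proof (cases "finite G")
  case True
  then show ?thesis using assms(2)
  proof (induction G)
    case (insert i G)
    then show ?case using lidealD(3)[OF assms(1), of "f i"] by simp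
  qed (use lidealD(2)[OF assms(1)] in auto)
qed (use lidealD(2)[OF assms(1)] in auto)

lemma ideal_imp_lideal:
  assumes V: "finite V" and J: "ideal J (cps V)"
  shows "lideal V J"
proof -
  interpret J: ideal J "cps V" by fact
  have scale: "(\<lambda>\<alpha>. c * f \<alpha>) \<in> J" if "f \<in> J" for c f
    using J.I_l_closed[OF that const_carrier[OF V, of c]] by (simp add: cmul_const)
  have shift: "sh \<mu> f \<in> J" if "\<mu> \<in> expos V" "f \<in> J" for \<mu> f
    using J.I_l_closed[OF that(2) monomial_carrier[OF V that(1), of 1]] by (simp add: cmul_monom)
  have sub: "J \<subseteq> carrier (cps V)" using J.a_subset by simp
  have zero: "(\<lambda>\<alpha>. 0) \<in> J" using additive_subgroup.zero_closed[OF J.is_additive_subgroup] by simp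
  have add: "(\<lambda>\<alpha>. f \<alpha> + g \<alpha>) \<in> J" if "f \<in> J" "g \<in> J" for f g
    using additive_subgroup.a_closed[OF J.is_additive_subgroup that] by simp
  show ?thesis unfolding lideal_def
    by (intro conjI ballI allI sub zero; rule add scale shift; assumption)
qed

text \<open>Closure in the topology of the powers of the maximal ideal, taken inside the convergent
  series.\<close>

definition adic_closure :: "nat set \<Rightarrow> (expo \<Rightarrow> 'k::real_normed_field) set \<Rightarrow> (expo \<Rightarrow> 'k) set" where
  "adic_closure V J = {g \<in> carrier (cps V). \<forall>k. \<exists>h\<in>J. \<forall>\<alpha>. expo_deg \<alpha> \<le> k \<longrightarrow> g \<alpha> = h \<alpha>}"

text \<open>Up to degree k only finitely many coefficients of a multiplier matter, so taking the
  closure turns stability under monomials and scalars into stability under all convergent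
  series.\<close>

lemma adic_closure_ideal:
  assumes V: "finite V" and J: "lideal V J"
  shows "ideal (adic_closure V J) (cps V)"
proof -
  interpret R: cring "cps V" using cring_cps[OF V] .
  let ?C = "adic_closure V J"
  have mult: "cmul f g \<in> ?C" if f: "f \<in> carrier (cps V)" and g: "g \<in> ?C" for f g
  proof -
    have "\<exists>h\<in>J. \<forall>\<alpha>. expo_deg \<alpha> \<le> k \<longrightarrow> cmul f g \<alpha> = h \<alpha>" for k
    proof -
      obtain h where h: "h \<in> J" "\<And>\<alpha>. expo_deg \<alpha> \<le> k \<Longrightarrow> g \<alpha> = h \<alpha>"
        using g by (auto simp: adic_closure_def)
      let ?G = "{\<beta> \<in> expos V. expo_deg \<beta> \<le> k}"
      have inJ: "(\<lambda>\<alpha>. \<Sum>\<beta>\<in>?G. f \<beta> * sh \<beta> h \<alpha>) \<in> J"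
        by (rule lideal_sum[OF J]) (auto intro: lidealD[OF J] h)
      have eq: "cmul f g \<alpha> = (\<Sum>\<beta>\<in>?G. f \<beta> * sh \<beta> h \<alpha>)" if "expo_deg \<alpha> \<le> k" for \<alpha>
      proof -
        have "cmul f g \<alpha> = (\<Sum>\<beta> | expo_le \<beta> \<alpha>. f \<beta> * sh \<beta> h \<alpha>)"
          unfolding cmul_alt
        proof (rule sum.cong[OF refl])
          fix \<beta> assume "\<beta> \<in> {\<beta>. expo_le \<beta> \<alpha>}"
          then obtain \<delta> where \<delta>: "\<alpha> = \<beta> + \<delta>" by (auto simp: expo_le_iff)
          then show "f \<beta> * g (\<alpha> - \<beta>) = f \<beta> * sh \<beta> h \<alpha>" using that h(2)[of \<delta>] by simp
        qed
        also have "\<dots> = (\<Sum>\<beta>\<in>{\<beta>. expo_le \<beta> \<alpha>} \<inter> expos V. f \<beta> * sh \<beta> h \<alpha>)"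
          using f carrier_cps_iff[OF V] finite_expo_le
          by (intro sum.mono_neutral_right) (auto simp: supp_in_def)
        also have "\<dots> = (\<Sum>\<beta>\<in>?G. f \<beta> * sh \<beta> h \<alpha>)"
        proof (rule sum.mono_neutral_left)
          show "{\<beta>. expo_le \<beta> \<alpha>} \<inter> expos V \<subseteq> ?G"
            using expo_deg_mono[of _ \<alpha>] that by fastforce
        qed (use V in \<open>auto simp: finite_expos_deg_le dest: sh_nonzero_le\<close>)
        finally show ?thesis .
      qed
      show ?thesis by (rule bexI[OF _ inJ]) (simp add: eq)
    qed
    moreover have "cmul f g \<in> carrier (cps V)"
      using g cps_mult_closed[OF V f, of g] by (simp add: adic_closure_def)
    ultimately show ?thesis by (simp add: adic_closure_def)
  qed
  show ?thesis
  proof (rule idealI)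
    show "subgroup ?C (add_monoid (cps V))"
    proof (rule R.add.subgroupI)
      show "?C \<subseteq> carrier (cps V)" by (auto simp: adic_closure_def)
      have "(\<lambda>\<alpha>. 0) \<in> ?C" using R.zero_closed lidealD(2)[OF J] by (auto simp: adic_closure_def)
      then show "?C \<noteq> {}" by auto
      fix f g assume f: "f \<in> ?C" and g: "g \<in> ?C"
      then have fc: "f \<in> carrier (cps V)" and gc: "g \<in> carrier (cps V)" by (auto simp: adic_closure_def)
      have m: "(\<lambda>\<alpha>. - 1 * f \<alpha>) \<in> ?C" using mult[OF const_carrier[OF V] f, of "-1"] by (simp add: cmul_const)
      then have "\<ominus>\<^bsub>cps V\<^esub> f = (\<lambda>\<alpha>. - 1 * f \<alpha>)"
        by (intro R.minus_equality) (use fc in \<open>auto simp: adic_closure_def\<close>)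
      then show "\<ominus>\<^bsub>cps V\<^esub> f \<in> ?C" using m by simp
      have "\<exists>h\<in>J. \<forall>\<alpha>. expo_deg \<alpha> \<le> k \<longrightarrow> f \<alpha> + g \<alpha> = h \<alpha>" for k
      proof -
        obtain h where h: "h \<in> J" "\<And>\<alpha>. expo_deg \<alpha> \<le> k \<Longrightarrow> f \<alpha> = h \<alpha>"
          using f by (auto simp: adic_closure_def)
        obtain h' where h': "h' \<in> J" "\<And>\<alpha>. expo_deg \<alpha> \<le> k \<Longrightarrow> g \<alpha> = h' \<alpha>"
          using g by (auto simp: adic_closure_def)
        show ?thesis
          by (rule bexI[OF _ lidealD(3)[OF J h(1) h'(1)]]) (simp add: h(2) h'(2))
      qed
      then show "f \<oplus>\<^bsub>cps V\<^esub> g \<in> ?C"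
        using R.a_closed[OF fc gc] by (simp add: adic_closure_def)
    qed
    show "f \<otimes>\<^bsub>cps V\<^esub> g \<in> ?C" if "g \<in> ?C" "f \<in> carrier (cps V)" for f g
      using mult[OF that(2,1)] by simp
    show "g \<otimes>\<^bsub>cps V\<^esub> f \<in> ?C" if "g \<in> ?C" "f \<in> carrier (cps V)" for f g
      using mult[OF that(2,1)] by (simp add: cmul_commute)
  qed (use R.ring_axioms in auto)
qed

lemma sh_carrier: "finite V \<Longrightarrow> \<mu> \<in> expos V \<Longrightarrow> f \<in> carrier (cps V) \<Longrightarrow> sh \<mu> f \<in> carrier (cps V)"
  by (rule lidealD(5)[OF lideal_carrier])

lemma sh_carrierD:
  assumes V: "finite V" and "sh \<mu> f \<in> carrier (cps V)"
  shows "f \<in> carrier (cps V)"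
proof -
  have s: "supp_in V (sh \<mu> f)" and g: "geo_bounded (sh \<mu> f)" using assms carrier_cps_iff by auto
  have "supp_in V f" unfolding supp_in_def
  proof safe
    fix \<alpha> assume "f \<alpha> \<noteq> 0"
    then have "sh \<mu> f (\<mu> + \<alpha>) \<noteq> 0" by simp
    then have "\<mu> + \<alpha> \<in> expos V" using s by (auto simp: supp_in_def simp del: sh_add)
    then show "\<alpha> \<in> expos V" by simp
  qed
  moreover obtain C M where "\<And>\<alpha>. norm (sh \<mu> f \<alpha>) \<le> C * M ^ expo_deg \<alpha>"
    using g by (auto simp: geo_bounded_def)
  from this[of "\<mu> + _"] have "norm (f \<alpha>) \<le> (C * M ^ expo_deg \<mu>) * M ^ expo_deg \<alpha>" for \<alpha>
    by (simp add: power_add mult_ac)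
  then have "geo_bounded f" by (rule geo_boundedI)
  ultimately show ?thesis by (simp add: carrier_cps_iff[OF V])
qed


section \<open>The chart of the blowing-up\<close>

declare One_nat_def [simp del] Poly_Mapping.single_one [simp del]

definition chart_monom :: "nat \<Rightarrow> (nat \<Rightarrow> 'k::real_normed_field) \<Rightarrow> expo \<Rightarrow> expo \<Rightarrow> 'k" where
  "chart_monom n a \<alpha> = (\<Otimes>\<^bsub>cps {0..n}\<^esub>v\<in>{0..n}. blowup_chart n a v [^]\<^bsub>cps {0..n}\<^esub> lk \<alpha> v)"

abbreviation pullback :: "nat \<Rightarrow> (nat \<Rightarrow> 'k::real_normed_field) \<Rightarrow> (expo \<Rightarrow> 'k) \<Rightarrow> expo \<Rightarrow> 'k" where
  "pullback n a f \<equiv> cps_subst {0..n} f (blowup_chart n a)"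

abbreviation tpow :: "nat \<Rightarrow> expo" where
  "tpow \<equiv> sg 0"

lemma blowup_chart_carrier:
  assumes "v \<le> n"
  shows "blowup_chart n a v \<in> carrier (cps {0..n})"
proof -
  interpret R: cring "cps {0..n}" by (rule cring_cps) simp
  have "cps_var w \<in> carrier (cps {0..n})" if "w \<le> n" for w using that by (intro var_carrier) auto
  moreover have "cps_const c \<in> carrier (cps {0..n})" for c by (intro const_carrier) auto
  ultimately show ?thesis
    using assms unfolding blowup_chart_def by (auto simp del: cps_simps intro!: R.m_closed R.a_closed)
qed

lemma cmul_chart_0: "cmul (blowup_chart n a 0) f = sh (tpow 1) f"
  by (simp add: blowup_chart_def cmul_var)

lemma cmul_chart:
  "v \<noteq> 0 \<Longrightarrow> cmul (blowup_chart n a v) f = sh (tpow 1) (\<lambda>\<gamma>. a v * f \<gamma> + sh (sg v 1) f \<gamma>)"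
  by (simp add: blowup_chart_def cmul_assoc) (simp add: cmul_var cmul_add_left cmul_const)

lemma chart_monom_0: "chart_monom n a 0 = (\<lambda>\<alpha>. if \<alpha> = 0 then 1 else 0)"
proof -
  interpret R: cring "cps {0..n} :: (expo \<Rightarrow> 'a) ring" by (rule cring_cps) simp
  have "chart_monom n a 0 = \<one>\<^bsub>cps {0..n} :: (expo \<Rightarrow> 'a) ring\<^esub>"
    unfolding chart_monom_def by (rule R.finprod_one_eqI) simp
  then show ?thesis by simp
qed

lemma chart_monom_carrier: "chart_monom n a \<alpha> \<in> carrier (cps {0..n})"
proof -
  interpret R: cring "cps {0..n} :: (expo \<Rightarrow> 'a) ring" by (rule cring_cps) simp
  show ?thesis unfolding chart_monom_def
    by (rule R.finprod_closed) (auto simp del: cps_simps intro!: R.nat_pow_closed blowup_chart_carrier)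
qed

lemma chart_monom_step:
  assumes v: "v \<le> n"
  shows "chart_monom n a (sg v 1 + \<alpha>) = cmul (blowup_chart n a v) (chart_monom n a \<alpha>)"
proof -
  let ?R = "cps {0..n} :: (expo \<Rightarrow> 'a) ring"
  interpret R: cring ?R by (rule cring_cps) simp
  let ?c = "blowup_chart n a"
  have c: "?c w \<in> carrier ?R" if "w \<le> n" for w by (rule blowup_chart_carrier[OF that])
  have "chart_monom n a (sg v 1 + \<alpha>) =
    (\<Otimes>\<^bsub>?R\<^esub>w\<in>{0..n}. (if v = w then ?c w else \<one>\<^bsub>?R\<^esub>) \<otimes>\<^bsub>?R\<^esub> ?c w [^]\<^bsub>?R\<^esub> lk \<alpha> w)"
    unfolding chart_monom_def
  proof (rule R.finprod_cong')
    fix w assume w: "w \<in> {0..n}"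
    show "?c w [^]\<^bsub>?R\<^esub> lk (sg v 1 + \<alpha>) w = (if v = w then ?c w else \<one>\<^bsub>?R\<^esub>) \<otimes>\<^bsub>?R\<^esub> ?c w [^]\<^bsub>?R\<^esub> lk \<alpha> w"
    proof (cases "v = w")
      case True
      have "?c w [^]\<^bsub>?R\<^esub> (1 + lk \<alpha> w) = ?c w [^]\<^bsub>?R\<^esub> (1::nat) \<otimes>\<^bsub>?R\<^esub> ?c w [^]\<^bsub>?R\<^esub> lk \<alpha> w"
        using c w by (intro R.nat_pow_mult[symmetric]) auto
      with True c w show ?thesis by (simp add: lookup_add lookup_single del: cps_simps)
    next
      case False
      then show ?thesis using c w
        by (simp add: lookup_add lookup_single del: cps_simps)
    qed
  qed (use c in \<open>auto simp del: cps_simps intro!: R.m_closed\<close>)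
  also have "\<dots> = (\<Otimes>\<^bsub>?R\<^esub>w\<in>{0..n}. if v = w then ?c w else \<one>\<^bsub>?R\<^esub>) \<otimes>\<^bsub>?R\<^esub> chart_monom n a \<alpha>"
    unfolding chart_monom_def using c
    by (intro R.finprod_multf) (auto simp del: cps_simps)
  also have "(\<Otimes>\<^bsub>?R\<^esub>w\<in>{0..n}. if v = w then ?c w else \<one>\<^bsub>?R\<^esub>) = ?c v"
    using c v by (intro R.finprod_singleton) auto
  finally show ?thesis by simp
qed

lemma supp_in_carrier: "f \<in> carrier (cps {0..n}) \<Longrightarrow> supp_in {0..n} f"
  by (simp add: carrier_cps_iff)

lemma chart_monom_step_0: "chart_monom n a (tpow 1 + \<alpha>) = sh (tpow 1) (chart_monom n a \<alpha>)"
  by (simp add: chart_monom_step cmul_chart_0)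

lemma chart_monom_step_v:
  "v \<le> n \<Longrightarrow> v \<noteq> 0 \<Longrightarrow> chart_monom n a (sg v 1 + \<alpha>) =
    sh (tpow 1) (\<lambda>\<gamma>. a v * chart_monom n a \<alpha> \<gamma> + sh (sg v 1) (chart_monom n a \<alpha>) \<gamma>)"
  by (simp add: chart_monom_step cmul_chart)

text \<open>The monomial \<open>t\<^bsup>p\<^esup>X\<^bsup>q\<^esup>\<close> pulls back to \<open>t\<^bsup>p+|q|\<^esup>(a + X)\<^bsup>q\<^esup>\<close>.\<close>

lemma chart_monom_nonzero:
  assumes "\<alpha> \<in> expos {0..n}" and "chart_monom n a \<alpha> \<gamma> \<noteq> 0"
  shows "lk \<gamma> 0 = expo_deg \<alpha> \<and> (\<forall>l. l \<noteq> 0 \<longrightarrow> lk \<gamma> l \<le> lk \<alpha> l)"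
  using assms
proof (induction \<alpha> arbitrary: \<gamma> rule: expos_induct)
  case zero
  then show ?case by (simp add: chart_monom_0 split: if_splits)
next
  case (step v \<alpha>)
  show ?case
  proof (cases "v = 0")
    case True
    with step.prems obtain \<delta> where "\<gamma> = tpow 1 + \<delta>" "chart_monom n a \<alpha> \<delta> \<noteq> 0"
      by (auto simp: chart_monom_step_0 elim: sh_nonzeroE)
    with step.IH[of \<delta>] True show ?thesis by (auto simp: lookup_add lookup_single)
  next
    case False
    with step.prems step.hyps obtain \<delta> where \<delta>: "\<gamma> = tpow 1 + \<delta>"
      "a v * chart_monom n a \<alpha> \<delta> + sh (sg v 1) (chart_monom n a \<alpha>) \<delta> \<noteq> 0"
      by (auto simp: chart_monom_step_v elim: sh_nonzeroE)
    then have "chart_monom n a \<alpha> \<delta> \<noteq> 0 \<or> sh (sg v 1) (chart_monom n a \<alpha>) \<delta> \<noteq> 0" by auto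
    then consider "chart_monom n a \<alpha> \<delta> \<noteq> 0" | "sh (sg v 1) (chart_monom n a \<alpha>) \<delta> \<noteq> 0" by blast
    then show ?thesis
    proof cases
      case 1
      with step.IH[of \<delta>] False \<delta> show ?thesis
        by (auto simp: lookup_add lookup_single when_def intro: trans_le_add2)
    next
      case 2
      then obtain \<epsilon> where "\<delta> = sg v 1 + \<epsilon>" "chart_monom n a \<alpha> \<epsilon> \<noteq> 0" by (rule sh_nonzeroE)
      with step.IH[of \<epsilon>] False \<delta> show ?thesis
        by (auto simp: lookup_add lookup_single when_def)
    qed
  qed
qed

text \<open>If \<alpha> is the exponent of t^p X^q, this is the exponent of t^(p+|q|) X^q, the term
  of highest degree in the pull-back of that monomial.\<close>

definition top_expo :: "expo \<Rightarrow> expo" where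
  "top_expo \<alpha> = tpow (expo_deg \<alpha>) + (\<alpha> - tpow (lk \<alpha> 0))"

lemma lk_top_expo: "lk (top_expo \<alpha>) v = (if v = 0 then expo_deg \<alpha> else lk \<alpha> v)"
  by (simp add: top_expo_def lookup_add lookup_minus lookup_single when_def)

lemma top_expo_step:
  "top_expo (tpow 1 + \<alpha>) = tpow 1 + top_expo \<alpha>"
  "v \<noteq> 0 \<Longrightarrow> top_expo (sg v 1 + \<alpha>) = tpow 1 + (sg v 1 + top_expo \<alpha>)"
  by (rule poly_mapping_eqI, simp add: lk_top_expo lookup_add lookup_single when_def)+

lemma chart_monom_top: "\<alpha> \<in> expos {0..n} \<Longrightarrow> chart_monom n a \<alpha> (top_expo \<alpha>) = 1"
proof (induction \<alpha> rule: expos_induct)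
  case zero
  have "top_expo 0 = 0" by (rule poly_mapping_eqI) (simp add: lk_top_expo)
  then show ?case by (simp add: chart_monom_0)
next
  case (step v \<alpha>)
  show ?case
  proof (cases "v = 0")
    case True
    then show ?thesis using step.IH by (simp add: chart_monom_step_0 top_expo_step)
  next
    case False
    have "chart_monom n a \<alpha> (sg v 1 + top_expo \<alpha>) = 0"
    proof (rule ccontr)
      assume "chart_monom n a \<alpha> (sg v 1 + top_expo \<alpha>) \<noteq> 0"
      then have "lk (sg v 1 + top_expo \<alpha>) v \<le> lk \<alpha> v"
        using chart_monom_nonzero[OF step.hyps(2)] False by blast
      then show False using False by (simp add: lookup_add lookup_single lk_top_expo)
    qed
    then show ?thesis using step False
      by (simp add: chart_monom_step_v top_expo_step)
  qed
qed

lemma sh_bound: "0 \<le> C \<Longrightarrow> (\<And>\<gamma>. norm (f \<gamma> :: 'k::real_normed_field) \<le> C) \<Longrightarrow> norm (sh \<mu> f \<gamma>) \<le> C"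
  by (simp add: sh_def)

text \<open>Multiplication by a component t or t(a_v + X_v) of the chart enlarges the bound on the
  coefficients by a factor at most \<open>1 + norm (a v)\<close>.\<close>

lemma chart_monom_bound:
  assumes "\<alpha> \<in> expos {0..n}" and B: "1 \<le> B" "\<And>v. v \<le> n \<Longrightarrow> 1 + norm (a v) \<le> B"
  shows "norm (chart_monom n a \<alpha> \<gamma>) \<le> B ^ expo_deg \<alpha>"
  using assms(1)
proof (induction \<alpha> arbitrary: \<gamma> rule: expos_induct)
  case zero
  then show ?case by (simp add: chart_monom_0)
next
  case (step v \<alpha>)
  have pos: "0 \<le> B ^ expo_deg \<alpha>" using B by simp
  show ?case
  proof (cases "v = 0")
    case True
    have "norm (sh (tpow 1) (chart_monom n a \<alpha>) \<gamma>) \<le> B ^ expo_deg \<alpha>"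
      by (rule sh_bound[OF pos step.IH])
    also have "\<dots> \<le> B ^ Suc (expo_deg \<alpha>)" using B by (intro power_increasing) auto
    finally show ?thesis using True by (simp add: chart_monom_step_0 power_add)
  next
    case False
    have "norm (sh (tpow 1) (\<lambda>\<gamma>. a v * chart_monom n a \<alpha> \<gamma> + sh (sg v 1) (chart_monom n a \<alpha>) \<gamma>) \<gamma>)
        \<le> B * B ^ expo_deg \<alpha>"
    proof (rule sh_bound)
      fix \<gamma>
      have "norm (a v * chart_monom n a \<alpha> \<gamma> + sh (sg v 1) (chart_monom n a \<alpha>) \<gamma>)
        \<le> norm (a v) * B ^ expo_deg \<alpha> + B ^ expo_deg \<alpha>"
        using step.IH sh_bound[OF pos step.IH]
        by (intro order_trans[OF norm_triangle_ineq] add_mono) (auto simp: norm_mult intro!: mult_left_mono)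
      also have "\<dots> = (1 + norm (a v)) * B ^ expo_deg \<alpha>" by (simp add: algebra_simps)
      also have "\<dots> \<le> B * B ^ expo_deg \<alpha>"
        using step.hyps pos B by (intro mult_right_mono) auto
      finally show "norm (a v * chart_monom n a \<alpha> \<gamma> + sh (sg v 1) (chart_monom n a \<alpha>) \<gamma>) \<le> B * B ^ expo_deg \<alpha>" .
    qed (use B in auto)
    then show ?thesis using False step.hyps by (simp add: chart_monom_step_v power_add)
  qed
qed

text \<open>Every term of \<open>chart_monom n a \<alpha>\<close> has t-exponent
  \<open>expo_deg \<alpha>\<close>, so only the part of \<open>f\<close> of degree
  \<open>lk \<gamma> 0\<close> contributes. The free bound \<open>m\<close> allows a common index
  set for several \<gamma>.\<close>

lemma pullback_eq:
  assumes "lk \<gamma> 0 \<le> m"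
  shows "pullback n a f \<gamma> = (\<Sum>\<alpha>\<in>{\<alpha> \<in> expos {0..n}. expo_deg \<alpha> \<le> m}. f \<alpha> * chart_monom n a \<alpha> \<gamma>)"
proof -
  let ?S = "\<lambda>m. \<Sum>\<alpha>\<in>{\<alpha> \<in> expos {0..n}. expo_deg \<alpha> \<le> m}. f \<alpha> * chart_monom n a \<alpha> \<gamma>"
  have *: "?S m = (\<Sum>\<alpha>\<in>{\<alpha> \<in> expos {0..n}. expo_deg \<alpha> = lk \<gamma> 0}. f \<alpha> * chart_monom n a \<alpha> \<gamma>)" if "lk \<gamma> 0 \<le> m" for m
    using that chart_monom_nonzero[of _ n a \<gamma>]
    by (intro sum.mono_neutral_right) (auto simp: finite_expos_deg_le)
  have "pullback n a f \<gamma> = ?S (expo_deg \<gamma>)"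
    unfolding cps_subst_def expos_def chart_monom_def by simp
  then show ?thesis using *[OF assms] *[OF lk_le_expo_deg] by simp
qed

lemma pullback_eq':
  "pullback n a f \<gamma> = (\<Sum>\<alpha>\<in>{\<alpha> \<in> expos {0..n}. expo_deg \<alpha> = lk \<gamma> 0}. f \<alpha> * chart_monom n a \<alpha> \<gamma>)"
  unfolding pullback_eq[OF order_refl]
  using chart_monom_nonzero[of _ n a \<gamma>]
  by (intro sum.mono_neutral_right) (auto simp: finite_expos_deg_le)

lemma pullback_linear:
  "pullback n a (\<lambda>\<alpha>. f \<alpha> + g \<alpha>) = (\<lambda>\<alpha>. pullback n a f \<alpha> + pullback n a g \<alpha>)"
  "pullback n a (\<lambda>\<alpha>. c * f \<alpha>) = (\<lambda>\<alpha>. c * pullback n a f \<alpha>)"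
  by (rule ext, simp only: pullback_eq', simp add: ring_distribs sum.distrib sum_distrib_left mult.assoc)+

lemma pullback_sh:
  assumes v: "v \<le> n"
  shows "pullback n a (sh (sg v 1) f) = cmul (blowup_chart n a v) (pullback n a f)"
proof
  fix \<gamma>
  define m where "m = expo_deg \<gamma>"
  let ?E = "\<lambda>m. {\<alpha> \<in> expos {0..n}. expo_deg \<alpha> \<le> m}"
  have "pullback n a (sh (sg v 1) f) \<gamma> = (\<Sum>\<alpha>\<in>?E (Suc m). sh (sg v 1) f \<alpha> * chart_monom n a \<alpha> \<gamma>)"
    by (rule pullback_eq) (simp add: m_def lk_le_expo_deg le_SucI)
  also have "\<dots> = (\<Sum>\<alpha>\<in>(+) (sg v 1) ` ?E m. sh (sg v 1) f \<alpha> * chart_monom n a \<alpha> \<gamma>)"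
  proof (rule sum.mono_neutral_right)
    show "\<forall>\<alpha>\<in>?E (Suc m) - (+) (sg v 1) ` ?E m. sh (sg v 1) f \<alpha> * chart_monom n a \<alpha> \<gamma> = 0"
    proof
      fix \<alpha> assume \<alpha>: "\<alpha> \<in> ?E (Suc m) - (+) (sg v 1) ` ?E m"
      have "\<not> expo_le (sg v 1) \<alpha>"
      proof
        assume "expo_le (sg v 1) \<alpha>"
        then obtain \<beta> where "\<alpha> = sg v 1 + \<beta>" by (auto simp: expo_le_iff)
        with \<alpha> show False by auto
      qed
      then show "sh (sg v 1) f \<alpha> * chart_monom n a \<alpha> \<gamma> = 0" by (simp add: sh_eq_0)
    qed
  qed (use v in \<open>auto simp: finite_expos_deg_le\<close>)
  also have "\<dots> = (\<Sum>\<beta>\<in>?E m. f \<beta> * cmul (blowup_chart n a v) (chart_monom n a \<beta>) \<gamma>)"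
    using v by (subst sum.reindex) (auto simp: inj_on_def chart_monom_step)
  also have "\<dots> = (\<Sum>\<delta> | expo_le \<delta> \<gamma>. blowup_chart n a v \<delta> * (\<Sum>\<beta>\<in>?E m. f \<beta> * chart_monom n a \<beta> (\<gamma> - \<delta>)))"
    unfolding cmul_alt sum_distrib_left by (subst sum.swap) (simp add: mult_ac)
  \<comment> \<open>All \<open>\<gamma> - \<delta>\<close> have t-exponent at most \<open>m\<close>,
    so the same index set computes the pull-back at each of them.\<close>
  also have "\<dots> = cmul (blowup_chart n a v) (pullback n a f) \<gamma>"
    unfolding cmul_alt
  proof (rule sum.cong[OF refl])
    fix \<delta>
    have "lk (\<gamma> - \<delta>) 0 \<le> m"
      using lk_le_expo_deg[of \<gamma> 0] by (simp add: lookup_minus m_def)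
    then show "blowup_chart n a v \<delta> * (\<Sum>\<beta>\<in>?E m. f \<beta> * chart_monom n a \<beta> (\<gamma> - \<delta>)) =
      blowup_chart n a v \<delta> * pullback n a f (\<gamma> - \<delta>)" by (simp add: pullback_eq)
  qed
  finally show "pullback n a (sh (sg v 1) f) \<gamma> = cmul (blowup_chart n a v) (pullback n a f) \<gamma>" .
qed

lemma pullback_sh_0: "pullback n a (sh (tpow 1) f) = sh (tpow 1) (pullback n a f)"
  using pullback_sh[where v = 0 and n = n and a = a and f = f] by (simp add: cmul_chart_0)

text \<open>X_v - a_v t pulls back to t X_v. A multiplication by X_v on the blowing-up thus comes
  from a multiplication downstairs, at the price of one factor t.\<close>

lemma pullback_sh_v:
  "v \<le> n \<Longrightarrow> v \<noteq> 0 \<Longrightarrow> pullback n a (\<lambda>\<alpha>. sh (sg v 1) f \<alpha> + - a v * sh (tpow 1) f \<alpha>) =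
    sh (tpow 1) (sh (sg v 1) (pullback n a f))"
  unfolding pullback_linear pullback_sh_0
  by (simp add: pullback_sh cmul_chart sh_linear fun_eq_iff)

lemma pullback_sh_tpow: "pullback n a (sh (tpow k) f) = sh (tpow k) (pullback n a f)"
proof (induction k)
  case (Suc k)
  have "tpow (Suc k) = tpow 1 + tpow k" by (simp add: single_add[symmetric] One_nat_def)
  then show ?case using Suc by (simp add: sh_sh[symmetric] pullback_sh_0)
qed simp

text \<open>The coefficient at \<gamma> is a sum over the exponents of degree m =
  \<open>lk \<gamma> 0\<close>; their number, the coefficients of \<open>f\<close> and those of the
  chart monomials all grow at most geometrically in m.\<close>

lemma pullback_carrier:
  assumes f: "f \<in> carrier (cps {0..n})"
  shows "pullback n a f \<in> carrier (cps {0..n})"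
proof -
  have fV: "supp_in {0..n} f" and "geo_bounded f" using f by (auto simp: carrier_cps_iff)
  then obtain C M where CM: "0 \<le> C" "1 \<le> M" "\<And>\<alpha>. norm (f \<alpha>) \<le> C * M ^ expo_deg \<alpha>"
    by (auto simp: geo_bounded_def)
  define B where "B = 1 + (\<Sum>v\<le>n. norm (a v))"
  have B: "1 \<le> B" "1 + norm (a v) \<le> B" if "v \<le> n" for v
    using that member_le_sum[of v "{..n}" "\<lambda>v. norm (a v)"] by (auto simp: B_def sum_nonneg)
  have B1: "1 \<le> B" using B(1)[of 0] by simp
  have "supp_in {0..n} (pullback n a f)"
    unfolding supp_in_def
  proof safe
    fix \<gamma> assume "pullback n a f \<gamma> \<noteq> 0"
    then obtain \<alpha> where "chart_monom n a \<alpha> \<gamma> \<noteq> 0"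
      unfolding pullback_eq' by (metis (no_types, lifting) mult_zero_right sum.neutral)
    then show "\<gamma> \<in> expos {0..n}" using supp_in_carrier[OF chart_monom_carrier] by (auto simp: supp_in_def)
  qed
  moreover have "geo_bounded (pullback n a f)"
  proof (rule geo_boundedI)
    fix \<gamma>
    let ?m = "lk \<gamma> 0" let ?E = "{\<alpha> \<in> expos {0..n}. expo_deg \<alpha> = ?m}"
    have "norm (pullback n a f \<gamma>) \<le> (\<Sum>\<alpha>\<in>?E. norm (f \<alpha> * chart_monom n a \<alpha> \<gamma>))"
      unfolding pullback_eq' by (rule norm_sum)
    also have "\<dots> \<le> (\<Sum>\<alpha>\<in>?E. (C * M ^ ?m) * B ^ ?m)"
    proof (rule sum_mono)
      fix \<alpha> assume \<alpha>: "\<alpha> \<in> ?E"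
      then have "norm (chart_monom n a \<alpha> \<gamma>) \<le> B ^ ?m" using chart_monom_bound[of \<alpha> n B a \<gamma>] B by auto
      moreover have "norm (f \<alpha>) \<le> C * M ^ ?m" using CM(3)[of \<alpha>] \<alpha> by simp
      ultimately show "norm (f \<alpha> * chart_monom n a \<alpha> \<gamma>) \<le> (C * M ^ ?m) * B ^ ?m"
        unfolding norm_mult using CM(1,2) by (intro mult_mono) auto
    qed
    also have "\<dots> = real (card ?E) * ((C * M ^ ?m) * B ^ ?m)" by simp
    also have "\<dots> \<le> (2 ^ card {0..n} * 2 ^ ?m) * ((C * M ^ ?m) * B ^ ?m)"
      using CM B1 by (intro mult_right_mono card_expos_deg_le) auto
    also have "\<dots> = (2 ^ card {0..n} * C) * (2 * M * B) ^ ?m"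
      by (simp add: power_mult_distrib mult_ac)
    also have "\<dots> \<le> (2 ^ card {0..n} * C) * (2 * M * B) ^ expo_deg \<gamma>"
    proof (intro mult_left_mono power_increasing)
      have "1 * 1 * 1 \<le> 2 * M * B" using CM B1 by (intro mult_mono) auto
      then show "1 \<le> 2 * M * B" by simp
    qed (use CM lk_le_expo_deg in auto)
    finally show "norm (pullback n a f \<gamma>) \<le> (2 ^ card {0..n} * C) * (2 * M * B) ^ expo_deg \<gamma>" .
  qed
  ultimately show ?thesis by (simp add: carrier_cps_iff)
qed

text \<open>The part of t-exponent m of the pull-back is t^m f_m(1, a + X), with f_m the homogeneous
  part of degree m of \<open>f\<close>; dehomogenizing and translating lose nothing.\<close>

lemma pullback_order:
  assumes f: "supp_in {0..n} f" and z: "\<And>\<gamma>. lk \<gamma> 0 = m \<Longrightarrow> pullback n a f \<gamma> = 0" and m: "expo_deg \<alpha> = m"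
  shows "f \<alpha> = 0"
proof (rule ccontr)
  assume nz: "f \<alpha> \<noteq> 0"
  let ?A = "\<lambda>\<alpha>. \<alpha> \<in> expos {0..n} \<and> expo_deg \<alpha> = m \<and> f \<alpha> \<noteq> 0"
  have "?A \<alpha>" using nz f m by (auto simp: supp_in_def)
  \<comment> \<open>Least t-exponent means largest degree in X, so no other monomial of degree m in
    \<open>f\<close> contributes to the coefficient at \<open>top_expo \<beta>\<close>.\<close>
  then obtain \<beta> where \<beta>: "?A \<beta>" and min: "\<And>\<gamma>. ?A \<gamma> \<Longrightarrow> lk \<beta> 0 \<le> lk \<gamma> 0"
    using ex_has_least_nat[of ?A \<alpha> "\<lambda>\<alpha>. lk \<alpha> 0"] by blast
  let ?E = "{\<alpha> \<in> expos {0..n}. expo_deg \<alpha> = m}"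
  have fin: "finite ?E" by (rule finite_subset[OF _ finite_expos_deg_le[of "{0..n}" m]]) auto
  have top: "lk (top_expo \<beta>) 0 = m" using \<beta> by (simp add: lk_top_expo)
  have "f \<gamma> * chart_monom n a \<gamma> (top_expo \<beta>) = 0" if \<gamma>: "\<gamma> \<in> ?E - {\<beta>}" for \<gamma>
  proof (rule ccontr)
    assume nz: "f \<gamma> * chart_monom n a \<gamma> (top_expo \<beta>) \<noteq> 0"
    then have "lk \<beta> 0 \<le> lk \<gamma> 0" using \<gamma> by (intro min) auto
    moreover have "\<forall>l. l \<noteq> 0 \<longrightarrow> lk \<beta> l \<le> lk \<gamma> l"
      using chart_monom_nonzero[of \<gamma> n a "top_expo \<beta>"] nz \<gamma> by (auto simp: lk_top_expo)
    ultimately have "expo_le \<beta> \<gamma>" unfolding expo_le_def by metis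
    then have "\<beta> = \<gamma>" using expo_le_deg_eq \<gamma> \<beta> by auto
    then show False using \<gamma> by auto
  qed
  then have "(\<Sum>\<gamma>\<in>?E - {\<beta>}. f \<gamma> * chart_monom n a \<gamma> (top_expo \<beta>)) = 0"
    by (intro sum.neutral ballI)
  then have "pullback n a f (top_expo \<beta>) = f \<beta> * chart_monom n a \<beta> (top_expo \<beta>)"
    unfolding pullback_eq' top using fin \<beta> by (subst sum.remove[of _ \<beta>]) auto
  then show False using z[OF top] \<beta> chart_monom_top[of \<beta> n a] by simp
qed


section \<open>The strict transform as an adic closure\<close>

text \<open>Here t^D g has to be the pull-back of a single element of \<open>J\<close>, not just a
  member of the ideal generated by pull-backs. The level \<open>D\<close> is kept as data: it bounds
  the degree on t = 0 and measures the cost of multiplications.\<close>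

definition divided :: "nat \<Rightarrow> (nat \<Rightarrow> 'k::real_normed_field) \<Rightarrow> (expo \<Rightarrow> 'k) set \<Rightarrow> nat \<Rightarrow> (expo \<Rightarrow> 'k) set" where
  "divided n a J D = {g \<in> carrier (cps {0..n}). \<exists>f\<in>J. sh (tpow D) g = pullback n a f}"

lemma dividedE:
  assumes "g \<in> divided n a J D"
  obtains f where "f \<in> J" "sh (tpow D) g = pullback n a f" "g \<in> carrier (cps {0..n})"
  using assms by (auto simp: divided_def)

lemma dividedI:
  "f \<in> J \<Longrightarrow> sh (tpow D) g = pullback n a f \<Longrightarrow> g \<in> carrier (cps {0..n}) \<Longrightarrow> g \<in> divided n a J D"
  by (auto simp: divided_def)

lemma tpow_add: "tpow (k + l) = tpow k + tpow l"
  by (simp add: single_add)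

lemma sh_commute: "sh \<mu> (sh \<nu> f) = sh \<nu> (sh \<mu> f)"
  by (simp add: sh_sh add.commute)

context
  fixes n :: nat and a :: "nat \<Rightarrow> 'k::real_normed_field" and J :: "(expo \<Rightarrow> 'k) set"
  assumes J: "lideal {0..n} J"
begin

lemma divided_mono: "g \<in> divided n a J D \<Longrightarrow> D \<le> D' \<Longrightarrow> g \<in> divided n a J D'"
proof -
  assume "g \<in> divided n a J D" "D \<le> D'"
  then obtain f k where f: "f \<in> J" "sh (tpow D) g = pullback n a f" "g \<in> carrier (cps {0..n})"
    and D': "D' = k + D" by (auto simp: le_iff_add add.commute elim: dividedE)
  show ?thesis
  proof (rule dividedI)
    show "sh (tpow k) f \<in> J" by (rule lidealD(5)[OF J]) (auto simp: f)
    show "sh (tpow D') g = pullback n a (sh (tpow k) f)"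
      unfolding D' tpow_add pullback_sh_tpow f(2)[symmetric] by (simp add: sh_sh)
  qed fact
qed

lemma divided_add:
  assumes "g \<in> divided n a J D" "h \<in> divided n a J D"
  shows "(\<lambda>\<alpha>. g \<alpha> + c * h \<alpha>) \<in> divided n a J D"
proof -
  obtain f where f: "f \<in> J" "sh (tpow D) g = pullback n a f" "g \<in> carrier (cps {0..n})"
    using assms(1) by (rule dividedE)
  obtain f' where f': "f' \<in> J" "sh (tpow D) h = pullback n a f'" "h \<in> carrier (cps {0..n})"
    using assms(2) by (rule dividedE)
  note C = lideal_carrier[of "{0..n}"]
  show ?thesis
  proof (rule dividedI)
    show "(\<lambda>\<alpha>. f \<alpha> + c * f' \<alpha>) \<in> J" by (intro lidealD[OF J] f f')
    show "sh (tpow D) (\<lambda>\<alpha>. g \<alpha> + c * h \<alpha>) = pullback n a (\<lambda>\<alpha>. f \<alpha> + c * f' \<alpha>)"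
      by (simp add: sh_linear pullback_linear f f')
    show "(\<lambda>\<alpha>. g \<alpha> + c * h \<alpha>) \<in> carrier (cps {0..n})"
      using f f' by (intro lidealD[OF C]) auto
  qed
qed

lemma divided_zero: "(\<lambda>\<alpha>. 0) \<in> divided n a J D"
proof (rule dividedI)
  show "(\<lambda>\<alpha>. 0) \<in> J" by (rule lidealD(2)[OF J])
  show "(\<lambda>\<alpha>. 0) \<in> carrier (cps {0..n})" by (rule lidealD(2)[OF lideal_carrier]) simp
  show "sh (tpow D) (\<lambda>\<alpha>. 0) = pullback n a (\<lambda>\<alpha>. 0)" by (simp add: fun_eq_iff sh_def pullback_eq')
qed

text \<open>Multiplication by X_v costs one level, through X_v - a_v t. Multiplication by t costs
  none, but is counted as one so that the bound is the degree.\<close>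

lemma divided_sh:
  assumes "\<mu> \<in> expos {0..n}" and g: "g \<in> divided n a J D"
  shows "sh \<mu> g \<in> divided n a J (expo_deg \<mu> + D)"
  using assms(1)
proof (induction \<mu> rule: expos_induct)
  case zero
  then show ?case using g by simp
next
  case (step v \<mu>)
  obtain f where f: "f \<in> J" "sh (tpow (expo_deg \<mu> + D)) (sh \<mu> g) = pullback n a f"
    "sh \<mu> g \<in> carrier (cps {0..n})"
    using step.IH by (rule dividedE)
  have c: "sh (sg v 1 + \<mu>) g \<in> carrier (cps {0..n})"
    using f(3) step.hyps(1) by (simp add: sh_carrier sh_sh[symmetric])
  have T: "expo_deg (sg v 1 + \<mu>) + D = 1 + (expo_deg \<mu> + D)" by simp
  have t: "tpow 1 \<in> expos {0..n}" "sg v 1 \<in> expos {0..n}" using step.hyps by auto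
  show ?case
  proof (cases "v = 0")
    case True
    have "sh (tpow 1) f \<in> J" by (intro lidealD[OF J] t f)
    moreover have "sh (tpow (expo_deg \<mu> + D)) (sh (sg v 1 + \<mu>) g) = pullback n a (sh (tpow 1) f)"
      unfolding pullback_sh_0 f(2)[symmetric] by (simp add: True sh_sh ac_simps)
    ultimately have "sh (sg v 1 + \<mu>) g \<in> divided n a J (expo_deg \<mu> + D)"
      using c by (rule dividedI)
    then show ?thesis by (rule divided_mono) simp
  next
    case False
    have "(\<lambda>\<alpha>. sh (sg v 1) f \<alpha> + - a v * sh (tpow 1) f \<alpha>) \<in> J"
      by (intro lidealD[OF J] t f)
    moreover have "sh (tpow (1 + (expo_deg \<mu> + D))) (sh (sg v 1 + \<mu>) g) =
      pullback n a (\<lambda>\<alpha>. sh (sg v 1) f \<alpha> + - a v * sh (tpow 1) f \<alpha>)"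
      using False step.hyps
      by (subst pullback_sh_v) (auto simp: f(2)[symmetric] sh_sh tpow_add ac_simps)
    ultimately show ?thesis using c unfolding T by (rule dividedI)
  qed
qed

text \<open>The same element of \<open>J\<close> serves; one more factor t is divided out of its
  pull-back.\<close>

lemma divided_quot:
  assumes "sh (tpow 1) g \<in> divided n a J D"
  shows "g \<in> divided n a J (D + 1)"
proof -
  obtain f where f: "f \<in> J" "sh (tpow D) (sh (tpow 1) g) = pullback n a f" "sh (tpow 1) g \<in> carrier (cps {0..n})"
    using assms by (rule dividedE)
  show ?thesis
    using f sh_carrierD[OF _ f(3)] by (intro dividedI[OF f(1)]) (auto simp: sh_sh tpow_add)
qed

lemma lideal_Union_divided: "lideal {0..n} (\<Union>D. divided n a J D)"
  unfolding lideal_def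
proof (intro conjI ballI allI)
  let ?K = "\<Union>D. divided n a J D"
  show "?K \<subseteq> carrier (cps {0..n})" by (auto simp: divided_def)
  show "(\<lambda>\<alpha>. 0) \<in> ?K" using divided_zero by auto
  fix f assume "f \<in> ?K"
  then obtain D where D: "f \<in> divided n a J D" by auto
  show "(\<lambda>\<alpha>. c * f \<alpha>) \<in> ?K" for c
    using divided_add[OF divided_zero D, of c] by auto
  show "sh \<mu> f \<in> ?K" if "\<mu> \<in> expos {0..n}" for \<mu>
    using divided_sh[OF that D] by auto
  fix g assume "g \<in> ?K"
  then obtain D' where D': "g \<in> divided n a J D'" by auto
  show "(\<lambda>\<alpha>. f \<alpha> + g \<alpha>) \<in> ?K"
    using divided_add[OF divided_mono[OF D, of "max D D'"] divided_mono[OF D', of "max D D'"], of 1] by auto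
qed

text \<open>On t = 0 an element of level \<open>D\<close> is f_D(1, a + X), where f_D is homogeneous
  of degree \<open>D\<close>.\<close>

lemma divided_restrict_deg:
  assumes "h \<in> divided n a J D" "lk \<beta> 0 = 0" "h \<beta> \<noteq> 0"
  shows "expo_deg \<beta> \<le> D"
proof -
  obtain f where f: "sh (tpow D) h = pullback n a f" using assms(1) by (rule dividedE)
  have "pullback n a f (tpow D + \<beta>) \<noteq> 0" using assms(3) by (simp add: f[symmetric])
  then obtain \<alpha> where \<alpha>: "\<alpha> \<in> expos {0..n}" "expo_deg \<alpha> = D" "chart_monom n a \<alpha> (tpow D + \<beta>) \<noteq> 0"
    unfolding pullback_eq' using assms(2)
    by (auto simp: lookup_add elim!: sum.not_neutral_contains_not_neutral)
  have "lk \<beta> v \<le> lk \<alpha> v" for v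
    using chart_monom_nonzero[OF \<alpha>(1,3)] assms(2) by (cases "v = 0") (auto simp: lookup_add lookup_single)
  then show ?thesis using expo_deg_mono[of \<beta> \<alpha>] \<alpha> by (simp add: expo_le_def)
qed

text \<open>A uniform Artin--Rees bound. The restriction to \<open>t = 0\<close> of an element \<open>h\<close> of level \<open>D\<close> is a
  polynomial of degree at most \<open>D\<close>. With \<open>b\<close> its initial exponent, Dickson's lemma for the pairs
  \<open>(D - |b|, b)\<close> provides finitely many elements whose multiples, of level at most \<open>D\<close>, reduce
  \<open>h\<close> to \<open>0\<close> in finitely many steps.\<close>

lemma divided_artin_rees:
  "\<exists>c. \<forall>D k. \<forall>h\<in>divided n a J D. (\<forall>\<beta>. lk \<beta> 0 = 0 \<and> h \<beta> \<noteq> 0 \<longrightarrow> k < expo_deg \<beta>) \<longrightarrow>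
     (\<exists>h'\<in>divided n a J D. (\<forall>\<beta>. lk \<beta> 0 = 0 \<longrightarrow> h' \<beta> = h \<beta>) \<and> (\<forall>\<beta>. h' \<beta> \<noteq> 0 \<longrightarrow> k < expo_deg \<beta> + c))"
proof -
  \<comment> \<open>The initial exponent of the restriction of \<open>h\<close> to t = 0.\<close>
  define lead0 where "lead0 h b \<longleftrightarrow> lk b 0 = 0 \<and> h b \<noteq> 0 \<and>
    (\<forall>\<beta>. lk \<beta> 0 = 0 \<and> h \<beta> \<noteq> 0 \<longrightarrow> rank n b \<le> rank n \<beta>)" for h :: "expo \<Rightarrow> 'k" and b
  \<comment> \<open>As b does not involve t, the coordinate of t is free to record
    \<open>D - expo_deg b\<close>, and one exponent encodes the pair. The subtraction is not
    truncated, since \<open>expo_deg b \<le> D\<close>.\<close>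
  define S where "S = {tpow (D - expo_deg b) + b | D b h. h \<in> divided n a J D \<and> lead0 h b}"
  have supp: "\<beta> \<in> expos {0..n}" if "h \<in> divided n a J D" "h \<beta> \<noteq> 0" for h D \<beta>
    using that supp_in_carrier by (auto simp: divided_def supp_in_def)
  have "S \<subseteq> expos {0..n}"
    using supp by (auto simp: S_def lead0_def)
  then obtain B where B: "finite B" "B \<subseteq> S" "\<And>\<alpha>. \<alpha> \<in> S \<Longrightarrow> \<exists>\<beta>\<in>B. expo_le \<beta> \<alpha>"
    using dickson[of "{0..n}" S] by auto
  define c where "c = Max (insert 0 (expo_deg ` B))"
  have c: "expo_deg s \<le> c" if "s \<in> B" for s
    unfolding c_def using that B by (intro Max_ge) auto
  have main: "\<exists>h'\<in>divided n a J D. (\<forall>\<beta>. lk \<beta> 0 = 0 \<longrightarrow> h' \<beta> = h \<beta>) \<and> (\<forall>\<beta>. h' \<beta> \<noteq> 0 \<longrightarrow> k < expo_deg \<beta> + c)"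
    if "h \<in> divided n a J D" "\<And>\<beta>. lk \<beta> 0 = 0 \<Longrightarrow> h \<beta> \<noteq> 0 \<Longrightarrow> k < expo_deg \<beta> \<and> r \<le> rank n \<beta>" for D k h r
  proof -
    \<comment> \<open>On t = 0 an element of level \<open>D\<close> has degree at most
      \<open>D\<close>, hence only exponents of rank below \<open>R\<close>; the induction on
      \<open>R - r\<close> therefore ends with a zero restriction.\<close>
    define R where "R = Suc (Max (rank n ` {\<beta> \<in> expos {0..n}. expo_deg \<beta> \<le> D}))"
    have R: "rank n \<beta> < R" if "\<beta> \<in> expos {0..n}" "expo_deg \<beta> \<le> D" for \<beta>
      unfolding R_def less_Suc_eq_le using that by (intro Max_ge) (auto simp: finite_expos_deg_le)
    show ?thesis
      using that
    proof (induction "R - r" arbitrary: r h)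
      case 0
      have "h \<beta> = 0" if "lk \<beta> 0 = 0" for \<beta>
      proof (rule ccontr)
        assume nz: "h \<beta> \<noteq> 0"
        then have "rank n \<beta> < R"
          using 0 that by (intro R supp[of h] divided_restrict_deg[of h]) auto
        moreover have "r \<le> rank n \<beta>" using 0(3)[OF that nz] by simp
        ultimately show False using 0(1) by simp
      qed
      then show ?case using divided_zero by (intro bexI[of _ "\<lambda>\<alpha>. 0"]) auto
    next
      case (Suc d)
      have d: "d = R - Suc r" using Suc.hyps(2) by simp
      show ?case
      proof (cases "\<exists>b. lk b 0 = 0 \<and> h b \<noteq> 0 \<and> rank n b = r")
        case False
        show ?thesis
        proof (rule Suc.hyps(1)[OF d Suc.prems(1)])
          fix \<beta> assume \<beta>: "lk \<beta> 0 = 0" "h \<beta> \<noteq> 0"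
          then have "rank n \<beta> \<noteq> r" using False by blast
          then show "k < expo_deg \<beta> \<and> Suc r \<le> rank n \<beta>" using Suc.prems(2)[OF \<beta>] by simp
        qed
      next
        case True
        then obtain b where b: "lk b 0 = 0" "h b \<noteq> 0" "rank n b = r" by auto
        then have lead: "lead0 h b" using Suc.prems by (auto simp: lead0_def)
        then have "tpow (D - expo_deg b) + b \<in> S" using Suc.prems by (auto simp: S_def)
        then obtain s where s: "s \<in> B" "expo_le s (tpow (D - expo_deg b) + b)" using B(3) by blast
        then obtain D' b' h' where h': "s = tpow (D' - expo_deg b') + b'" "h' \<in> divided n a J D'" "lead0 h' b'"
          using B(2) by (auto simp: S_def)
        have b': "lk b' 0 = 0" "h' b' \<noteq> 0" using h'(3) by (auto simp: lead0_def)
        \<comment> \<open>Once b is written as \<mu> + b', this reads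
          \<open>expo_deg \<mu> + D' \<le> D\<close>: the multiple of \<open>h'\<close> that cancels
          the initial term stays within level \<open>D\<close>.\<close>
        have le: "D' - expo_deg b' \<le> D - expo_deg b"
          using s(2) b b' unfolding h'(1) expo_le_def by (auto simp: lookup_add dest: spec[of _ 0])
        have "lk b' v \<le> lk b v" for v
          using s(2) b b' unfolding h'(1) expo_le_def
          by (cases "v = 0") (auto simp: lookup_add lookup_single dest!: spec[of _ v])
        then obtain \<mu> where \<mu>: "b = \<mu> + b'" by (metis add.commute expo_le_def expo_le_iff)
        have degs: "expo_deg b \<le> D" "expo_deg b' \<le> D'"
          using divided_restrict_deg b b' h' Suc.prems by auto
        have bE: "b \<in> expos {0..n}" using supp[OF Suc.prems(1) b(2)] .
        then have E: "\<mu> \<in> expos {0..n}" "b' \<in> expos {0..n}" using \<mu> by auto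
        have \<mu>0: "lk \<mu> 0 = 0" using b(1) \<mu> by (simp add: lookup_add)
        define u where "u = (\<lambda>\<alpha>. (h b / h' b') * sh \<mu> h' \<alpha>)"
        have sh: "sh \<mu> h' \<in> divided n a J D"
          by (rule divided_mono[OF divided_sh[OF E(1) h'(2)]]) (use le degs \<mu> in auto)
        have u: "u \<in> divided n a J D"
          using divided_add[OF divided_zero sh, of "h b / h' b'"] by (simp only: u_def add_0)
        define h2 where "h2 = (\<lambda>\<alpha>. h \<alpha> + (-1) * u \<alpha>)"
        have h2: "h2 \<in> divided n a J D"
          unfolding h2_def by (rule divided_add[OF Suc.prems(1) u])
        have "h2 b = 0" using b'(2) by (simp add: h2_def u_def) (simp add: \<mu>)
        have bound: "k < expo_deg \<beta> \<and> Suc r \<le> rank n \<beta>" if \<beta>: "lk \<beta> 0 = 0" "h2 \<beta> \<noteq> 0" for \<beta>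
        proof -
          have \<beta>E: "\<beta> \<in> expos {0..n}" using supp[OF h2 \<beta>(2)] .
          have "r \<le> rank n \<beta>"
          proof (cases "h \<beta> = 0")
            case True
            then have "sh \<mu> h' \<beta> \<noteq> 0" using \<beta> by (auto simp: h2_def u_def)
            then obtain \<delta> where \<delta>: "\<beta> = \<mu> + \<delta>" "h' \<delta> \<noteq> 0" by (rule sh_nonzeroE)
            then have "rank n b' \<le> rank n \<delta>" using h'(3) \<beta>(1) by (auto simp: lead0_def lookup_add)
            then show ?thesis
              using rank_add_less_iff[of \<delta> n b' \<mu>] \<delta> E \<beta>E b(3) \<mu> by auto
          qed (use Suc.prems \<beta> in auto)
          moreover have "rank n \<beta> \<noteq> r"
            using rank_inj[OF \<beta>E bE] b(3) \<beta>(2) \<open>h2 b = 0\<close> by auto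
          ultimately have "Suc r \<le> rank n \<beta>" by simp
          moreover have "expo_deg b \<le> expo_deg \<beta>"
            using \<open>r \<le> rank n \<beta>\<close> b(3) by (intro rank_le_imp_deg_le[OF \<beta>E]) auto
          ultimately show ?thesis using Suc.prems(2)[OF b(1,2)] by simp
        qed
        then obtain h3 where h3: "h3 \<in> divided n a J D" "\<And>\<beta>. lk \<beta> 0 = 0 \<Longrightarrow> h3 \<beta> = h2 \<beta>"
          "\<And>\<beta>. h3 \<beta> \<noteq> 0 \<Longrightarrow> k < expo_deg \<beta> + c"
          using Suc.hyps(1)[OF d h2] by blast
        show ?thesis
        proof (intro bexI conjI allI impI)
          show "(\<lambda>\<alpha>. h3 \<alpha> + 1 * u \<alpha>) \<in> divided n a J D" by (rule divided_add[OF h3(1) u])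
          show "h3 \<beta> + 1 * u \<beta> = h \<beta>" if "lk \<beta> 0 = 0" for \<beta> using h3(2)[OF that] by (simp add: h2_def)
          show "k < expo_deg \<beta> + c" if "h3 \<beta> + 1 * u \<beta> \<noteq> 0" for \<beta>
          proof (cases "h3 \<beta> = 0")
            case True
            then have "sh \<mu> h' \<beta> \<noteq> 0" using that by (auto simp: u_def)
            then obtain \<delta> where \<delta>: "\<beta> = \<mu> + \<delta>" by (rule sh_nonzeroE)
            \<comment> \<open>Every exponent of \<open>u\<close> has degree at least that of \<mu>,
              which is \<open>expo_deg b - expo_deg b'\<close> with \<open>expo_deg b\<close> above
              k. The loss c is independent of \<open>D\<close> and k.\<close>
            have "expo_deg b' \<le> c" using c[OF s(1)] h'(1) by simp
            then show ?thesis using Suc.prems(2)[OF b(1,2)] \<delta> \<mu> by simp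
          qed (use h3(3) in auto)
        qed
      qed
    qed
  qed
  show ?thesis
  proof (intro exI[of _ c] allI ballI impI)
    fix D k h
    assume h: "h \<in> divided n a J D" and small: "\<forall>\<beta>. lk \<beta> 0 = 0 \<and> h \<beta> \<noteq> 0 \<longrightarrow> k < expo_deg \<beta>"
    show "\<exists>h'\<in>divided n a J D. (\<forall>\<beta>. lk \<beta> 0 = 0 \<longrightarrow> h' \<beta> = h \<beta>) \<and> (\<forall>\<beta>. h' \<beta> \<noteq> 0 \<longrightarrow> k < expo_deg \<beta> + c)"
      by (rule main[OF h, of k 0]) (simp add: small)
  qed
qed

text \<open>If \<open>h\<close> approximates t g to high order, its restriction to t = 0 vanishes to
  high order. Subtracting an element of high order with the same restriction leaves a multiple of t,
  whose quotient by t approximates g.\<close>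

lemma adic_closure_divided_saturated:
  assumes g: "sh (tpow 1) g \<in> adic_closure {0..n} (\<Union>D. divided n a J D)"
  shows "g \<in> adic_closure {0..n} (\<Union>D. divided n a J D)"
proof -
  let ?K = "\<Union>D. divided n a J D"
  have gc: "g \<in> carrier (cps {0..n})"
    using g by (auto simp: adic_closure_def intro: sh_carrierD)
  obtain c where c: "\<forall>D k. \<forall>h\<in>divided n a J D. (\<forall>\<beta>. lk \<beta> 0 = 0 \<and> h \<beta> \<noteq> 0 \<longrightarrow> k < expo_deg \<beta>) \<longrightarrow>
     (\<exists>h'\<in>divided n a J D. (\<forall>\<beta>. lk \<beta> 0 = 0 \<longrightarrow> h' \<beta> = h \<beta>) \<and> (\<forall>\<beta>. h' \<beta> \<noteq> 0 \<longrightarrow> k < expo_deg \<beta> + c))"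
    using divided_artin_rees ..
  have "\<exists>h\<in>?K. \<forall>\<alpha>. expo_deg \<alpha> \<le> k \<longrightarrow> g \<alpha> = h \<alpha>" for k
  proof -
    \<comment> \<open>One order is lost in the division by t, and c orders in the choice of
      \<open>h'\<close> from its restriction.\<close>
    define k' where "k' = k + 1 + c"
    have "\<exists>h\<in>?K. \<forall>\<alpha>. expo_deg \<alpha> \<le> k' \<longrightarrow> sh (tpow 1) g \<alpha> = h \<alpha>"
      using g by (simp only: adic_closure_def mem_Collect_eq)
    then obtain h where "h \<in> ?K" and h2: "\<forall>\<alpha>. expo_deg \<alpha> \<le> k' \<longrightarrow> sh (tpow 1) g \<alpha> = h \<alpha>" ..
    then obtain D where "h \<in> divided n a J D" by auto
    note h = this h2[rule_format]
    have small: "k' < expo_deg \<beta>" if "lk \<beta> 0 = 0" "h \<beta> \<noteq> 0" for \<beta>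
    proof (rule ccontr)
      assume "\<not> k' < expo_deg \<beta>"
      then have "sh (tpow 1) g \<beta> = h \<beta>" using h by simp
      moreover have "sh (tpow 1) g \<beta> = 0" using that by (intro sh_eq_0) (simp add: expo_le_single_iff)
      ultimately show False using that by simp
    qed
    then obtain h' where h': "h' \<in> divided n a J D" "\<And>\<beta>. lk \<beta> 0 = 0 \<Longrightarrow> h' \<beta> = h \<beta>"
      "\<And>\<beta>. h' \<beta> \<noteq> 0 \<Longrightarrow> k' < expo_deg \<beta> + c"
      using c[THEN spec, THEN spec, THEN bspec, OF h(1), of k'] by auto
    define d where "d = (\<lambda>\<alpha>. h \<alpha> + (-1) * h' \<alpha>)"
    have d: "d \<in> divided n a J D" unfolding d_def by (rule divided_add[OF h(1) h'(1)])
    define q where "q = (\<lambda>\<gamma>. d (tpow 1 + \<gamma>))"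
    have "sh (tpow 1) q = d"
    proof
      fix \<gamma>
      show "sh (tpow 1) q \<gamma> = d \<gamma>"
      proof (cases "lk \<gamma> 0 = 0")
        case True
        then show ?thesis using h'(2) by (simp add: d_def sh_eq_0 expo_le_single_iff)
      next
        case False
        then have "expo_le (tpow 1) \<gamma>" by (simp add: expo_le_single_iff)
        then obtain \<delta> where "\<gamma> = tpow 1 + \<delta>" by (auto simp: expo_le_iff)
        then show ?thesis by (simp add: q_def)
      qed
    qed
    then have "q \<in> divided n a J (D + 1)" using d by (intro divided_quot) simp
    moreover have "g \<alpha> = q \<alpha>" if "expo_deg \<alpha> \<le> k" for \<alpha>
    proof -
      have "h' (tpow 1 + \<alpha>) = 0" using h'(3)[of "tpow 1 + \<alpha>"] that by (fastforce simp: k'_def)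
      moreover have "h (tpow 1 + \<alpha>) = g \<alpha>"
        using h(2)[of "tpow 1 + \<alpha>"] that by (simp add: k'_def)
      ultimately show ?thesis by (simp add: q_def d_def)
    qed
    ultimately show ?thesis by blast
  qed
  then show ?thesis using gc by (simp add: adic_closure_def)
qed

section \<open>Comparison with the strict transform\<close>

lemma var_pow_mult: "cmul (cps_var 0 [^]\<^bsub>cps V\<^esub> (k::nat)) g = sh (tpow k) (g :: expo \<Rightarrow> 'k)"
proof (induction k arbitrary: g)
  case 0
  then show ?case by (simp add: fun_eq_iff cmul_monomial)
next
  case (Suc k)
  have "tpow (Suc k) = tpow k + tpow 1" by (simp add: single_add[symmetric] One_nat_def)
  moreover have "cmul (cps_var 0 [^]\<^bsub>cps V\<^esub> Suc k) g = cmul (cps_var 0 [^]\<^bsub>cps V\<^esub> k) (cmul (cps_var 0) g)"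
    by (simp only: nat_pow_Suc cps_simps cmul_assoc)
  ultimately show ?case by (simp add: Suc cmul_var sh_sh)
qed

lemma strict_transform_iff:
  "g \<in> strict_transform n a J \<longleftrightarrow> g \<in> carrier (cps {0..n}) \<and>
    (\<exists>k. sh (tpow k) g \<in> genideal (cps {0..n}) (pullback n a ` J))"
  by (simp add: strict_transform_def var_pow_mult)

lemma genideal_pullback: "ideal (genideal (cps {0..n}) (pullback n a ` J)) (cps {0..n})"
proof -
  interpret R: cring "cps {0..n} :: (expo \<Rightarrow> 'k) ring" by (rule cring_cps) simp
  show ?thesis using lidealD(1)[OF J] by (intro R.genideal_ideal) (auto intro: pullback_carrier)
qed

lemma strict_transform_ideal: "ideal (strict_transform n a J) (cps {0..n})"
proof -
  interpret R: cring "cps {0..n} :: (expo \<Rightarrow> 'k) ring" by (rule cring_cps) simp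
  let ?S = "strict_transform n a J"
  let ?G = "genideal (cps {0..n}) (pullback n a ` J)"
  have G: "lideal {0..n} ?G" by (rule ideal_imp_lideal[OF _ genideal_pullback]) simp
  have C: "lideal {0..n} (carrier (cps {0..n} :: (expo \<Rightarrow> 'k) ring))" by (rule lideal_carrier) simp
  have up: "sh (tpow (l + k)) g \<in> ?G" if "sh (tpow k) g \<in> ?G" for k l g
    unfolding tpow_add sh_sh[symmetric] by (rule lidealD(5)[OF G _ that]) simp
  have mult: "cmul f g \<in> ?S" if g: "g \<in> ?S" and f: "f \<in> carrier (cps {0..n})" for f g
  proof -
    obtain k where k: "g \<in> carrier (cps {0..n})" "sh (tpow k) g \<in> ?G"
      using g by (auto simp: strict_transform_iff)
    have "sh (tpow k) (cmul f g) = cmul f (sh (tpow k) g)"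
      by (simp only: cmul_monom[symmetric] cmul_assoc[symmetric] cmul_commute[of _ f])
    moreover have "cmul f (sh (tpow k) g) \<in> ?G" using ideal.I_l_closed[OF genideal_pullback k(2) f] by simp
    moreover have "cmul f g \<in> carrier (cps {0..n})" using f k(1) by (intro cps_mult_closed) auto
    ultimately show ?thesis unfolding strict_transform_iff by (intro conjI exI[of _ k]) simp_all
  qed
  show ?thesis
  proof (rule idealI)
    show "subgroup ?S (add_monoid (cps {0..n}))"
    proof (rule R.add.subgroupI)
      show S: "?S \<subseteq> carrier (cps {0..n})" by (auto simp: strict_transform_iff)
      have "(\<lambda>\<alpha>. 0) \<in> ?S"
        unfolding strict_transform_iff using lidealD(2)[OF C] lidealD(2)[OF G] by (auto intro!: exI[of _ 0])
      then show "?S \<noteq> {}" by blast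
      fix f assume f: "f \<in> ?S"
      have m: "cmul (cps_const (-1)) f \<in> ?S" by (rule mult[OF f const_carrier]) simp
      have "\<ominus>\<^bsub>cps {0..n}\<^esub> f = cmul (cps_const (-1)) f"
        by (rule R.minus_equality) (use f m S in \<open>auto simp: cmul_const\<close>)
      then show "\<ominus>\<^bsub>cps {0..n}\<^esub> f \<in> ?S" using m by simp
      fix g assume g: "g \<in> ?S"
      obtain k where k: "f \<in> carrier (cps {0..n})" "sh (tpow k) f \<in> ?G"
        using f by (auto simp: strict_transform_iff)
      obtain l where l: "g \<in> carrier (cps {0..n})" "sh (tpow l) g \<in> ?G"
        using g by (auto simp: strict_transform_iff)
      have "sh (tpow (l + k)) (\<lambda>\<alpha>. f \<alpha> + g \<alpha>) \<in> ?G"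
        unfolding sh_linear using lidealD(3)[OF G up[OF k(2), of l] up[OF l(2), of k]]
        by (simp only: add.commute[of k])
      then show "f \<oplus>\<^bsub>cps {0..n}\<^esub> g \<in> ?S"
        unfolding strict_transform_iff using lidealD(3)[OF C k(1) l(1)] by auto
    qed
    show "f \<otimes>\<^bsub>cps {0..n}\<^esub> g \<in> ?S" if "g \<in> ?S" "f \<in> carrier (cps {0..n})" for f g
      using mult[OF that] by simp
    show "g \<otimes>\<^bsub>cps {0..n}\<^esub> f \<in> ?S" if "g \<in> ?S" "f \<in> carrier (cps {0..n})" for f g
      using mult[OF that] by (simp add: cmul_commute[of g])
  qed (rule R.ring_axioms)
qed

lemma divided_subset_strict_transform: "divided n a J D \<subseteq> strict_transform n a J"
proof
  fix g assume "g \<in> divided n a J D"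
  then obtain f where f: "f \<in> J" "sh (tpow D) g = pullback n a f" "g \<in> carrier (cps {0..n})" by (rule dividedE)
  have "pullback n a f \<in> genideal (cps {0..n}) (pullback n a ` J)" using f(1) by (auto simp: genideal_def)
  then show "g \<in> strict_transform n a J"
    unfolding strict_transform_iff using f by (auto intro!: exI[of _ D])
qed

text \<open>The closure is an ideal that contains the pull-backs of \<open>J\<close> and in which t
  can be cancelled; the strict transform is the smallest such ideal.\<close>

lemma strict_transform_subset: "strict_transform n a J \<subseteq> adic_closure {0..n} (\<Union>D. divided n a J D)"
proof
  let ?C = "adic_closure {0..n} (\<Union>D. divided n a J D)"
  have C: "ideal ?C (cps {0..n})" by (rule adic_closure_ideal[OF _ lideal_Union_divided]) simp
  have "pullback n a ` J \<subseteq> ?C"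
  proof safe
    fix f assume f: "f \<in> J"
    then have c: "pullback n a f \<in> carrier (cps {0..n})" using lidealD(1)[OF J] by (auto intro: pullback_carrier)
    then have "pullback n a f \<in> divided n a J 0" using f by (intro dividedI) auto
    then show "pullback n a f \<in> ?C" using c by (auto simp: adic_closure_def)
  qed
  then have G: "genideal (cps {0..n}) (pullback n a ` J) \<subseteq> ?C"
    using C by (auto simp: genideal_def)
  fix g assume "g \<in> strict_transform n a J"
  then obtain k where "sh (tpow k) g \<in> ?C" using G by (auto simp: strict_transform_iff)
  then show "g \<in> ?C"
  proof (induction k)
    case (Suc k)
    have "tpow (Suc k) = tpow 1 + tpow k" by (simp add: single_add[symmetric] One_nat_def)
    with Suc.prems have "sh (tpow 1) (sh (tpow k) g) \<in> ?C" by (simp add: sh_sh)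
    then show ?case by (rule Suc.IH[OF adic_closure_divided_saturated])
  qed simp
qed

end


section \<open>Diagrams of initial exponents\<close>

definition lead :: "nat \<Rightarrow> (expo \<Rightarrow> 'k::zero) \<Rightarrow> expo \<Rightarrow> bool" where
  "lead n f \<alpha> \<longleftrightarrow> f \<alpha> \<noteq> 0 \<and> (\<forall>\<beta>. f \<beta> \<noteq> 0 \<longrightarrow> rank n \<alpha> \<le> rank n \<beta>)"

lemma lead_exists:
  assumes "f \<gamma> \<noteq> 0"
  obtains \<alpha> where "lead n f \<alpha>" "rank n \<alpha> \<le> rank n \<gamma>"
  using ex_has_least_nat[of "\<lambda>\<alpha>. f \<alpha> \<noteq> 0" \<gamma> "rank n"] assms unfolding lead_def by blast

lemma initial_exponent_eq:
  assumes f: "supp_in {0..n} f" and l: "lead n f \<alpha>"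
  shows "initial_exponent n f = \<alpha>"
  unfolding initial_exponent_def
proof (rule the_equality)
  have E: "\<beta> \<in> expos {0..n}" if "f \<beta> \<noteq> 0" for \<beta> using f that by (auto simp: supp_in_def)
  have *: "\<alpha> = \<beta> \<or> expo_less n \<alpha> \<beta>" if "f \<beta> \<noteq> 0" for \<beta>
    using l that E rank_less_iff[of \<alpha> n \<beta>] rank_inj[of \<alpha> n \<beta>] by (auto simp: lead_def order_le_less)
  then show "f \<alpha> \<noteq> 0 \<and> (\<forall>\<beta>. f \<beta> \<noteq> 0 \<longrightarrow> \<alpha> = \<beta> \<or> expo_less n \<alpha> \<beta>)"
    using l by (auto simp: lead_def)
  fix \<beta> assume \<beta>: "f \<beta> \<noteq> 0 \<and> (\<forall>\<gamma>. f \<gamma> \<noteq> 0 \<longrightarrow> \<beta> = \<gamma> \<or> expo_less n \<beta> \<gamma>)"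
  then show "\<beta> = \<alpha>"
    using *[of \<beta>] l expo_less_trans[of n \<alpha> \<beta> \<alpha>] expo_less_irrefl[of n \<alpha>] by (auto simp: lead_def)
qed

lemma initial_diagram_iff:
  assumes J: "lideal {0..n} J"
  shows "\<alpha> \<in> initial_diagram n J \<longleftrightarrow> (\<exists>f\<in>J. lead n f \<alpha>)"
proof -
  have supp: "supp_in {0..n} f" if "f \<in> J" for f
    using that lidealD(1)[OF J] supp_in_carrier by blast
  show ?thesis
  proof
    assume "\<alpha> \<in> initial_diagram n J"
    then obtain f where f: "f \<in> J" "f \<noteq> (\<lambda>\<alpha>. 0)" "\<alpha> = initial_exponent n f"
      by (auto simp: initial_diagram_def)
    then obtain \<gamma> where "f \<gamma> \<noteq> 0" by auto
    then obtain \<beta> where "lead n f \<beta>" by (rule lead_exists)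
    then show "\<exists>f\<in>J. lead n f \<alpha>" using f initial_exponent_eq[OF supp] by metis
  next
    assume "\<exists>f\<in>J. lead n f \<alpha>"
    then obtain f where f: "f \<in> J" "lead n f \<alpha>" by blast
    then have "f \<noteq> (\<lambda>\<alpha>. 0)" by (auto simp: lead_def)
    then show "\<alpha> \<in> initial_diagram n J"
      using f initial_exponent_eq[OF supp] unfolding initial_diagram_def by blast
  qed
qed

lemma initial_diagram_expos: "lideal {0..n} J \<Longrightarrow> initial_diagram n J \<subseteq> expos {0..n}"
  using lidealD(1)[of "{0..n}" J] supp_in_carrier
  by (fastforce simp: initial_diagram_iff lead_def supp_in_def)

text \<open>Multiplication by a monomial respects the order. By Dickson's lemma a diagram is then
  determined by finitely many of its elements.\<close>

lemma initial_diagram_upset: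
  assumes J: "lideal {0..n} J" and \<alpha>: "\<alpha> \<in> initial_diagram n J" and \<gamma>: "\<gamma> \<in> expos {0..n}"
  shows "\<gamma> + \<alpha> \<in> initial_diagram n J"
proof -
  obtain f where f: "f \<in> J" "lead n f \<alpha>" using \<alpha> initial_diagram_iff[OF J] by blast
  have supp: "supp_in {0..n} f" using f lidealD(1)[OF J] supp_in_carrier by blast
  have "lead n (sh \<gamma> f) (\<gamma> + \<alpha>)"
    unfolding lead_def
  proof (intro conjI allI impI)
    show "sh \<gamma> f (\<gamma> + \<alpha>) \<noteq> 0" using f by (simp add: lead_def)
    fix \<beta> assume "sh \<gamma> f \<beta> \<noteq> 0"
    then obtain \<delta> where \<delta>: "\<beta> = \<gamma> + \<delta>" "f \<delta> \<noteq> 0" by (rule sh_nonzeroE)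
    then have "\<delta> \<in> expos {0..n}" "\<alpha> \<in> expos {0..n}" "rank n \<alpha> \<le> rank n \<delta>"
      using supp f by (auto simp: supp_in_def lead_def)
    then show "rank n (\<gamma> + \<alpha>) \<le> rank n \<beta>"
      using rank_add_less_iff[of \<delta> n \<alpha> \<gamma>] \<gamma> \<delta> by simp
  qed
  moreover have "sh \<gamma> f \<in> J" by (rule lidealD(5)[OF J \<gamma> f(1)])
  ultimately show ?thesis using initial_diagram_iff[OF J] by blast
qed

text \<open>The contrapositive is the point: an element of \<open>J\<close> that vanishes at all
  initial exponents of rank below r vanishes at all exponents of rank below r.\<close>

lemma lideal_nonzero_meets_diagram:
  assumes J: "lideal {0..n} J" and f: "f \<in> J" "f \<gamma> \<noteq> 0" "rank n \<gamma> < r"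
  obtains \<alpha> where "\<alpha> \<in> initial_diagram n J" "rank n \<alpha> < r" "f \<alpha> \<noteq> 0"
proof -
  obtain \<alpha> where "lead n f \<alpha>" "rank n \<alpha> \<le> rank n \<gamma>" using f(2) by (rule lead_exists)
  then show ?thesis
    using f initial_diagram_iff[OF J] by (intro that[of \<alpha>]) (auto simp: lead_def)
qed

lemma linear_system_nontrivial:
  fixes M :: "'b \<Rightarrow> 'c \<Rightarrow> 'k::field"
  assumes "finite G" "finite B" "card G < card B"
  shows "\<exists>c. (\<exists>\<beta>\<in>B. c \<beta> \<noteq> 0) \<and> (\<forall>\<gamma>\<in>G. (\<Sum>\<beta>\<in>B. c \<beta> * M \<beta> \<gamma>) = 0)"
  using assms
proof (induction G arbitrary: B M rule: finite_induct)
  case empty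
  then have "B \<noteq> {}" by auto
  then show ?case by (intro exI[of _ "\<lambda>_. 1"]) auto
next
  case (insert \<gamma>0 G)
  show ?case
  proof (cases "\<forall>\<beta>\<in>B. M \<beta> \<gamma>0 = 0")
    case True
    have "card G < card B" using insert.prems insert.hyps by simp
    then obtain c where "\<exists>\<beta>\<in>B. c \<beta> \<noteq> 0" "\<forall>\<gamma>\<in>G. (\<Sum>\<beta>\<in>B. c \<beta> * M \<beta> \<gamma>) = 0"
      using insert.IH[OF insert.prems(1), of M] by blast
    then show ?thesis using True by (intro exI[of _ c]) (auto intro!: sum.neutral)
  next
    case False
    then obtain \<beta>0 where \<beta>0: "\<beta>0 \<in> B" "M \<beta>0 \<gamma>0 \<noteq> 0" by blast
    define B' where "B' = B - {\<beta>0}"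
    have B': "finite B'" "\<beta>0 \<notin> B'" "B = insert \<beta>0 B'" using insert.prems \<beta>0 by (auto simp: B'_def)
    then have "card G < card B'" using insert.prems insert.hyps by simp
    then obtain c where c: "\<exists>\<beta>\<in>B'. c \<beta> \<noteq> 0"
      "\<forall>\<gamma>\<in>G. (\<Sum>\<beta>\<in>B'. c \<beta> * (M \<beta> \<gamma> - M \<beta> \<gamma>0 / M \<beta>0 \<gamma>0 * M \<beta>0 \<gamma>)) = 0"
      using insert.IH[OF B'(1), of "\<lambda>\<beta> \<gamma>. M \<beta> \<gamma> - M \<beta> \<gamma>0 / M \<beta>0 \<gamma>0 * M \<beta>0 \<gamma>"] by blast
    \<comment> \<open>The value of the unknown at \<beta>0 forced by the equation at \<gamma>0;
      substituting it turns the other equations into the reduced system.\<close>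
    define e where "e = - (\<Sum>\<beta>\<in>B'. c \<beta> * M \<beta> \<gamma>0) / M \<beta>0 \<gamma>0"
    define c' where "c' = c(\<beta>0 := e)"
    have sum: "(\<Sum>\<beta>\<in>B. c' \<beta> * M \<beta> \<gamma>) = e * M \<beta>0 \<gamma> + (\<Sum>\<beta>\<in>B'. c \<beta> * M \<beta> \<gamma>)" for \<gamma>
    proof -
      have "(\<Sum>\<beta>\<in>B'. c' \<beta> * M \<beta> \<gamma>) = (\<Sum>\<beta>\<in>B'. c \<beta> * M \<beta> \<gamma>)"
        using B' by (intro sum.cong) (auto simp: c'_def)
      then show ?thesis using B' by (simp add: c'_def)
    qed
    have "(\<Sum>\<beta>\<in>B. c' \<beta> * M \<beta> \<gamma>) = 0" if "\<gamma> \<in> insert \<gamma>0 G" for \<gamma>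
    proof (cases "\<gamma> = \<gamma>0")
      case True
      then show ?thesis unfolding sum using \<beta>0 by (simp add: e_def)
    next
      case False
      then have "(\<Sum>\<beta>\<in>B'. c \<beta> * (M \<beta> \<gamma> - M \<beta> \<gamma>0 / M \<beta>0 \<gamma>0 * M \<beta>0 \<gamma>)) = 0" using that c by auto
      moreover have "(\<Sum>\<beta>\<in>B'. c \<beta> * (M \<beta> \<gamma> - M \<beta> \<gamma>0 / M \<beta>0 \<gamma>0 * M \<beta>0 \<gamma>)) =
          (\<Sum>\<beta>\<in>B'. c \<beta> * M \<beta> \<gamma>) + e * M \<beta>0 \<gamma>"
        by (simp add: e_def right_diff_distrib sum_subtractf sum_distrib_left sum_distrib_right
              sum_divide_distrib mult_ac)
      ultimately show ?thesis unfolding sum by (simp add: add.commute)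
    qed
    moreover have "\<exists>\<beta>\<in>B. c' \<beta> \<noteq> 0" using c(1) B' by (auto simp: c'_def)
    ultimately show ?thesis by blast
  qed
qed


section \<open>Families of ideals with polynomial sections\<close>

text \<open>Polynomial functions rather than polynomials, so that closure under the ring operations
  holds by the rules. They are matched with \<open>mpoly_eval\<close> in
  \<open>polyfun_eq_mpoly_funs\<close>.\<close>

inductive_set polyfun :: "'v set \<Rightarrow> (('v \<Rightarrow> 'k::field) \<Rightarrow> 'k) set" for V where
  const: "(\<lambda>_. c) \<in> polyfun V"
| coord: "v \<in> V \<Longrightarrow> (\<lambda>A. A v) \<in> polyfun V"
| add: "p \<in> polyfun V \<Longrightarrow> q \<in> polyfun V \<Longrightarrow> (\<lambda>A. p A + q A) \<in> polyfun V"
| mult: "p \<in> polyfun V \<Longrightarrow> q \<in> polyfun V \<Longrightarrow> (\<lambda>A. p A * q A) \<in> polyfun V"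

lemma polyfun_sum: "(\<And>i. i \<in> G \<Longrightarrow> p i \<in> polyfun V) \<Longrightarrow> (\<lambda>A. \<Sum>i\<in>G. p i A) \<in> polyfun V"
  by (induction G rule: infinite_finite_induct) (auto intro: polyfun.intros)

lemma polyfun_diff: "p \<in> polyfun V \<Longrightarrow> q \<in> polyfun V \<Longrightarrow> (\<lambda>A. p A - q A) \<in> polyfun V"
  using polyfun.add[OF _ polyfun.mult[OF polyfun.const[of "-1"]], of p V q] by simp

text \<open>Every coefficient is polynomial in A separately, with no bound on the degrees as
  \<alpha> varies.\<close>

definition poly_section ::
    "'v set \<Rightarrow> ('v \<Rightarrow> 'k) set \<Rightarrow> (('v \<Rightarrow> 'k) \<Rightarrow> (expo \<Rightarrow> 'k::field) set) \<Rightarrow> (('v \<Rightarrow> 'k) \<Rightarrow> expo \<Rightarrow> 'k) \<Rightarrow> bool" where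
  "poly_section V T J s \<longleftrightarrow> (\<forall>A\<in>T. s A \<in> J A) \<and> (\<forall>\<alpha>. (\<lambda>A. s A \<alpha>) \<in> polyfun V)"

text \<open>Finite precision is the right demand: a truncation is enough to exhibit an initial
  exponent, and the strict transform is only reached through approximations.\<close>

definition regular_family ::
    "'v set \<Rightarrow> ('v \<Rightarrow> 'k) set \<Rightarrow> (('v \<Rightarrow> 'k) \<Rightarrow> (expo \<Rightarrow> 'k::field) set) \<Rightarrow> bool" where
  "regular_family V T J \<longleftrightarrow> (\<forall>A\<in>T. \<forall>f\<in>J A. \<forall>k. \<exists>s. poly_section V T J s \<and> (\<forall>\<alpha>. expo_deg \<alpha> \<le> k \<longrightarrow> s A \<alpha> = f \<alpha>))"

lemma regular_familyE:
  assumes "regular_family V T J" "A \<in> T" "f \<in> J A"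
  obtains s where "poly_section V T J s" "\<And>\<alpha>. expo_deg \<alpha> \<le> k \<Longrightarrow> s A \<alpha> = f \<alpha>"
proof -
  have "\<exists>s. poly_section V T J s \<and> (\<forall>\<alpha>. expo_deg \<alpha> \<le> k \<longrightarrow> s A \<alpha> = f \<alpha>)"
    using assms unfolding regular_family_def by simp
  then show ?thesis using that by blast
qed

lemma regular_family_subset:
  assumes "regular_family V T J" "T' \<subseteq> T"
  shows "regular_family V T' J"
  unfolding regular_family_def
proof (intro ballI allI)
  fix A f k assume "A \<in> T'" "f \<in> J A"
  then obtain s where s: "poly_section V T J s" "\<And>\<alpha>. expo_deg \<alpha> \<le> k \<Longrightarrow> s A \<alpha> = f \<alpha>"
    using regular_familyE[OF assms(1), of A f k] assms(2) by blast
  then have "poly_section V T' J s" using assms(2) by (auto simp: poly_section_def)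
  then show "\<exists>s. poly_section V T' J s \<and> (\<forall>\<alpha>. expo_deg \<alpha> \<le> k \<longrightarrow> s A \<alpha> = f \<alpha>)" using s(2) by auto
qed

locale ideal_family =
  fixes n :: nat and V :: "'v set" and T :: "('v \<Rightarrow> 'k::real_normed_field) set"
    and J :: "('v \<Rightarrow> 'k) \<Rightarrow> (expo \<Rightarrow> 'k) set"
  assumes lideal: "A \<in> T \<Longrightarrow> lideal {0..n} (J A)"
    and regular: "regular_family V T J"
begin

abbreviation N :: "('v \<Rightarrow> 'k) \<Rightarrow> expo set" where
  "N A \<equiv> initial_diagram n (J A)"

abbreviation Nseg :: "('v \<Rightarrow> 'k) \<Rightarrow> nat \<Rightarrow> expo set" where
  "Nseg A r \<equiv> {\<beta> \<in> N A. rank n \<beta> < r}"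

lemma finite_Nseg: "A \<in> T \<Longrightarrow> finite (Nseg A r)"
  by (rule finite_subset[OF _ finite_rank_less[of n r]]) (use initial_diagram_expos[OF lideal] in auto)

lemma section_in: "poly_section V T J s \<Longrightarrow> A \<in> T \<Longrightarrow> s A \<in> J A"
  by (simp add: poly_section_def)

lemma section_coeff: "poly_section V T J s \<Longrightarrow> (\<lambda>A. s A \<alpha>) \<in> polyfun V"
  by (simp add: poly_section_def)

lemma section_scale:
  "p \<in> polyfun V \<Longrightarrow> poly_section V T J s \<Longrightarrow> poly_section V T J (\<lambda>A \<alpha>. p A * s A \<alpha>)"
  by (auto simp: poly_section_def intro: lidealD(4)[OF lideal] polyfun.mult)

lemma section_diff:
  "poly_section V T J s \<Longrightarrow> poly_section V T J s' \<Longrightarrow> poly_section V T J (\<lambda>A \<alpha>. s A \<alpha> - s' A \<alpha>)"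
  by (auto simp: poly_section_def intro: lideal_diff[OF lideal] polyfun_diff)

lemma section_sum:
  "(\<And>i. i \<in> G \<Longrightarrow> poly_section V T J (s i)) \<Longrightarrow> poly_section V T J (\<lambda>A \<alpha>. \<Sum>i\<in>G. s i A \<alpha>)"
  by (auto simp: poly_section_def intro: lideal_sum[OF lideal] polyfun_sum)

text \<open>Fraction-free Gaussian elimination.\<close>

lemma pivot_sections:
  assumes A0: "A0 \<in> T"
  shows "\<exists>d b. d \<in> polyfun V \<and> d A0 \<noteq> 0 \<and> (\<forall>\<beta>\<in>Nseg A0 r. poly_section V T J (b \<beta>)) \<and>
    (\<forall>A. \<forall>\<beta>\<in>Nseg A0 r. \<forall>\<gamma>\<in>Nseg A0 r. b \<beta> A \<gamma> = (if \<beta> = \<gamma> then d A else 0))"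
proof (induction r)
  case 0
  then show ?case by (intro exI[of _ "\<lambda>_. 1"]) (auto intro: polyfun.const)
next
  case (Suc r)
  let ?B = "Nseg A0 r"
  obtain d b where d: "d \<in> polyfun V" "d A0 \<noteq> 0" and b: "\<And>\<beta>. \<beta> \<in> ?B \<Longrightarrow> poly_section V T J (b \<beta>)"
    and piv: "\<And>A \<beta> \<gamma>. \<beta> \<in> ?B \<Longrightarrow> \<gamma> \<in> ?B \<Longrightarrow> b \<beta> A \<gamma> = (if \<beta> = \<gamma> then d A else 0)"
    using Suc.IH by blast
  show ?case
  proof (cases "\<exists>\<delta>\<in>N A0. rank n \<delta> = r")
    case False
    then have "Nseg A0 (Suc r) = ?B" by (auto simp: less_Suc_eq)
    then show ?thesis using Suc.IH by simp
  next
    case True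
    then obtain \<delta> where \<delta>: "\<delta> \<in> N A0" "rank n \<delta> = r" by blast
    note E = initial_diagram_expos[OF lideal[OF A0]]
    have seg: "Nseg A0 (Suc r) = insert \<delta> ?B"
      using \<delta> E rank_inj[of _ n \<delta>] by (auto simp: less_Suc_eq)
    have \<delta>B: "\<delta> \<notin> ?B" using \<delta> by simp
    have fin: "finite ?B" by (rule finite_Nseg[OF A0])
    obtain f where f: "f \<in> J A0" "lead n f \<delta>"
      using \<delta> initial_diagram_iff[OF lideal[OF A0]] by blast
    obtain s where s: "poly_section V T J s" "\<And>\<alpha>. expo_deg \<alpha> \<le> expo_deg \<delta> \<Longrightarrow> s A0 \<alpha> = f \<alpha>"
      using regular_familyE[OF regular A0 f(1)] by blast
    have sB: "s A0 \<beta> = 0" if "\<beta> \<in> ?B" for \<beta>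
    proof -
      have "rank n \<beta> < rank n \<delta>" using that \<delta> by simp
      then have "expo_deg \<beta> \<le> expo_deg \<delta>" using E \<delta> by (intro rank_le_imp_deg_le[of \<delta> n]) auto
      then have "s A0 \<beta> = f \<beta>" by (rule s(2))
      also have "f \<beta> = 0" using f(2) \<open>rank n \<beta> < rank n \<delta>\<close> by (auto simp: lead_def not_le[symmetric])
      finally show ?thesis .
    qed
    \<comment> \<open>Clears the coefficients of \<open>s\<close> at the earlier pivots for all A at
      once. At \<open>A0\<close> these coefficients are 0 already, so the initial exponent \<delta>
      survives there.\<close>
    define u where "u = (\<lambda>A \<alpha>. d A * s A \<alpha> - (\<Sum>\<beta>\<in>?B. s A \<beta> * b \<beta> A \<alpha>))"
    have u: "poly_section V T J u"
      unfolding u_def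
    by (rule section_diff[OF section_scale[OF d(1) s(1)] section_sum[OF section_scale[OF section_coeff[OF s(1)] b]]])
    have uB: "u A \<gamma> = 0" if "\<gamma> \<in> ?B" for A \<gamma>
    proof -
      have "(\<Sum>\<beta>\<in>?B. s A \<beta> * b \<beta> A \<gamma>) = (\<Sum>\<beta>\<in>?B. if \<gamma> = \<beta> then s A \<gamma> * d A else 0)"
        using piv that by (intro sum.cong) auto
      also have "\<dots> = s A \<gamma> * d A" using fin that by simp
      finally show ?thesis by (simp add: u_def)
    qed
    have "u A0 \<delta> = d A0 * f \<delta>"
      using sB s(2)[of \<delta>] by (simp add: u_def)
    then have u0: "u A0 \<delta> \<noteq> 0" using d f(2) by (simp add: lead_def)
    \<comment> \<open>Cross-multiplication clears the new column \<delta> from the old sections. All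
      pivots become \<open>d A * u A \<delta>\<close>, and the new section is scaled by
      \<open>d\<close> to match.\<close>
    define b' where "b' = (\<lambda>\<beta>. if \<beta> = \<delta> then (\<lambda>A \<alpha>. d A * u A \<alpha>)
      else (\<lambda>A \<alpha>. u A \<delta> * b \<beta> A \<alpha> - b \<beta> A \<delta> * u A \<alpha>))"
    have "poly_section V T J (b' \<beta>)" if "\<beta> \<in> insert \<delta> ?B" for \<beta>
    proof (cases "\<beta> = \<delta>")
      case True
      then show ?thesis using section_scale[OF d(1) u] by (simp add: b'_def)
    next
      case False
      then have sb: "poly_section V T J (b \<beta>)" using that by (intro b) simp
      have "poly_section V T J (\<lambda>A \<alpha>. u A \<delta> * b \<beta> A \<alpha> - b \<beta> A \<delta> * u A \<alpha>)"
        by (rule section_diff[OF section_scale[OF section_coeff[OF u] sb] section_scale[OF section_coeff[OF sb] u]])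
      then show ?thesis using False by (simp add: b'_def)
    qed
    moreover have "b' \<beta> A \<gamma> = (if \<beta> = \<gamma> then d A * u A \<delta> else 0)"
      if "\<beta> \<in> insert \<delta> ?B" "\<gamma> \<in> insert \<delta> ?B" for A \<beta> \<gamma>
    proof (cases "\<beta> = \<delta>")
      case True
      then show ?thesis using that(2) uB \<delta>B by (cases "\<gamma> = \<delta>") (auto simp: b'_def)
    next
      case False
      then have \<beta>: "\<beta> \<in> ?B" using that by simp
      show ?thesis
      proof (cases "\<gamma> = \<delta>")
        case True
        then show ?thesis using False by (simp add: b'_def mult.commute)
      next
        case False
        then have "\<gamma> \<in> ?B" using that by simp
        then show ?thesis using piv[OF \<beta>] uB \<open>\<beta> \<noteq> \<delta>\<close> by (simp add: b'_def)
      qed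
    qed
    moreover have "(\<lambda>A. d A * u A \<delta>) \<in> polyfun V" by (rule polyfun.mult[OF d(1) section_coeff[OF u]])
    ultimately show ?thesis
      unfolding seg using d u0 by (intro exI[of _ "\<lambda>A. d A * u A \<delta>"] exI[of _ b']) simp
  qed
qed

text \<open>Where d is nonzero, the pivot sections are independent on the columns
  \<open>Nseg A0 r\<close>. If A had fewer initial exponents of rank below r, a nontrivial
  combination would vanish at all of these, hence at every exponent of rank below r, the pivots
  included.\<close>

lemma diagram_semicontinuous:
  assumes A0: "A0 \<in> T"
  shows "\<exists>d. d \<in> polyfun V \<and> d A0 \<noteq> 0 \<and> (\<forall>A\<in>T. d A \<noteq> 0 \<longrightarrow> card (Nseg A0 r) \<le> card (Nseg A r))"
proof -
  let ?B = "Nseg A0 r"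
  obtain d b where d: "d \<in> polyfun V" "d A0 \<noteq> 0" and b: "\<And>\<beta>. \<beta> \<in> ?B \<Longrightarrow> poly_section V T J (b \<beta>)"
    and piv: "\<And>A \<beta> \<gamma>. \<beta> \<in> ?B \<Longrightarrow> \<gamma> \<in> ?B \<Longrightarrow> b \<beta> A \<gamma> = (if \<beta> = \<gamma> then d A else 0)"
    using pivot_sections[OF A0, of r] by blast
  have "card ?B \<le> card (Nseg A r)" if A: "A \<in> T" and dA: "d A \<noteq> 0" for A
  proof (rule ccontr)
    assume "\<not> card ?B \<le> card (Nseg A r)"
    then obtain c where c: "\<exists>\<beta>\<in>?B. c \<beta> \<noteq> 0" "\<And>\<gamma>. \<gamma> \<in> Nseg A r \<Longrightarrow> (\<Sum>\<beta>\<in>?B. c \<beta> * b \<beta> A \<gamma>) = 0"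
      using linear_system_nontrivial[OF finite_Nseg[OF A, of r] finite_Nseg[OF A0, of r], of "\<lambda>\<beta>. b \<beta> A"]
      by (auto simp: not_le)
    define v where "v = (\<lambda>\<alpha>. \<Sum>\<beta>\<in>?B. c \<beta> * b \<beta> A \<alpha>)"
    have v: "v \<in> J A"
      unfolding v_def by (intro lideal_sum[OF lideal[OF A]] lidealD(4)[OF lideal[OF A]] section_in[OF b] A)
    obtain \<beta> where \<beta>: "\<beta> \<in> ?B" "c \<beta> \<noteq> 0" using c by blast
    have "v \<beta> = (\<Sum>\<gamma>\<in>?B. if \<beta> = \<gamma> then c \<beta> * d A else 0)"
      unfolding v_def using piv \<beta> by (intro sum.cong) auto
    then have "v \<beta> = c \<beta> * d A" using \<beta> finite_Nseg[OF A0] by simp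
    then have "v \<beta> \<noteq> 0" "rank n \<beta> < r" using \<beta> dA by auto
    then obtain \<alpha> where "\<alpha> \<in> N A" "rank n \<alpha> < r" "v \<alpha> \<noteq> 0"
      by (rule lideal_nonzero_meets_diagram[OF lideal[OF A] v])
    then show False using c(2)[of \<alpha>] by (simp add: v_def)
  qed
  then show ?thesis using d by blast
qed

text \<open>Eliminating the coefficients of \<open>s\<close> at the initial exponents of rank below \<open>r\<close> leaves a section
  without initial exponent of rank below \<open>r\<close>, since the diagram is constant. Nothing is divided by
  \<open>d A\<close>, so the zeros of \<open>d\<close> are harmless.\<close>

lemma section_vanishing:
  assumes const: "\<And>A. A \<in> T \<Longrightarrow> N A = N A0" and A0: "A0 \<in> T"
    and s: "poly_section V T J s" and s0: "\<And>\<alpha>. rank n \<alpha> < r \<Longrightarrow> s A0 \<alpha> = 0"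
  shows "\<exists>s'. poly_section V T J s' \<and> s' A0 = s A0 \<and> (\<forall>A\<in>T. \<forall>\<alpha>. rank n \<alpha> < r \<longrightarrow> s' A \<alpha> = 0)"
proof -
  let ?B = "Nseg A0 r"
  obtain d b where d: "d \<in> polyfun V" "d A0 \<noteq> 0" and b: "\<And>\<beta>. \<beta> \<in> ?B \<Longrightarrow> poly_section V T J (b \<beta>)"
    and piv: "\<And>A \<beta> \<gamma>. \<beta> \<in> ?B \<Longrightarrow> \<gamma> \<in> ?B \<Longrightarrow> b \<beta> A \<gamma> = (if \<beta> = \<gamma> then d A else 0)"
    using pivot_sections[OF A0, of r] by blast
  define u where "u = (\<lambda>A \<alpha>. d A * s A \<alpha> - (\<Sum>\<beta>\<in>?B. s A \<beta> * b \<beta> A \<alpha>))"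
  have u: "poly_section V T J u"
    unfolding u_def
    by (rule section_diff[OF section_scale[OF d(1) s] section_sum[OF section_scale[OF section_coeff[OF s] b]]])
  have uB: "u A \<gamma> = 0" if "\<gamma> \<in> ?B" for A \<gamma>
  proof -
    have "(\<Sum>\<beta>\<in>?B. s A \<beta> * b \<beta> A \<gamma>) = (\<Sum>\<beta>\<in>?B. if \<gamma> = \<beta> then s A \<gamma> * d A else 0)"
      using piv that by (intro sum.cong) auto
    also have "\<dots> = s A \<gamma> * d A" using finite_Nseg[OF A0] that by simp
    finally show ?thesis by (simp add: u_def)
  qed
  have uv: "u A \<alpha> = 0" if A: "A \<in> T" and \<alpha>: "rank n \<alpha> < r" for A \<alpha>
  proof (rule ccontr)
    assume "u A \<alpha> \<noteq> 0"
    then obtain \<beta> where "\<beta> \<in> N A" "rank n \<beta> < r" "u A \<beta> \<noteq> 0"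
      by (rule lideal_nonzero_meets_diagram[OF lideal[OF A] section_in[OF u A] _ \<alpha>])
    then show False using uB const[OF A] by simp
  qed
  have u0: "u A0 \<alpha> = d A0 * s A0 \<alpha>" for \<alpha>
    using s0 by (simp add: u_def)
  show ?thesis
  proof (intro exI conjI ballI allI impI)
    \<comment> \<open>At \<open>A0\<close> all subtracted coefficients are 0, so \<open>u\<close> is
      \<open>d A0\<close> times \<open>s\<close> there; scaling by the constant
      \<open>1 / d A0\<close> restores \<open>s\<close>.\<close>
    show "poly_section V T J (\<lambda>A \<alpha>. (1 / d A0) * u A \<alpha>)"
      by (rule section_scale[OF polyfun.const u])
    show "(\<lambda>\<alpha>. (1 / d A0) * u A0 \<alpha>) = s A0" using d by (simp add: u0)
    show "(1 / d A0) * u A \<alpha> = 0" if "A \<in> T" "rank n \<alpha> < r" for A \<alpha>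
      using uv[OF that] by simp
  qed
qed

section \<open>Regularity of the strict transform\<close>

lemma chart_monom_polyfun:
  fixes a :: "('v \<Rightarrow> 'k) \<Rightarrow> nat \<Rightarrow> 'k"
  assumes a: "\<And>l. 1 \<le> l \<Longrightarrow> l \<le> n \<Longrightarrow> (\<lambda>A. a A l) \<in> polyfun V" and "\<alpha> \<in> expos {0..n}"
  shows "(\<lambda>A. chart_monom n (a A) \<alpha> \<gamma>) \<in> polyfun V"
  using assms(2)
proof (induction \<alpha> arbitrary: \<gamma> rule: expos_induct)
  case zero
  then show ?case by (simp add: chart_monom_0 polyfun.const)
next
  case (step v \<alpha>)
  have sh: "(\<lambda>A. sh \<mu> (F A) \<gamma>) \<in> polyfun V" if "\<And>\<gamma>. (\<lambda>A. F A \<gamma>) \<in> polyfun V"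
    for F :: "('v \<Rightarrow> 'k) \<Rightarrow> expo \<Rightarrow> 'k" and \<mu> \<gamma>
    using that by (cases "expo_le \<mu> \<gamma>") (auto simp: sh_def polyfun.const)
  show ?case
  proof (cases "v = 0")
    case True
    then show ?thesis using sh[OF step.IH] by (simp add: chart_monom_step_0)
  next
    case False
    then have v: "v \<le> n" "1 \<le> v" using step.hyps by auto
    show ?thesis unfolding chart_monom_step_v[OF v(1) False]
    proof (rule sh)
      fix \<gamma>
      show "(\<lambda>A. a A v * chart_monom n (a A) \<alpha> \<gamma> + sh (sg v 1) (chart_monom n (a A) \<alpha>) \<gamma>) \<in> polyfun V"
        by (rule polyfun.add[OF polyfun.mult[OF a[OF v(2,1)] step.IH] sh[OF step.IH]])
    qed
  qed
qed

lemma pullback_polyfun: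
  fixes a :: "('v \<Rightarrow> 'k) \<Rightarrow> nat \<Rightarrow> 'k"
  assumes a: "\<And>l. 1 \<le> l \<Longrightarrow> l \<le> n \<Longrightarrow> (\<lambda>A. a A l) \<in> polyfun V"
    and f: "\<And>\<alpha>. (\<lambda>A. f A \<alpha>) \<in> polyfun V"
  shows "(\<lambda>A. pullback n (a A) (f A) \<gamma>) \<in> polyfun V"
  unfolding pullback_eq'
  by (intro polyfun_sum polyfun.mult f chart_monom_polyfun a) auto

lemma strict_transform_regular:
  fixes a :: "('v \<Rightarrow> 'k) \<Rightarrow> nat \<Rightarrow> 'k"
  assumes const: "\<And>A B. A \<in> T \<Longrightarrow> B \<in> T \<Longrightarrow> N A = N B"
    and a: "\<And>l. 1 \<le> l \<Longrightarrow> l \<le> n \<Longrightarrow> (\<lambda>A. a A l) \<in> polyfun V"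
  shows "regular_family V T (\<lambda>A. strict_transform n (a A) (J A))"
  unfolding regular_family_def
proof (intro ballI allI)
  fix A0 g k assume A0: "A0 \<in> T" and g: "g \<in> strict_transform n (a A0) (J A0)"
  have "\<exists>h\<in>\<Union>D. divided n (a A0) (J A0) D. \<forall>\<alpha>. expo_deg \<alpha> \<le> k \<longrightarrow> g \<alpha> = h \<alpha>"
    using subsetD[OF strict_transform_subset[OF lideal[OF A0]] g]
    by (simp only: adic_closure_def mem_Collect_eq)
  then obtain h where h: "h \<in> (\<Union>D. divided n (a A0) (J A0) D)" "\<forall>\<alpha>. expo_deg \<alpha> \<le> k \<longrightarrow> g \<alpha> = h \<alpha>" ..
  then obtain D where "h \<in> divided n (a A0) (J A0) D" by auto
  then obtain f where f: "f \<in> J A0" "sh (tpow D) h = pullback n (a A0) f" by (rule dividedE)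
  have f_supp: "supp_in {0..n} f" using f(1) lidealD(1)[OF lideal[OF A0]] supp_in_carrier by blast
  \<comment> \<open>Divisibility of the pull-back by t^D is translated into a condition on the order
    of \<open>f\<close>, which \<open>section_vanishing\<close> can carry to the other
    points.\<close>
  have f0: "f \<alpha> = 0" if "expo_deg \<alpha> < D" for \<alpha>
  proof (rule pullback_order[OF f_supp _ refl])
    fix \<gamma> assume "lk \<gamma> 0 = expo_deg \<alpha>"
    then show "pullback n (a A0) f \<gamma> = 0"
      using that unfolding f(2)[symmetric] by (intro sh_eq_0) (simp add: expo_le_single_iff)
  qed
  \<comment> \<open>The coefficient of the pull-back at \<open>tpow D + \<gamma>\<close> involves
    \<open>f\<close> in degree \<open>D + lk \<gamma> 0\<close> only, at most \<open>D + k\<close>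
    for the \<gamma> to be compared.\<close>
  obtain s where s: "poly_section V T J s" "\<And>\<alpha>. expo_deg \<alpha> \<le> D + k \<Longrightarrow> s A0 \<alpha> = f \<alpha>"
    using regular_familyE[OF regular A0 f(1), of "D + k"] by blast
  have "expo_deg (tpow D) \<ge> D \<and> tpow D \<in> expos {0..n}" by simp
  \<comment> \<open>The first exponent of degree at least \<open>D\<close>: in
    \<open>expos {0..n}\<close>, rank below that of \<omega> means degree below \<open>D\<close>, so
    order becomes a condition on ranks.\<close>
  then obtain \<omega> where \<omega>: "expo_deg \<omega> \<ge> D" "\<omega> \<in> expos {0..n}"
    and min: "\<And>\<alpha>. expo_deg \<alpha> \<ge> D \<and> \<alpha> \<in> expos {0..n} \<Longrightarrow> rank n \<omega> \<le> rank n \<alpha>"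
    using ex_has_least_nat[of "\<lambda>\<alpha>. expo_deg \<alpha> \<ge> D \<and> \<alpha> \<in> expos {0..n}" "tpow D" "rank n"] by blast
  have supp: "\<alpha> \<in> expos {0..n}" if "poly_section V T J s" "A \<in> T" "s A \<alpha> \<noteq> 0" for s A \<alpha>
    using section_in[OF that(1,2)] lidealD(1)[OF lideal[OF that(2)]] that(3) supp_in_carrier
    by (auto simp: supp_in_def)
  have s0: "s A0 \<alpha> = 0" if "rank n \<alpha> < rank n \<omega>" for \<alpha>
  proof (rule ccontr)
    assume nz: "s A0 \<alpha> \<noteq> 0"
    then have "expo_deg \<alpha> < D" using min[of \<alpha>] supp[OF s(1) A0 nz] that by (meson not_le)
    then show False using nz s(2)[of \<alpha>] f0 by simp
  qed
  obtain s' where s': "poly_section V T J s'" "s' A0 = s A0"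
    and "\<forall>A\<in>T. \<forall>\<alpha>. rank n \<alpha> < rank n \<omega> \<longrightarrow> s' A \<alpha> = 0"
    using section_vanishing[OF const[OF _ A0] A0 s(1) s0] by blast
  then have s'0: "s' A \<alpha> = 0" if "A \<in> T" "expo_deg \<alpha> < D" for A \<alpha>
    using that supp[OF s'(1) that(1)] rank_less_deg[of \<alpha> n \<omega>] \<omega> by (meson order_less_le_trans)
  define q where "q = (\<lambda>A \<gamma>. pullback n (a A) (s' A) (tpow D + \<gamma>))"
  have sh_q: "sh (tpow D) (q A) = pullback n (a A) (s' A)" if A: "A \<in> T" for A
  proof
    fix \<gamma>
    show "sh (tpow D) (q A) \<gamma> = pullback n (a A) (s' A) \<gamma>"
    proof (cases "expo_le (tpow D) \<gamma>")
      case True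
      then obtain \<delta> where "\<gamma> = tpow D + \<delta>" by (auto simp: expo_le_iff)
      then show ?thesis by (simp add: q_def)
    next
      case False
      then have "lk \<gamma> 0 < D" by (simp add: expo_le_single_iff)
      then show ?thesis using False s'0[OF A]
        by (simp add: sh_eq_0 pullback_eq')
    qed
  qed
  have "q A \<in> strict_transform n (a A) (J A)" if A: "A \<in> T" for A
  proof -
    have "pullback n (a A) (s' A) \<in> carrier (cps {0..n})"
      using section_in[OF s'(1) A] lidealD(1)[OF lideal[OF A]] by (intro pullback_carrier) auto
    then have "q A \<in> carrier (cps {0..n})" using sh_q[OF A] by (simp add: sh_carrierD[of _ "tpow D" "q A"])
    then have "q A \<in> divided n (a A) (J A) D" by (intro dividedI[OF section_in[OF s'(1) A] sh_q[OF A]])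
    then show ?thesis using divided_subset_strict_transform[OF lideal[OF A]] by blast
  qed
  moreover have "(\<lambda>A. q A \<gamma>) \<in> polyfun V" for \<gamma>
    unfolding q_def by (rule pullback_polyfun[OF a section_coeff[OF s'(1)]])
  ultimately have "poly_section V T (\<lambda>A. strict_transform n (a A) (J A)) q"
    by (simp add: poly_section_def)
  moreover have "q A0 \<gamma> = g \<gamma>" if "expo_deg \<gamma> \<le> k" for \<gamma>
  proof -
    have "q A0 \<gamma> = pullback n (a A0) f (tpow D + \<gamma>)"
      unfolding q_def s'(2) pullback_eq'
    proof (rule sum.cong[OF refl])
      fix \<alpha> assume "\<alpha> \<in> {\<alpha> \<in> expos {0..n}. expo_deg \<alpha> = lk (tpow D + \<gamma>) 0}"
      then have "expo_deg \<alpha> \<le> D + k" using lk_le_expo_deg[of \<gamma> 0] that by (simp add: lookup_add)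
      then show "s A0 \<alpha> * chart_monom n (a A0) \<alpha> (tpow D + \<gamma>) = f \<alpha> * chart_monom n (a A0) \<alpha> (tpow D + \<gamma>)"
        by (simp add: s(2))
    qed
    also have "\<dots> = h \<gamma>" by (simp add: f(2)[symmetric])
    finally show ?thesis using h(2) that by simp
  qed
  ultimately show "\<exists>s. poly_section V T (\<lambda>A. strict_transform n (a A) (J A)) s \<and>
    (\<forall>\<alpha>. expo_deg \<alpha> \<le> k \<longrightarrow> s A0 \<alpha> = g \<alpha>)" by auto
qed

end


section \<open>The Hilbert basis theorem for polynomial functions\<close>

text \<open>Polynomials in the variables 0, ..., m as finitely supported coefficient functions, so
  that \<open>sh\<close>, \<open>rank\<close> and Dickson's lemma apply again. The map
  \<open>e\<close> below tells which coordinate a variable stands for.\<close>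

definition fin_coeffs :: "nat \<Rightarrow> (expo \<Rightarrow> 'k::real_normed_field) set" where
  "fin_coeffs m = {c. finite {\<mu>. c \<mu> \<noteq> 0} \<and> supp_in {0..m} c}"

definition monom_fun :: "nat \<Rightarrow> (nat \<Rightarrow> 'v) \<Rightarrow> expo \<Rightarrow> ('v \<Rightarrow> 'k::real_normed_field) \<Rightarrow> 'k" where
  "monom_fun m e \<mu> A = (\<Prod>v\<in>{0..m}. A (e v) ^ lk \<mu> v)"

definition eval_coeffs :: "nat \<Rightarrow> (nat \<Rightarrow> 'v) \<Rightarrow> (expo \<Rightarrow> 'k::real_normed_field) \<Rightarrow> ('v \<Rightarrow> 'k) \<Rightarrow> 'k" where
  "eval_coeffs m e c A = (\<Sum>\<mu> | c \<mu> \<noteq> 0. c \<mu> * monom_fun m e \<mu> A)"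

lemma eval_coeffs_superset:
  "finite G \<Longrightarrow> {\<mu>. c \<mu> \<noteq> 0} \<subseteq> G \<Longrightarrow> eval_coeffs m e c A = (\<Sum>\<mu>\<in>G. c \<mu> * monom_fun m e \<mu> A)"
  unfolding eval_coeffs_def by (rule sum.mono_neutral_left) auto

lemma monom_fun_add: "monom_fun m e (\<mu> + \<nu>) A = monom_fun m e \<mu> A * monom_fun m e \<nu> A"
  by (simp add: monom_fun_def lookup_add power_add prod.distrib)

lemma fin_coeffs_add: "c \<in> fin_coeffs m \<Longrightarrow> d \<in> fin_coeffs m \<Longrightarrow> (\<lambda>\<alpha>. c \<alpha> + d \<alpha>) \<in> fin_coeffs m"
  unfolding fin_coeffs_def supp_in_def
  by (auto intro: finite_subset[of _ "{\<mu>. c \<mu> \<noteq> 0} \<union> {\<mu>. d \<mu> \<noteq> 0}"]) force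

lemma sh_support: "{\<gamma>. sh \<mu> c \<gamma> \<noteq> 0} = (+) \<mu> ` {\<gamma>. c \<gamma> \<noteq> 0}"
  by (auto elim: sh_nonzeroE)

lemma fin_coeffs_sh:
  assumes "c \<in> fin_coeffs m" "\<mu> \<in> expos {0..m}"
  shows "(\<lambda>\<alpha>. a * sh \<mu> c \<alpha>) \<in> fin_coeffs m"
proof -
  have "finite {\<gamma>. sh \<mu> c \<gamma> \<noteq> 0}" "supp_in {0..m} (sh \<mu> c)"
    using assms by (auto simp: fin_coeffs_def sh_support supp_in_def elim: sh_nonzeroE)
  then show ?thesis
    by (auto simp: fin_coeffs_def supp_in_def intro: finite_subset[of _ "{\<gamma>. sh \<mu> c \<gamma> \<noteq> 0}"])
qed

lemma eval_coeffs_add: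
  assumes "c \<in> fin_coeffs m" "d \<in> fin_coeffs m"
  shows "eval_coeffs m e (\<lambda>\<alpha>. c \<alpha> + d \<alpha>) A = eval_coeffs m e c A + eval_coeffs m e d A"
proof -
  let ?G = "{\<mu>. c \<mu> \<noteq> 0} \<union> {\<mu>. d \<mu> \<noteq> 0}"
  have G: "finite ?G" using assms by (simp add: fin_coeffs_def)
  have "eval_coeffs m e (\<lambda>\<alpha>. c \<alpha> + d \<alpha>) A = (\<Sum>\<mu>\<in>?G. (c \<mu> + d \<mu>) * monom_fun m e \<mu> A)"
    by (rule eval_coeffs_superset[OF G]) auto
  moreover have "eval_coeffs m e c A = (\<Sum>\<mu>\<in>?G. c \<mu> * monom_fun m e \<mu> A)"
    by (rule eval_coeffs_superset[OF G]) auto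
  moreover have "eval_coeffs m e d A = (\<Sum>\<mu>\<in>?G. d \<mu> * monom_fun m e \<mu> A)"
    by (rule eval_coeffs_superset[OF G]) auto
  ultimately show ?thesis by (simp add: ring_distribs sum.distrib)
qed

lemma eval_coeffs_sh:
  assumes "c \<in> fin_coeffs m"
  shows "eval_coeffs m e (\<lambda>\<alpha>. a * sh \<mu> c \<alpha>) A = a * monom_fun m e \<mu> A * eval_coeffs m e c A"
proof -
  have fin: "finite {\<gamma>. c \<gamma> \<noteq> 0}" using assms by (simp add: fin_coeffs_def)
  have "eval_coeffs m e (\<lambda>\<alpha>. a * sh \<mu> c \<alpha>) A =
      (\<Sum>\<gamma>\<in>(+) \<mu> ` {\<gamma>. c \<gamma> \<noteq> 0}. a * sh \<mu> c \<gamma> * monom_fun m e \<gamma> A)"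
    by (intro eval_coeffs_superset finite_imageI[OF fin]) (auto elim!: sh_nonzeroE)
  also have "\<dots> = (\<Sum>\<gamma>| c \<gamma> \<noteq> 0. a * c \<gamma> * monom_fun m e (\<mu> + \<gamma>) A)"
    by (subst sum.reindex) (auto simp: inj_on_def)
  also have "\<dots> = a * monom_fun m e \<mu> A * eval_coeffs m e c A"
    by (simp add: eval_coeffs_def sum_distrib_left monom_fun_add mult_ac)
  finally show ?thesis .
qed

text \<open>The factor \<open>c\<close> accumulates: a product p q acts by applying the claim for q
  and then for p, so the product rule becomes a composition.\<close>

lemma polyfun_mult_coeffs:
  assumes "p \<in> polyfun V" and e: "V \<subseteq> e ` {0..m}" and c: "c \<in> fin_coeffs m"
  shows "\<exists>d\<in>fin_coeffs m. \<forall>A. p A * eval_coeffs m e c A = eval_coeffs m e d A"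
  using assms(1) c
proof (induction arbitrary: c)
  case (const a)
  then show ?case
    using fin_coeffs_sh[of c m 0 a] eval_coeffs_sh[of c m e a 0]
    by (intro bexI[of _ "\<lambda>\<alpha>. a * sh 0 c \<alpha>"]) (auto simp: monom_fun_def)
next
  case (coord v)
  then obtain w where w: "w \<in> {0..m}" "v = e w" using e by auto
  have "monom_fun m e (sg w 1) A = A v" for A :: "'a \<Rightarrow> 'b"
  proof -
    have "monom_fun m e (sg w 1) A = (\<Prod>u\<in>{0..m}. if w = u then A v else 1)"
      unfolding monom_fun_def using w by (intro prod.cong) (auto simp: lookup_single when_def)
    then show ?thesis using w by simp
  qed
  then show ?case
    using fin_coeffs_sh[of c m "sg w 1" 1] eval_coeffs_sh[of c m e 1 "sg w 1"] coord w
    by (intro bexI[of _ "\<lambda>\<alpha>. 1 * sh (sg w 1) c \<alpha>"]) auto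
next
  case (add p q)
  obtain d where d: "d \<in> fin_coeffs m" "\<And>A. p A * eval_coeffs m e c A = eval_coeffs m e d A"
    using add.IH(1)[OF add.prems] by blast
  obtain d' where d': "d' \<in> fin_coeffs m" "\<And>A. q A * eval_coeffs m e c A = eval_coeffs m e d' A"
    using add.IH(2)[OF add.prems] by blast
  show ?case
    by (rule bexI[OF _ fin_coeffs_add[OF d(1) d'(1)]])
      (simp add: eval_coeffs_add[OF d(1) d'(1)] d(2) d'(2) ring_distribs)
next
  case (mult p q)
  obtain d where d: "d \<in> fin_coeffs m" "\<And>A. q A * eval_coeffs m e c A = eval_coeffs m e d A"
    using mult.IH(2)[OF mult.prems] by blast
  obtain d' where d': "d' \<in> fin_coeffs m" "\<And>A. p A * eval_coeffs m e d A = eval_coeffs m e d' A"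
    using mult.IH(1)[OF d(1)] by blast
  show ?case by (rule bexI[OF _ d'(1)]) (simp add: mult.assoc d(2) d'(2))
qed

lemma polyfun_coeffs:
  assumes "p \<in> polyfun V" and e: "V \<subseteq> e ` {0..m}"
  obtains d where "d \<in> fin_coeffs m" "\<And>A. p A = eval_coeffs m e d A"
proof -
  define c :: "expo \<Rightarrow> 'b" where "c = (\<lambda>\<alpha>. if \<alpha> = 0 then 1 else 0)"
  have "{\<mu>. c \<mu> \<noteq> 0} = {0}" by (auto simp: c_def)
  then have "c \<in> fin_coeffs m" and "eval_coeffs m e c A = 1" for A
    by (auto simp: fin_coeffs_def supp_in_def eval_coeffs_def monom_fun_def c_def)
  then show ?thesis using polyfun_mult_coeffs[OF assms, of c] that by auto
qed

section \<open>Ideals of polynomials and division by leading terms\<close>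

inductive_set coeff_ideal :: "nat \<Rightarrow> (expo \<Rightarrow> 'k::real_normed_field) set \<Rightarrow> (expo \<Rightarrow> 'k) set" for m C where
  zero: "(\<lambda>\<alpha>. 0) \<in> coeff_ideal m C"
| step: "c \<in> C \<Longrightarrow> \<mu> \<in> expos {0..m} \<Longrightarrow> d \<in> coeff_ideal m C \<Longrightarrow>
    (\<lambda>\<alpha>. a * sh \<mu> c \<alpha> + d \<alpha>) \<in> coeff_ideal m C"

lemma coeff_ideal_add:
  assumes "d \<in> coeff_ideal m C" "d' \<in> coeff_ideal m C"
  shows "(\<lambda>\<alpha>. d \<alpha> + d' \<alpha>) \<in> coeff_ideal m C"
  using assms(1)
proof induction
  case (step c \<mu> d a)
  then show ?case using coeff_ideal.step[OF step.hyps(1,2) step.IH, of a] by (simp add: add.assoc)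
qed (use assms(2) in simp)

lemma coeff_ideal_sh:
  assumes "d \<in> coeff_ideal m C" "\<nu> \<in> expos {0..m}"
  shows "(\<lambda>\<alpha>. b * sh \<nu> d \<alpha>) \<in> coeff_ideal m C"
  using assms(1)
proof induction
  case zero
  have "(\<lambda>\<alpha>. b * sh \<nu> (\<lambda>\<alpha>. 0) \<alpha>) = (\<lambda>\<alpha>. 0)" by (simp add: fun_eq_iff sh_def)
  then show ?case using coeff_ideal.zero by metis
next
  case (step c \<mu> d a)
  have "(\<lambda>\<alpha>. (b * a) * sh (\<nu> + \<mu>) c \<alpha> + b * sh \<nu> d \<alpha>) \<in> coeff_ideal m C"
    using step assms(2) by (intro coeff_ideal.step) auto
  then show ?case by (simp add: sh_linear sh_sh ring_distribs mult.assoc)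
qed

lemma coeff_ideal_mono: "d \<in> coeff_ideal m C \<Longrightarrow> C \<subseteq> C' \<Longrightarrow> d \<in> coeff_ideal m C'"
  by (induction rule: coeff_ideal.induct) (auto intro: coeff_ideal.intros)

lemma coeff_ideal_finitary:
  "d \<in> coeff_ideal m C \<Longrightarrow> \<exists>C0. finite C0 \<and> C0 \<subseteq> C \<and> d \<in> coeff_ideal m C0"
proof (induction rule: coeff_ideal.induct)
  case (step c \<mu> d a)
  then obtain C0 where C0: "finite C0" "C0 \<subseteq> C" "d \<in> coeff_ideal m C0" by blast
  have "(\<lambda>\<alpha>. a * sh \<mu> c \<alpha> + d \<alpha>) \<in> coeff_ideal m (insert c C0)"
    using step by (intro coeff_ideal.step coeff_ideal_mono[OF C0(3)]) auto
  then show ?case using C0 step by (intro exI[of _ "insert c C0"]) auto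
qed (blast intro: coeff_ideal.zero)

lemma coeff_ideal_fin_coeffs: "C \<subseteq> fin_coeffs m \<Longrightarrow> coeff_ideal m C \<subseteq> fin_coeffs m"
proof
  fix d assume C: "C \<subseteq> fin_coeffs m" and "d \<in> coeff_ideal m C"
  from this(2) show "d \<in> fin_coeffs m"
  proof induction
    case (step c \<mu> d a)
    then show ?case using C by (intro fin_coeffs_add fin_coeffs_sh) auto
  qed (simp add: fin_coeffs_def supp_in_def)
qed

lemma eval_coeffs_ideal_zero:
  assumes C: "C \<subseteq> fin_coeffs m" and z: "\<And>c. c \<in> C \<Longrightarrow> eval_coeffs m e c A = 0"
    and "d \<in> coeff_ideal m C"
  shows "eval_coeffs m e d A = 0"
  using assms(3)
proof induction
  case zero
  then show ?case by (simp add: eval_coeffs_def)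
next
  case (step c \<mu> d a)
  have "c \<in> fin_coeffs m" "d \<in> fin_coeffs m" using C step coeff_ideal_fin_coeffs[OF C] by auto
  then have "eval_coeffs m e (\<lambda>\<alpha>. a * sh \<mu> c \<alpha> + d \<alpha>) A =
      a * monom_fun m e \<mu> A * eval_coeffs m e c A + eval_coeffs m e d A"
    using step.hyps(2) by (subst eval_coeffs_add) (auto simp: eval_coeffs_sh intro: fin_coeffs_sh)
  then show ?case using z step by simp
qed

text \<open>Leading term for the largest rank, in contrast with \<open>lead\<close>; finite support
  ensures that it exists.\<close>

definition top_term :: "nat \<Rightarrow> (expo \<Rightarrow> 'k::real_normed_field) \<Rightarrow> expo \<Rightarrow> bool" where
  "top_term m c \<alpha> \<longleftrightarrow> c \<alpha> \<noteq> 0 \<and> (\<forall>\<beta>. c \<beta> \<noteq> 0 \<longrightarrow> rank m \<beta> \<le> rank m \<alpha>)"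

lemma top_term_exists:
  assumes "c \<in> fin_coeffs m" "c \<noteq> (\<lambda>\<alpha>. 0)"
  obtains \<alpha> where "top_term m c \<alpha>"
proof -
  let ?S = "{\<mu>. c \<mu> \<noteq> 0}"
  have "finite ?S" "?S \<noteq> {}" using assms by (auto simp: fin_coeffs_def)
  then have "Max (rank m ` ?S) \<in> rank m ` ?S" by simp
  then obtain \<alpha> where "c \<alpha> \<noteq> 0" "Max (rank m ` ?S) = rank m \<alpha>" by auto
  then have "top_term m c \<alpha>"
    unfolding top_term_def using \<open>finite ?S\<close> by (metis (mono_tags, lifting) Max_ge finite_imageI image_eqI mem_Collect_eq)
  then show ?thesis by (rule that)
qed

text \<open>By Dickson's lemma the leading exponents of the ideal are multiples of finitely many.
  Division by elements with these leading exponents ends, because ranks decrease.\<close>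

lemma coeff_ideal_noetherian:
  assumes C: "C \<subseteq> fin_coeffs m"
  obtains C0 where "finite C0" "C0 \<subseteq> C" "coeff_ideal m C \<subseteq> coeff_ideal m C0"
proof -
  let ?I = "coeff_ideal m C"
  note I = coeff_ideal_fin_coeffs[OF C]
  define S where "S = {\<alpha>. \<exists>c\<in>?I. top_term m c \<alpha>}"
  have suppI: "\<alpha> \<in> expos {0..m}" if "c \<in> ?I" "c \<alpha> \<noteq> 0" for c \<alpha>
    using that I by (auto simp: fin_coeffs_def supp_in_def)
  then have "S \<subseteq> expos {0..m}" by (auto simp: S_def top_term_def)
  then obtain B where B: "finite B" "B \<subseteq> S" "\<And>\<alpha>. \<alpha> \<in> S \<Longrightarrow> \<exists>\<beta>\<in>B. expo_le \<beta> \<alpha>"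
    using dickson[of "{0..m}" S] by auto
  \<comment> \<open>The divisors lie in the ideal but possibly not in \<open>C\<close>; each is
    traded for finitely many generators in \<open>C\<close> that express it.\<close>
  have "\<exists>c D. c \<in> ?I \<and> top_term m c \<beta> \<and> finite D \<and> D \<subseteq> C \<and> c \<in> coeff_ideal m D" if "\<beta> \<in> B" for \<beta>
    using that B(2) coeff_ideal_finitary unfolding S_def by blast
  then obtain g D where g: "\<And>\<beta>. \<beta> \<in> B \<Longrightarrow> g \<beta> \<in> ?I \<and> top_term m (g \<beta>) \<beta> \<and> finite (D \<beta>) \<and> D \<beta> \<subseteq> C \<and> g \<beta> \<in> coeff_ideal m (D \<beta>)"
    by metis
  define C0 where "C0 = (\<Union>\<beta>\<in>B. D \<beta>)"
  have C0: "finite C0" "C0 \<subseteq> C" using B(1) g by (auto simp: C0_def)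
  have g0: "g \<beta> \<in> coeff_ideal m C0" if "\<beta> \<in> B" for \<beta>
    using g[OF that] that by (auto simp: C0_def intro: coeff_ideal_mono)
  have main: "c \<in> coeff_ideal m C0" if "c \<in> ?I" "\<And>\<alpha>. c \<alpha> \<noteq> 0 \<Longrightarrow> rank m \<alpha> < r" for c r
    using that
  proof (induction r arbitrary: c rule: less_induct)
    case (less r)
    show ?case
    proof (cases "c = (\<lambda>\<alpha>. 0)")
      case True
      then show ?thesis using coeff_ideal.zero by simp
    next
      case False
      then obtain \<alpha> where \<alpha>: "top_term m c \<alpha>"
        using top_term_exists less.prems(1) I by blast
      then have "\<alpha> \<in> S" using less.prems by (auto simp: S_def)
      then obtain \<beta> where \<beta>: "\<beta> \<in> B" "expo_le \<beta> \<alpha>" using B(3) by blast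
      then obtain \<mu> where \<mu>: "\<alpha> = \<mu> + \<beta>" by (metis add.commute expo_le_iff)
      have \<alpha>E: "\<alpha> \<in> expos {0..m}" using suppI less.prems(1) \<alpha> by (auto simp: top_term_def)
      then have E: "\<mu> \<in> expos {0..m}" "\<beta> \<in> expos {0..m}" using \<mu> by auto
      define b where "b = - c \<alpha> / g \<beta> \<beta>"
      define c' where "c' = (\<lambda>\<gamma>. b * sh \<mu> (g \<beta>) \<gamma> + c \<gamma>)"
      have gb: "g \<beta> \<beta> \<noteq> 0" using g[OF \<beta>(1)] by (simp add: top_term_def)
      have c'I: "c' \<in> ?I"
        unfolding c'_def using g[OF \<beta>(1)] E less.prems by (intro coeff_ideal_add coeff_ideal_sh) auto
      have "c' \<alpha> = 0" using gb by (simp add: c'_def b_def \<mu>)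
      have "rank m \<gamma> < rank m \<alpha>" if nz: "c' \<gamma> \<noteq> 0" for \<gamma>
      proof -
        have \<gamma>E: "\<gamma> \<in> expos {0..m}" by (rule suppI[OF c'I nz])
        have "rank m \<gamma> \<le> rank m \<alpha>"
        proof (cases "c \<gamma> = 0")
          case True
          then have "sh \<mu> (g \<beta>) \<gamma> \<noteq> 0" using nz by (auto simp: c'_def)
          then obtain \<delta> where \<delta>: "\<gamma> = \<mu> + \<delta>" "g \<beta> \<delta> \<noteq> 0" by (rule sh_nonzeroE)
          then have "rank m \<delta> \<le> rank m \<beta>" using g[OF \<beta>(1)] by (simp add: top_term_def)
          then show ?thesis using rank_add_less_iff[of \<beta> m \<delta> \<mu>] E \<gamma>E \<delta> \<mu> by auto
        qed (use \<alpha> in \<open>auto simp: top_term_def\<close>)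
        moreover have "rank m \<gamma> \<noteq> rank m \<alpha>"
          using rank_inj[OF \<gamma>E \<alpha>E] nz \<open>c' \<alpha> = 0\<close> by auto
        ultimately show ?thesis by simp
      qed
      moreover have "rank m \<alpha> < r" using less.prems(2) \<alpha> by (simp add: top_term_def)
      ultimately have "c' \<in> coeff_ideal m C0" using less.IH c'I by blast
      then have "(\<lambda>\<gamma>. - b * sh \<mu> (g \<beta>) \<gamma> + c' \<gamma>) \<in> coeff_ideal m C0"
        using g0[OF \<beta>(1)] E by (intro coeff_ideal_add coeff_ideal_sh) auto
      then show ?thesis by (simp add: c'_def)
    qed
  qed
  have "?I \<subseteq> coeff_ideal m C0"
  proof
    fix c assume c: "c \<in> ?I"
    then have fin: "finite {\<mu>. c \<mu> \<noteq> 0}" using I by (auto simp: fin_coeffs_def)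
    have "rank m \<alpha> < Suc (Max (rank m ` {\<mu>. c \<mu> \<noteq> 0}))" if "c \<alpha> \<noteq> 0" for \<alpha>
      using fin that by (simp add: less_Suc_eq_le)
    then show "c \<in> coeff_ideal m C0" by (rule main[OF c])
  qed
  then show ?thesis using C0 that by blast
qed

lemma polyfun_noetherian:
  fixes P :: "(('v \<Rightarrow> 'k::real_normed_field) \<Rightarrow> 'k) set"
  assumes V: "finite V" and P: "P \<subseteq> polyfun V"
  shows "\<exists>P0. finite P0 \<and> P0 \<subseteq> P \<and> (\<forall>A. (\<forall>p\<in>P0. p A = 0) \<longrightarrow> (\<forall>p\<in>P. p A = 0))"
proof -
  obtain e :: "nat \<Rightarrow> 'v" where "V = e ` {i. i < card V}"
    using finite_imp_nat_seg_image_inj_on[OF V] by (metis card_image card_Collect_less_nat)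
  moreover have "e ` {i. i < card V} \<subseteq> e ` {0..card V}" by (intro image_mono) auto
  \<comment> \<open>The variables 0, ..., \<open>card V\<close> exceed the elements of
    \<open>V\<close> by one, and \<open>e\<close> may leave \<open>V\<close> at the last
    index.\<close>
  ultimately have e: "V \<subseteq> e ` {0..card V}" by simp
  let ?m = "card V"
  \<comment> \<open>All coefficient functions that represent members of \<open>P\<close>, so that a
    finite subset of \<open>C\<close> yields a finite subset of \<open>P\<close>.\<close>
  define C where "C = {c \<in> fin_coeffs ?m. eval_coeffs ?m e c \<in> P}"
  have C: "C \<subseteq> fin_coeffs ?m" by (auto simp: C_def)
  obtain C0 where C0: "finite C0" "C0 \<subseteq> C" "coeff_ideal ?m C \<subseteq> coeff_ideal ?m C0"
    using coeff_ideal_noetherian[OF C] by blast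
  show ?thesis
  proof (intro exI[of _ "eval_coeffs ?m e ` C0"] conjI allI impI)
    show "finite (eval_coeffs ?m e ` C0)" using C0 by simp
    show "eval_coeffs ?m e ` C0 \<subseteq> P" using C0 by (auto simp: C_def)
    fix A assume z: "\<forall>p\<in>eval_coeffs ?m e ` C0. p A = 0"
    show "\<forall>p\<in>P. p A = 0"
    proof
      fix p assume p: "p \<in> P"
      then obtain c where c: "c \<in> fin_coeffs ?m" "\<And>A. p A = eval_coeffs ?m e c A"
        using polyfun_coeffs[OF _ e] P by blast
      have "eval_coeffs ?m e c = p" using c(2) by (simp add: fun_eq_iff)
      then have cC: "c \<in> C" using c(1) p by (simp add: C_def)
      have "(\<lambda>\<alpha>. 1 * sh 0 c \<alpha> + 0) \<in> coeff_ideal ?m C"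
        by (intro coeff_ideal.step coeff_ideal.zero cC) simp
      then have "c \<in> coeff_ideal ?m C0" using C0(3) by auto
      then show "p A = 0"
        unfolding c(2) using C0(2) C z by (auto intro!: eval_coeffs_ideal_zero[of C0, OF _ _ \<open>c \<in> coeff_ideal ?m C0\<close>])
    qed
  qed
qed


section \<open>Closed sets and the stratification by diagrams\<close>

text \<open>Zeros are taken inside an ambient set \<open>X\<close>, since polynomial functions are
  defined on all maps, whereas truncated arcs are the extensional ones.\<close>

definition zclosed :: "'v set \<Rightarrow> ('v \<Rightarrow> 'k::field) set \<Rightarrow> ('v \<Rightarrow> 'k) set \<Rightarrow> bool" where
  "zclosed V X Z \<longleftrightarrow> (\<exists>P\<subseteq>polyfun V. Z = {A \<in> X. \<forall>p\<in>P. p A = 0})"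

lemma zclosed_Int_zeros:
  assumes "zclosed V X Z" "p \<in> polyfun V"
  shows "zclosed V X {A \<in> Z. p A = 0}"
proof -
  obtain P where "P \<subseteq> polyfun V" "Z = {A \<in> X. \<forall>p\<in>P. p A = 0}" using assms(1) by (auto simp: zclosed_def)
  then show ?thesis using assms(2) unfolding zclosed_def by (intro exI[of _ "insert p P"]) auto
qed

lemma zclosed_whole: "zclosed V X X"
  unfolding zclosed_def by (intro exI[of _ "{}"]) auto

lemma zclosed_Int: "zclosed V X Y \<Longrightarrow> zclosed V X Z \<Longrightarrow> zclosed V X (Y \<inter> Z)"
  unfolding zclosed_def
proof (elim exE conjE)
  fix P Q assume "P \<subseteq> polyfun V" "Y = {A \<in> X. \<forall>p\<in>P. p A = 0}" "Q \<subseteq> polyfun V" "Z = {A \<in> X. \<forall>p\<in>Q. p A = 0}"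
  then show "\<exists>P\<subseteq>polyfun V. Y \<inter> Z = {A \<in> X. \<forall>p\<in>P. p A = 0}"
    by (intro exI[of _ "P \<union> Q"]) auto
qed

lemma zclosed_Un: "zclosed V X Y \<Longrightarrow> zclosed V X Z \<Longrightarrow> zclosed V X (Y \<union> Z)"
  unfolding zclosed_def
proof (elim exE conjE)
  fix P Q assume *: "P \<subseteq> polyfun V" "Y = {A \<in> X. \<forall>p\<in>P. p A = 0}" "Q \<subseteq> polyfun V" "Z = {A \<in> X. \<forall>p\<in>Q. p A = 0}"
  let ?R = "{\<lambda>A. p A * q A | p q. p \<in> P \<and> q \<in> Q}"
  have RP: "?R \<subseteq> polyfun V" using * by (auto intro!: polyfun.mult)
  have RZ: "(\<forall>r\<in>?R. r A = 0) \<longleftrightarrow> (\<forall>p\<in>P. p A = 0) \<or> (\<forall>q\<in>Q. q A = 0)" for A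
  proof
    assume r: "\<forall>r\<in>?R. r A = 0"
    show "(\<forall>p\<in>P. p A = 0) \<or> (\<forall>q\<in>Q. q A = 0)"
    proof (rule ccontr)
      assume "\<not> ((\<forall>p\<in>P. p A = 0) \<or> (\<forall>q\<in>Q. q A = 0))"
      then obtain p q where pq: "p \<in> P" "q \<in> Q" "p A * q A \<noteq> 0" by auto
      then have "(\<lambda>A. p A * q A) \<in> ?R" by blast
      with r have "(\<lambda>A. p A * q A) A = 0" by (rule bspec)
      then show False using pq(3) by simp
    qed
  qed auto
  have eq: "Y \<union> Z = {A \<in> X. \<forall>r\<in>?R. r A = 0}"
    by (simp only: *(2,4) RZ set_eq_iff Un_iff mem_Collect_eq conj_disj_distribL simp_thms)
  show "\<exists>P\<subseteq>polyfun V. Y \<union> Z = {A \<in> X. \<forall>p\<in>P. p A = 0}"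
    by (rule exI[of _ ?R], rule conjI[OF RP eq])
qed

text \<open>Finitely many of the equations that occur along a descending chain imply all of them.
  They have all appeared by some stage m, and the chain cannot descend further.\<close>

lemma zclosed_wf:
  assumes V: "finite V"
  shows "wf {(Y, Z :: ('v \<Rightarrow> 'k::real_normed_field) set). Y \<subset> Z \<and> zclosed V X Y \<and> zclosed V X Z}"
  unfolding wf_iff_no_infinite_down_chain
proof
  assume "\<exists>f. \<forall>i. (f (Suc i), f i) \<in> {(Y, Z :: ('v \<Rightarrow> 'k) set). Y \<subset> Z \<and> zclosed V X Y \<and> zclosed V X Z}"
  then obtain f :: "nat \<Rightarrow> ('v \<Rightarrow> 'k) set"
    where "\<forall>i. (f (Suc i), f i) \<in> {(Y, Z). Y \<subset> Z \<and> zclosed V X Y \<and> zclosed V X Z}" ..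
  then have f: "f (Suc i) \<subset> f i" "zclosed V X (f i)" for i by auto
  define P where "P i = {p \<in> polyfun V. \<forall>A\<in>f i. p A = 0}" for i
  have P: "P i \<subseteq> polyfun V" "f i = {A \<in> X. \<forall>p\<in>P i. p A = 0}" for i
  proof -
    obtain Q where Q: "Q \<subseteq> polyfun V" "f i = {A \<in> X. \<forall>p\<in>Q. p A = 0}"
      using f(2)[of i] unfolding zclosed_def by (elim exE conjE)
    show "P i \<subseteq> polyfun V" by (auto simp: P_def)
    have "Q \<subseteq> P i" using Q by (auto simp: P_def)
    then show "f i = {A \<in> X. \<forall>p\<in>P i. p A = 0}" unfolding Q(2) by (auto simp: P_def Q(2))
  qed
  have "(\<Union>i. P i) \<subseteq> polyfun V" using P(1) by blast
  from polyfun_noetherian[OF V this] obtain P0 where P0: "finite P0" "P0 \<subseteq> (\<Union>i. P i)"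
    "\<forall>A. (\<forall>p\<in>P0. p A = 0) \<longrightarrow> (\<forall>p\<in>(\<Union>i. P i). p A = 0)"
    by (elim exE conjE)
  have anti: "f j \<subseteq> f i" if "i \<le> j" for i j
    using that f(1) by (intro lift_Suc_antimono_le[of f i j]) auto
  have "\<exists>m. P0 \<subseteq> (\<Union>i\<le>m. P i)"
    using P0(1,2)
  proof (induction P0)
    case (insert p P0)
    then obtain m k where "P0 \<subseteq> (\<Union>i\<le>m. P i)" "p \<in> P k" by auto
    then have "insert p P0 \<subseteq> (\<Union>i\<le>max m k. P i)" by fastforce
    then show ?case by blast
  qed auto
  then obtain m where m: "P0 \<subseteq> (\<Union>i\<le>m. P i)" by blast
  have "f m \<subseteq> f (Suc m)"
  proof
    fix A assume A: "A \<in> f m"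
    have "p A = 0" if p: "p \<in> P0" for p
    proof -
      obtain i where "i \<le> m" "p \<in> P i" using m p by blast
      moreover have "A \<in> f i" using anti[of i m] A \<open>i \<le> m\<close> by blast
      ultimately show ?thesis unfolding P(2)[of i] by simp
    qed
    then have "\<forall>p\<in>P0. p A = 0" by (rule ballI)
    then have all: "\<forall>p\<in>(\<Union>i. P i). p A = 0" by (rule P0(3)[THEN spec, THEN mp])
    have "p A = 0" if "p \<in> P (Suc m)" for p using all that by simp
    moreover have "A \<in> X" using A P(2)[of m] by simp
    ultimately show "A \<in> f (Suc m)" unfolding P(2)[of "Suc m"] by simp
  qed
  then show False using f(1)[of m] by blast
qed

section \<open>Stratification of a regular family by its diagram\<close>

context ideal_family
begin

text \<open>The counting function of a set of exponents jumps exactly at the ranks of its elements,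
  so the numbers controlled by semicontinuity determine the diagram.\<close>

lemma diagram_mem_iff:
  assumes M: "M \<subseteq> expos {0..n}" and \<alpha>: "\<alpha> \<in> expos {0..n}"
  shows "\<alpha> \<in> M \<longleftrightarrow> card {\<beta> \<in> M. rank n \<beta> < Suc (rank n \<alpha>)} \<noteq> card {\<beta> \<in> M. rank n \<beta> < rank n \<alpha>}"
proof -
  have eq: "{\<beta> \<in> M. rank n \<beta> < Suc (rank n \<alpha>)} = {\<beta> \<in> M. rank n \<beta> < rank n \<alpha>} \<union> (M \<inter> {\<alpha>})"
    using rank_inj[OF _ \<alpha>] M by (auto simp: less_Suc_eq)
  have fin: "finite {\<beta> \<in> M. rank n \<beta> < rank n \<alpha>}"
    by (rule finite_subset[OF _ finite_rank_less[of n "rank n \<alpha>"]]) (use M in auto)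
  show ?thesis
  proof (cases "\<alpha> \<in> M")
    case True
    then have "M \<inter> {\<alpha>} = {\<alpha>}" by auto
    then show ?thesis unfolding eq using True fin by simp
  next
    case False
    then have "M \<inter> {\<alpha>} = {}" by auto
    then show ?thesis unfolding eq using False by simp
  qed
qed

lemma diagram_eqI:
  assumes A: "A \<in> T" and sub: "M \<subseteq> N A" and le: "\<And>r. card (Nseg A r) \<le> card {\<beta> \<in> M. rank n \<beta> < r}"
  shows "N A = M"
proof
  show "N A \<subseteq> M"
  proof
    fix \<alpha> assume \<alpha>: "\<alpha> \<in> N A"
    let ?r = "Suc (rank n \<alpha>)"
    have "{\<beta> \<in> M. rank n \<beta> < ?r} = Nseg A ?r"
      by (rule card_subset_eq[OF finite_Nseg[OF A]]) (use sub le[of ?r] card_mono[OF finite_Nseg[OF A], of "{\<beta> \<in> M. rank n \<beta> < ?r}" ?r] in auto)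
    then show "\<alpha> \<in> M" using \<alpha> by auto
  qed
qed (rule sub)

text \<open>Noetherian induction on \<open>Z\<close>. If \<open>T \<inter> Z\<close> is irreducible, the open conditions that the number of
  initial exponents of rank below \<open>r\<close> be maximal meet for any finitely many \<open>r\<close>. The maximal numbers
  define an upset \<open>L\<close>, generated below some rank \<open>R\<close>, so that the conditions for \<open>r \<le> R\<close> alone force
  the diagram to be \<open>L\<close>.\<close>

lemma finite_diagrams:
  assumes V: "finite V" and TX: "T \<subseteq> X"
  shows "finite (N ` T)"
proof -
  have "finite (N ` (T \<inter> Z))" if "zclosed V X Z" for Z
    using that
  proof (induction Z rule: wf_induct_rule[OF zclosed_wf[OF V, of X]])
    case (1 Z)
    have IH: "finite (N ` (T \<inter> {A \<in> Z. p A = 0}))" if p: "p \<in> polyfun V" "A \<in> T \<inter> Z" "p A \<noteq> 0" for p A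
      using zclosed_Int_zeros[OF 1(2) p(1)] p(2,3) 1(2) by (intro 1(1)) auto
    show ?case
    \<comment> \<open>The first case says that \<open>T \<inter> Z\<close> is reducible: it is
      covered by the zeros of p and of q in \<open>Z\<close>, both strictly smaller than
      \<open>Z\<close>.\<close>
    proof (cases "\<exists>p q A B. p \<in> polyfun V \<and> q \<in> polyfun V \<and> A \<in> T \<inter> Z \<and> B \<in> T \<inter> Z \<and> p A \<noteq> 0 \<and> q B \<noteq> 0 \<and>
        (\<forall>C\<in>T \<inter> Z. p C * q C = 0)")
      case True
      then obtain p q A B where pq: "p \<in> polyfun V" "q \<in> polyfun V" "A \<in> T \<inter> Z" "B \<in> T \<inter> Z" "p A \<noteq> 0" "q B \<noteq> 0"
        and "\<forall>C\<in>T \<inter> Z. p C * q C = 0" by blast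
      then have "N ` (T \<inter> Z) \<subseteq> N ` (T \<inter> {A \<in> Z. p A = 0}) \<union> N ` (T \<inter> {A \<in> Z. q A = 0})" by auto
      then show ?thesis by (rule finite_subset[OF _ finite_UnI[OF IH[OF pq(1,3,5)] IH[OF pq(2,4,6)]]])
    next
      case False
      then have irr: "\<exists>C\<in>T \<inter> Z. p C * q C \<noteq> 0" if "p \<in> polyfun V" "q \<in> polyfun V" "A \<in> T \<inter> Z" "B \<in> T \<inter> Z" "p A \<noteq> 0" "q B \<noteq> 0" for p q A B
        using that by blast
      show ?thesis
      proof (cases "T \<inter> Z = {}")
        case nonempty: False
        define M where "M r = Max ((\<lambda>A. card (Nseg A r)) ` (T \<inter> Z))" for r
        have bound: "card (Nseg A r) \<le> card {\<alpha> \<in> expos {0..n}. rank n \<alpha> < r}" if "A \<in> T \<inter> Z" for A r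
          using that initial_diagram_expos[OF lideal] by (intro card_mono finite_rank_less) auto
        have fin: "finite ((\<lambda>A. card (Nseg A r)) ` (T \<inter> Z))" for r
          by (rule finite_subset[of _ "{..card {\<alpha> \<in> expos {0..n}. rank n \<alpha> < r}}"]) (use bound in auto)
        have le_M: "card (Nseg A r) \<le> M r" if "A \<in> T \<inter> Z" for A r
          unfolding M_def using that fin by (intro Max_ge) auto
        \<comment> \<open>A polynomial together with a point of \<open>T \<inter> Z\<close> where it
          is nonzero; off its zeros the count below r is maximal.\<close>
        define \<Phi> where "\<Phi> r w \<longleftrightarrow> fst w \<in> polyfun V \<and> snd w \<in> T \<inter> Z \<and> fst w (snd w) \<noteq> 0 \<and>
          (\<forall>B\<in>T \<inter> Z. fst w B \<noteq> 0 \<longrightarrow> card (Nseg B r) = M r)"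
          for r and w :: "(('v \<Rightarrow> 'k) \<Rightarrow> 'k) \<times> ('v \<Rightarrow> 'k)"
        have "\<exists>w. \<Phi> r w" for r
        proof -
          have "M r \<in> (\<lambda>A. card (Nseg A r)) ` (T \<inter> Z)"
            unfolding M_def using fin nonempty by (intro Max_in) auto
          then obtain A where A: "A \<in> T \<inter> Z" "card (Nseg A r) = M r" by auto
          then obtain d where "d \<in> polyfun V" "d A \<noteq> 0" "\<And>B. B \<in> T \<Longrightarrow> d B \<noteq> 0 \<Longrightarrow> card (Nseg A r) \<le> card (Nseg B r)"
            using diagram_semicontinuous[of A r] by auto
          then have "\<Phi> r (d, A)" using A le_M by (auto simp: \<Phi>_def intro!: antisym)
          then show ?thesis ..
        qed
        then have "\<forall>r. \<exists>w. \<Phi> r w" ..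
        then have "\<exists>w. \<forall>r. \<Phi> r (w r)" by (rule choice)
        then obtain w where w: "\<forall>r. \<Phi> r (w r)" ..
        define d where "d r = fst (w r)" for r
        define W where "W r = snd (w r)" for r
        have d: "d r \<in> polyfun V" "W r \<in> T \<inter> Z" "d r (W r) \<noteq> 0"
          "B \<in> T \<inter> Z \<Longrightarrow> d r B \<noteq> 0 \<Longrightarrow> card (Nseg B r) = M r" for r B
          using w[THEN spec, of r] by (auto simp: \<Phi>_def d_def W_def)
        \<comment> \<open>By irreducibility a product of two of these polynomials is nonzero
          somewhere on \<open>T \<inter> Z\<close>. Only finitely many ranks can be combined in this
          way, which is why generators of \<open>L\<close> come in.\<close>
        have prod: "\<exists>D A. D \<in> polyfun V \<and> A \<in> T \<inter> Z \<and> D A \<noteq> 0 \<and>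
            (\<forall>B\<in>T \<inter> Z. D B \<noteq> 0 \<longrightarrow> (\<forall>r\<le>R. card (Nseg B r) = M r))" for R
        proof (induction R)
          case 0
          then show ?case using d(1)[of 0] d(2)[of 0] d(3)[of 0] d(4)[of _ 0] by auto
        next
          case (Suc R)
          then obtain D A where D: "D \<in> polyfun V" "A \<in> T \<inter> Z" "D A \<noteq> 0"
            "\<And>B r. B \<in> T \<inter> Z \<Longrightarrow> D B \<noteq> 0 \<Longrightarrow> r \<le> R \<Longrightarrow> card (Nseg B r) = M r" by blast
          obtain C where C: "C \<in> T \<inter> Z" "D C * d (Suc R) C \<noteq> 0"
            using irr[OF D(1) d(1) D(2) d(2) D(3) d(3)] by blast
          have "card (Nseg B r) = M r" if "B \<in> T \<inter> Z" "D B * d (Suc R) B \<noteq> 0" "r \<le> Suc R" for B r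
            using that D(4)[of B r] d(4)[of B "Suc R"] by (auto simp: le_Suc_eq)
          then show ?case using C polyfun.mult[OF D(1) d(1)[of "Suc R"]]
            by (intro exI[of _ "\<lambda>A. D A * d (Suc R) A"] exI[of _ C]) simp
        qed
        \<comment> \<open>Read off from the jumps of \<open>M\<close>. Its properties are checked in
          finite ranges, each time against the diagram of a point whose counts agree with
          \<open>M\<close> up to a sufficiently large rank.\<close>
        define L where "L = {\<alpha> \<in> expos {0..n}. M (Suc (rank n \<alpha>)) \<noteq> M (rank n \<alpha>)}"
        have L_iff: "\<alpha> \<in> L \<longleftrightarrow> \<alpha> \<in> N A"
          if A: "A \<in> T \<inter> Z" "\<And>r. r \<le> R \<Longrightarrow> card (Nseg A r) = M r" and \<alpha>: "rank n \<alpha> < R" for A R \<alpha>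
        proof (cases "\<alpha> \<in> expos {0..n}")
          case True
          have "N A \<subseteq> expos {0..n}" using A(1) initial_diagram_expos[OF lideal] by auto
          then show ?thesis using diagram_mem_iff[OF _ True, of "N A"] A(2)[of "rank n \<alpha>"] A(2)[of "Suc (rank n \<alpha>)"] \<alpha> True
            by (simp add: L_def)
        next
          case False
          then show ?thesis using A(1) initial_diagram_expos[OF lideal, of A] by (auto simp: L_def)
        qed
        have upset: "\<gamma> + \<alpha> \<in> L" if "\<alpha> \<in> L" "\<gamma> \<in> expos {0..n}" for \<alpha> \<gamma>
        proof -
          obtain A where A: "A \<in> T \<inter> Z" "\<And>r. r \<le> Suc (max (rank n \<alpha>) (rank n (\<gamma> + \<alpha>))) \<Longrightarrow> card (Nseg A r) = M r"
            using prod[of "Suc (max (rank n \<alpha>) (rank n (\<gamma> + \<alpha>)))"] by blast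
          then have "\<alpha> \<in> N A" using L_iff[OF A, where \<alpha> = \<alpha>] that by simp
          then have "\<gamma> + \<alpha> \<in> N A" using initial_diagram_upset[OF lideal _ that(2)] A(1) by auto
          then show ?thesis using L_iff[OF A, where \<alpha> = "\<gamma> + \<alpha>"] by simp
        qed
        have card_L: "card {\<beta> \<in> L. rank n \<beta> < r} = M r" for r
        proof -
          obtain A where A: "A \<in> T \<inter> Z" "\<And>r'. r' \<le> r \<Longrightarrow> card (Nseg A r') = M r'"
            using prod[of r] by blast
          have "{\<beta> \<in> L. rank n \<beta> < r} = Nseg A r" using L_iff[OF A] by auto
          then show ?thesis using A(2)[of r] by simp
        qed
        have "L \<subseteq> expos {0..n}" by (auto simp: L_def)
        then obtain B where B: "finite B" "B \<subseteq> L" "\<And>\<alpha>. \<alpha> \<in> L \<Longrightarrow> \<exists>\<beta>\<in>B. expo_le \<beta> \<alpha>"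
          using dickson[of "{0..n}" L] by auto
        define R where "R = Suc (Max (insert 0 (rank n ` B)))"
        have R: "rank n \<beta> < R" if "\<beta> \<in> B" for \<beta>
          unfolding R_def less_Suc_eq_le using that B(1) by (intro Max_ge) auto
        obtain D A where D: "D \<in> polyfun V" "A \<in> T \<inter> Z" "D A \<noteq> 0"
            "\<And>B r. B \<in> T \<inter> Z \<Longrightarrow> D B \<noteq> 0 \<Longrightarrow> r \<le> R \<Longrightarrow> card (Nseg B r) = M r"
          using prod[of R] by blast
        have NL: "N C = L" if C: "C \<in> T \<inter> Z" "D C \<noteq> 0" for C
        proof (rule diagram_eqI)
          show "C \<in> T" using C by simp
          show "L \<subseteq> N C"
          proof
            fix \<alpha> assume \<alpha>: "\<alpha> \<in> L"
            then obtain \<beta> where \<beta>: "\<beta> \<in> B" "expo_le \<beta> \<alpha>" using B(3) by blast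
            then obtain \<gamma> where \<gamma>: "\<alpha> = \<gamma> + \<beta>" by (metis add.commute expo_le_iff)
            have "\<beta> \<in> N C" using L_iff[OF C(1) D(4)[OF C] R[OF \<beta>(1)]] B(2) \<beta>(1) by auto
            then show "\<alpha> \<in> N C" using initial_diagram_upset[OF lideal] C \<alpha> \<gamma> by (auto simp: L_def)
          qed
          show "card (Nseg C r) \<le> card {\<beta> \<in> L. rank n \<beta> < r}" for r
            using le_M[OF C(1)] card_L by simp
        qed
        \<comment> \<open>\<open>L\<close> is the generic value; all others occur on a strictly
          smaller closed set.\<close>
        have "N ` (T \<inter> Z) \<subseteq> insert L (N ` (T \<inter> {A \<in> Z. D A = 0}))" using NL by auto
        then show ?thesis by (rule finite_subset[OF _ finite.insertI[OF IH[OF D(1,2,3)]]])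
      qed auto
    qed
  qed
  from this[OF zclosed_whole] show ?thesis using TX by (simp add: Int_absorb2)
qed

text \<open>The diagram at A is \<open>N A1\<close> iff its counts are at most those of
  \<open>A1\<close> for all ranks and at least those for ranks up to R, with R beyond the generators
  of \<open>N A1\<close>. By semicontinuity the former condition is closed; within it, the fibre is
  where some polynomial attached to a point of the fibre is nonzero, hence open.\<close>

lemma diagram_fibre_locally_closed:
  assumes TX: "T \<subseteq> X" and A1: "A1 \<in> T"
  obtains U W where "zclosed V X U" "zclosed V X W" "{A \<in> T. N A = N A1} = T \<inter> (U - W)"
proof -
  let ?M = "N A1"
  define d where "d A r = (SOME p. p \<in> polyfun V \<and> p A \<noteq> 0 \<and>
    (\<forall>B\<in>T. p B \<noteq> 0 \<longrightarrow> card (Nseg A r) \<le> card (Nseg B r)))" for A r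
  have "d A r \<in> polyfun V \<and> d A r A \<noteq> 0 \<and> (\<forall>B\<in>T. d A r B \<noteq> 0 \<longrightarrow> card (Nseg A r) \<le> card (Nseg B r))"
    if "A \<in> T" for A r
    unfolding d_def by (rule someI_ex[OF diagram_semicontinuous[OF that]])
  then have d: "\<And>A r. A \<in> T \<Longrightarrow> d A r \<in> polyfun V" "\<And>A r. A \<in> T \<Longrightarrow> d A r A \<noteq> 0"
    "\<And>A r B. A \<in> T \<Longrightarrow> B \<in> T \<Longrightarrow> d A r B \<noteq> 0 \<Longrightarrow> card (Nseg A r) \<le> card (Nseg B r)" by simp_all
  \<comment> \<open>Polynomials of the points whose count exceeds that of \<open>A1\<close>. Each
    point with excess is excluded by its own polynomial, while at points without excess all of them
    vanish.\<close>
  define P where "P = {d A r | A r. A \<in> T \<and> card (Nseg A r) > card (Nseg A1 r)}"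
  have P: "(\<forall>p\<in>P. p A = 0) \<longleftrightarrow> (\<forall>r. card (Nseg A r) \<le> card (Nseg A1 r))" if A: "A \<in> T" for A
  proof
    assume z: "\<forall>p\<in>P. p A = 0"
    show "\<forall>r. card (Nseg A r) \<le> card (Nseg A1 r)"
    proof (rule ccontr)
      assume "\<not> ?thesis"
      then obtain r where "card (Nseg A r) > card (Nseg A1 r)" by (auto simp: not_le)
      then have "d A r \<in> P" using A by (auto simp: P_def)
      then show False using z d(2)[OF A] by blast
    qed
  next
    assume le: "\<forall>r. card (Nseg A r) \<le> card (Nseg A1 r)"
    show "\<forall>p\<in>P. p A = 0"
    proof
      fix p assume "p \<in> P"
      then obtain B r where B: "p = d B r" "B \<in> T" "card (Nseg B r) > card (Nseg A1 r)" by (auto simp: P_def)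
      show "p A = 0"
      proof (rule ccontr)
        assume "p A \<noteq> 0"
        then have "card (Nseg B r) \<le> card (Nseg A r)" unfolding B(1) by (rule d(3)[OF B(2) A])
        then show False using le[THEN spec, of r] B(3) by simp
      qed
    qed
  qed
  have MX: "?M \<subseteq> expos {0..n}" by (rule initial_diagram_expos[OF lideal[OF A1]])
  then obtain B where B: "finite B" "B \<subseteq> ?M" "\<And>\<alpha>. \<alpha> \<in> ?M \<Longrightarrow> \<exists>\<beta>\<in>B. expo_le \<beta> \<alpha>"
    using dickson[of "{0..n}" ?M] by auto
  define R where "R = Suc (Max (insert 0 (rank n ` B)))"
  have R: "rank n \<beta> < R" if "\<beta> \<in> B" for \<beta>
    unfolding R_def less_Suc_eq_le using that B(1) by (intro Max_ge) auto
  define D where "D A C = (\<Prod>r\<le>R. d A r C)" for A C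
  have D: "D A \<in> polyfun V" if "A \<in> T" for A
  proof -
    have "(\<lambda>C. \<Prod>r\<in>G. d A r C) \<in> polyfun V" if "finite G" for G
      using that by induction (auto intro: polyfun.intros d(1)[OF \<open>A \<in> T\<close>])
    then show ?thesis unfolding D_def by simp
  qed
  \<comment> \<open>One product for every point of the fibre, since such a product is only known to
    be nonzero at its own point.\<close>
  define Q where "Q = {D A | A. A \<in> T \<and> N A = ?M}"
  define U where "U = {A \<in> X. \<forall>p\<in>P. p A = 0}"
  define W where "W = {A \<in> X. \<forall>q\<in>Q. q A = 0}"
  have "P \<subseteq> polyfun V" "Q \<subseteq> polyfun V" using d(1) D by (auto simp: P_def Q_def)
  then have "zclosed V X U" "zclosed V X W" by (auto simp: zclosed_def U_def W_def)
  moreover have "{A \<in> T. N A = ?M} = T \<inter> (U - W)"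
  proof (intro equalityI subsetI)
    fix A assume "A \<in> {A \<in> T. N A = ?M}"
    then have A: "A \<in> T" "N A = ?M" by auto
    have "\<forall>p\<in>P. p A = 0" unfolding P[OF A(1)] A(2) by simp
    moreover have "D A A \<noteq> 0" using d(2)[OF A(1)] by (simp add: D_def)
    moreover have "D A \<in> Q" using A by (auto simp: Q_def)
    ultimately show "A \<in> T \<inter> (U - W)" using A(1) TX by (auto simp: U_def W_def)
  next
    fix A assume "A \<in> T \<inter> (U - W)"
    then have A: "A \<in> T" and le: "\<And>r. card (Nseg A r) \<le> card (Nseg A1 r)"
      using P by (auto simp: U_def)
    obtain C where C: "C \<in> T" "N C = ?M" "D C A \<noteq> 0"
      using \<open>A \<in> T \<inter> (U - W)\<close> TX by (auto simp: U_def W_def Q_def)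
    have eq: "card (Nseg A r) = card (Nseg A1 r)" if "r \<le> R" for r
    proof -
      have "d C r A \<noteq> 0" using C(3) that by (auto simp: D_def)
      then have "card (Nseg C r) \<le> card (Nseg A r)" by (rule d(3)[OF C(1) A])
      then show ?thesis using le[of r] unfolding C(2) by simp
    qed
    have "N A = ?M"
    proof (rule diagram_eqI[OF A _ le])
      show "?M \<subseteq> N A"
      proof
        fix \<alpha> assume \<alpha>: "\<alpha> \<in> ?M"
        then obtain \<beta> where \<beta>: "\<beta> \<in> B" "expo_le \<beta> \<alpha>" using B(3) by blast
        then obtain \<gamma> where \<gamma>: "\<alpha> = \<gamma> + \<beta>" by (metis add.commute expo_le_iff)
        have E: "\<beta> \<in> expos {0..n}" "\<gamma> \<in> expos {0..n}" using \<alpha> \<gamma> MX by auto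
        have "\<beta> \<in> ?M" using \<beta> B by auto
        then have "\<beta> \<in> N A"
          using diagram_mem_iff[OF MX E(1)] diagram_mem_iff[OF initial_diagram_expos[OF lideal[OF A]] E(1)]
            eq[of "rank n \<beta>"] eq[of "Suc (rank n \<beta>)"] R[OF \<beta>(1)] by simp
        then show "\<alpha> \<in> N A" using initial_diagram_upset[OF lideal[OF A] _ E(2)] \<gamma> by simp
      qed
    qed
    then show "A \<in> {A \<in> T. N A = ?M}" using A by simp
  qed
  ultimately show ?thesis by (rule that)
qed

end


section \<open>The Hilbert--Samuel function is determined by the diagram\<close>

lemma quot_simps:
  assumes I: "ideal I R"
  shows "carrier (R Quot I) = (\<lambda>x. I +>\<^bsub>R\<^esub> x) ` carrier R"
    "x \<in> carrier R \<Longrightarrow> y \<in> carrier R \<Longrightarrow> (I +>\<^bsub>R\<^esub> x) \<otimes>\<^bsub>R Quot I\<^esub> (I +>\<^bsub>R\<^esub> y) = I +>\<^bsub>R\<^esub> (x \<otimes>\<^bsub>R\<^esub> y)"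
    "x \<in> carrier R \<Longrightarrow> y \<in> carrier R \<Longrightarrow> (I +>\<^bsub>R\<^esub> x) \<oplus>\<^bsub>R Quot I\<^esub> (I +>\<^bsub>R\<^esub> y) = I +>\<^bsub>R\<^esub> (x \<oplus>\<^bsub>R\<^esub> y)"
    "\<one>\<^bsub>R Quot I\<^esub> = I +>\<^bsub>R\<^esub> \<one>\<^bsub>R\<^esub>"
    "\<zero>\<^bsub>R Quot I\<^esub> = I +>\<^bsub>R\<^esub> \<zero>\<^bsub>R\<^esub>"
proof -
  interpret I: ideal I R by fact
  interpret h: ring_hom_ring R "R Quot I" "(+>\<^bsub>R\<^esub>) I" by (rule I.rcos_ring_hom_ring)
  show "carrier (R Quot I) = (\<lambda>x. I +>\<^bsub>R\<^esub> x) ` carrier R"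
    by (simp only: FactRing_def A_RCOSETS_def' UNION_singleton_eq_range partial_object.select_convs)
  show "x \<in> carrier R \<Longrightarrow> y \<in> carrier R \<Longrightarrow> (I +>\<^bsub>R\<^esub> x) \<otimes>\<^bsub>R Quot I\<^esub> (I +>\<^bsub>R\<^esub> y) = I +>\<^bsub>R\<^esub> (x \<otimes>\<^bsub>R\<^esub> y)"
    by (rule h.hom_mult[symmetric])
  show "x \<in> carrier R \<Longrightarrow> y \<in> carrier R \<Longrightarrow> (I +>\<^bsub>R\<^esub> x) \<oplus>\<^bsub>R Quot I\<^esub> (I +>\<^bsub>R\<^esub> y) = I +>\<^bsub>R\<^esub> (x \<oplus>\<^bsub>R\<^esub> y)"
    by (rule h.hom_add[symmetric])
  show "\<one>\<^bsub>R Quot I\<^esub> = I +>\<^bsub>R\<^esub> \<one>\<^bsub>R\<^esub>" by (rule h.hom_one[symmetric])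
  show "\<zero>\<^bsub>R Quot I\<^esub> = I +>\<^bsub>R\<^esub> \<zero>\<^bsub>R\<^esub>" by (rule h.hom_zero[symmetric])
qed

text \<open>The k-th power of the maximal ideal of K{t,X}, described by the vanishing of
  coefficients.\<close>

definition order_ge :: "nat \<Rightarrow> nat \<Rightarrow> (expo \<Rightarrow> 'k::real_normed_field) set" where
  "order_ge n k = {f \<in> carrier (cps {0..n}). \<forall>\<alpha>. expo_deg \<alpha> < k \<longrightarrow> f \<alpha> = 0}"

locale proper_cps_ideal =
  fixes n :: nat and J :: "(expo \<Rightarrow> 'k::real_normed_field) set"
  assumes ideal: "ideal J (cps {0..n})" and proper: "J \<noteq> carrier (cps {0..n})"
begin

abbreviation R :: "(expo \<Rightarrow> 'k) ring" where "R \<equiv> cps {0..n}"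
abbreviation L where "L \<equiv> R Quot J"
abbreviation \<pi> where "\<pi> f \<equiv> J +>\<^bsub>R\<^esub> f"

lemma lideal: "lideal {0..n} J"
  by (rule ideal_imp_lideal[OF _ ideal]) simp

lemma cring_R: "cring R"
  by (rule cring_cps) simp

lemma cring_L: "cring L"
  by (rule ideal.quotient_is_cring[OF ideal cring_R])

lemmas carrier_lin = lidealD(2-5)[OF lideal_carrier[of "{0..n}"], simplified]
  lideal_diff[OF lideal_carrier[of "{0..n}"], simplified]

lemma cps_minus: "f \<in> carrier R \<Longrightarrow> g \<in> carrier R \<Longrightarrow> f \<ominus>\<^bsub>R\<^esub> g = (\<lambda>\<alpha>. f \<alpha> - g \<alpha>)"
proof -
  interpret R: cring R by (rule cring_R)
  assume f: "f \<in> carrier R" and g: "g \<in> carrier R"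
  have ng: "(\<lambda>\<alpha>. - g \<alpha>) \<in> carrier R" using carrier_lin(3)[OF g, of "-1"] by simp
  have "\<ominus>\<^bsub>R\<^esub> g = (\<lambda>\<alpha>. - g \<alpha>)" by (rule R.minus_equality) (use g ng in auto)
  then show ?thesis by (simp add: a_minus_def)
qed

lemma \<pi>_eq_iff: "f \<in> carrier R \<Longrightarrow> g \<in> carrier R \<Longrightarrow> \<pi> f = \<pi> g \<longleftrightarrow> (\<lambda>\<alpha>. f \<alpha> - g \<alpha>) \<in> J"
  using ring.quotient_eq_iff_same_a_r_cos[OF cring.axioms(1)[OF cring_R] ideal, of f g] by (simp add: cps_minus)

lemma carrier_L: "carrier L = \<pi> ` carrier R"
  by (rule quot_simps(1)[OF ideal])

lemma \<pi>_mult: "f \<in> carrier R \<Longrightarrow> g \<in> carrier R \<Longrightarrow> \<pi> f \<otimes>\<^bsub>L\<^esub> \<pi> g = \<pi> (cmul f g)"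
  using quot_simps(2)[OF ideal, of f g] by simp

lemma \<pi>_add: "f \<in> carrier R \<Longrightarrow> g \<in> carrier R \<Longrightarrow> \<pi> f \<oplus>\<^bsub>L\<^esub> \<pi> g = \<pi> (\<lambda>\<alpha>. f \<alpha> + g \<alpha>)"
  using quot_simps(3)[OF ideal, of f g] by simp

lemma nonunit_of_mem: "f \<in> J \<Longrightarrow> f 0 = 0"
proof (rule ccontr)
  assume f: "f \<in> J" and nz: "f 0 \<noteq> 0"
  interpret R: cring R by (rule cring_R)
  have "f \<in> Units R" using f nz lidealD(1)[OF lideal] Units_cps_iff[of "{0..n}" f] by auto
  then have "J = carrier R" using ideal.one_imp_carrier[OF ideal] ideal.I_l_closed[OF ideal f, of "inv\<^bsub>R\<^esub> f"]
    by (simp only: R.Units_inv_closed R.Units_l_inv)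
  then show False using proper by simp
qed

lemma cmul_0: "cmul f g 0 = f 0 * (g 0 :: 'k)"
  by (simp add: cmul_alt)

lemma mult_carrier: "f \<in> carrier R \<Longrightarrow> g \<in> carrier R \<Longrightarrow> cmul f g \<in> carrier R"
  by (rule cps_mult_closed) auto

text \<open>A proper ideal consists of series without constant term, so passing to the quotient
  creates no new units.\<close>

lemma nonunits_L: "nonunits L = \<pi> ` order_ge n 1"
proof -
  interpret R: cring R by (rule cring_R)
  interpret L: cring L by (rule cring_L)
  have Unit: "\<pi> f \<in> Units L \<longleftrightarrow> f 0 \<noteq> 0" if f: "f \<in> carrier R" for f
  proof
    assume nz: "f 0 \<noteq> 0"
    then have "f \<in> Units R" using f Units_cps_iff[of "{0..n}" f] by auto
    then obtain g where g: "g \<in> carrier R" "cmul f g = \<one>\<^bsub>R\<^esub>" "cmul g f = \<one>\<^bsub>R\<^esub>" by (auto simp: Units_def)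
    then show "\<pi> f \<in> Units L"
      unfolding Units_def quot_simps(4)[OF ideal] using f
      by (auto simp: carrier_L \<pi>_mult simp del: cps_simps intro!: bexI[of _ g])
  next
    assume "\<pi> f \<in> Units L"
    then obtain g where g: "g \<in> carrier R" "\<pi> (cmul f g) = \<pi> \<one>\<^bsub>R\<^esub>"
      using f unfolding Units_def quot_simps(4)[OF ideal] by (auto simp: carrier_L \<pi>_mult simp del: cps_simps)
    then have "(\<lambda>\<alpha>. cmul f g \<alpha> - (if \<alpha> = 0 then 1 else 0)) \<in> J"
      using \<pi>_eq_iff[OF mult_carrier[OF f g(1)] R.one_closed] by simp
    then have "cmul f g 0 - 1 = 0" using nonunit_of_mem by fastforce
    then show "f 0 \<noteq> 0" by (auto simp: cmul_0)
  qed
  have "order_ge n 1 = {f \<in> carrier R. f 0 = 0}" by (auto simp: order_ge_def One_nat_def)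
  then show ?thesis using Unit by (auto simp: nonunits_def carrier_L)
qed

section \<open>Powers of the maximal ideal\<close>

lemma order_ge_lin:
  "f \<in> order_ge n k \<Longrightarrow> g \<in> order_ge n k \<Longrightarrow> (\<lambda>\<alpha>. f \<alpha> + g \<alpha>) \<in> order_ge n k"
  "f \<in> order_ge n k \<Longrightarrow> (\<lambda>\<alpha>. c * f \<alpha>) \<in> order_ge n k"
  by (auto simp: order_ge_def carrier_lin)

lemma order_ge_mult:
  assumes f: "f \<in> order_ge n k" and g: "g \<in> order_ge n l"
  shows "cmul f (g :: expo \<Rightarrow> 'k) \<in> order_ge n (k + l)"
proof -
  have "cmul f g \<gamma> = 0" if "expo_deg \<gamma> < k + l" for \<gamma>
    unfolding cmul_def
  proof (rule sum.neutral, safe)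
    fix \<alpha> \<beta> :: expo assume "\<gamma> = \<alpha> + \<beta>"
    then have "expo_deg \<alpha> < k \<or> expo_deg \<beta> < l" using that by auto
    then show "f \<alpha> * g \<beta> = 0" using f g by (auto simp: order_ge_def)
  qed
  then show ?thesis using f g mult_carrier by (auto simp: order_ge_def)
qed

lemma order_ge_decompose:
  fixes f :: "expo \<Rightarrow> 'k"
  assumes f: "f \<in> order_ge n (Suc k)"
  obtains F where "\<And>v. F v \<in> order_ge n k" "f = (\<lambda>\<alpha>. \<Sum>v\<in>{0..n}. sh (sg v 1) (F v) \<alpha>)"
proof -
  \<comment> \<open>Every monomial is assigned to the first of its variables, so that each nonzero
    coefficient of \<open>f\<close> is used exactly once and the estimate for \<open>f\<close>
    passes to \<open>F v\<close>.\<close>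
  define F :: "nat \<Rightarrow> expo \<Rightarrow> 'k" where
    "F v \<gamma> = (if v \<le> n \<and> (\<forall>w<v. lk \<gamma> w = 0) then f (sg v 1 + \<gamma>) else 0)" for v \<gamma>
  have fs: "supp_in {0..n} f" and "geo_bounded f" and f0: "\<And>\<alpha>. expo_deg \<alpha> < Suc k \<Longrightarrow> f \<alpha> = 0"
    using f by (auto simp: order_ge_def carrier_cps_iff)
  then obtain C M where CM: "0 \<le> C" "1 \<le> M" "\<And>\<alpha>. norm (f \<alpha>) \<le> C * M ^ expo_deg \<alpha>"
    by (auto simp: geo_bounded_def)
  have "F v \<in> order_ge n k" for v
  proof -
    have "norm (F v \<gamma>) \<le> (C * M) * M ^ expo_deg \<gamma>" for \<gamma>
      using CM CM(3)[of "sg v 1 + \<gamma>"] by (auto simp: F_def power_add mult_ac)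
    then have "geo_bounded (F v)" by (rule geo_boundedI)
    moreover have "supp_in {0..n} (F v)"
      unfolding supp_in_def
    proof (intro allI impI)
      fix \<gamma> assume "F v \<gamma> \<noteq> 0"
      then have "f (sg v 1 + \<gamma>) \<noteq> 0" by (auto simp: F_def split: if_splits)
      then have "sg v 1 + \<gamma> \<in> expos {0..n}" using fs unfolding supp_in_def by blast
      then show "\<gamma> \<in> expos {0..n}" by simp
    qed
    ultimately show ?thesis using f0 by (auto simp: order_ge_def carrier_cps_iff F_def)
  qed
  moreover have "f \<alpha> = (\<Sum>v\<in>{0..n}. sh (sg v 1) (F v) \<alpha>)" for \<alpha>
  proof (cases "f \<alpha> = 0")
    case True
    have "sh (sg v 1) (F v) \<alpha> = 0" for v
      using True by (auto simp: sh_def F_def expo_le_diff_add)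
    then show ?thesis using True by simp
  next
    case False
    then have \<alpha>: "\<alpha> \<noteq> 0" "\<alpha> \<in> expos {0..n}" using f0[of 0] fs by (auto simp: supp_in_def)
    define v0 where "v0 = (LEAST v. lk \<alpha> v \<noteq> 0)"
    have ex: "\<exists>v. lk \<alpha> v \<noteq> 0" using \<alpha>(1) by (metis lookup_zero poly_mapping_eqI)
    have v0: "lk \<alpha> v0 \<noteq> 0" "\<And>w. w < v0 \<Longrightarrow> lk \<alpha> w = 0"
      unfolding v0_def using LeastI_ex[OF ex] not_less_Least by blast+
    have v0n: "v0 \<le> n" using v0(1) \<alpha>(2) by (force simp: expos_iff)
    have other: "sh (sg v 1) (F v) \<alpha> = 0" if "v \<noteq> v0" for v
    proof (rule ccontr)
      assume "sh (sg v 1) (F v) \<alpha> \<noteq> 0"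
      then obtain \<delta> where \<delta>: "\<alpha> = sg v 1 + \<delta>" "F v \<delta> \<noteq> 0" by (rule sh_nonzeroE)
      then have z: "\<And>w. w < v \<Longrightarrow> lk \<delta> w = 0" by (auto simp: F_def split: if_splits)
      have "lk \<alpha> v \<noteq> 0" using \<delta> by (simp add: lookup_add)
      then have "v0 < v" using v0(2)[of v] that by (meson linorder_neqE_nat)
      then have "lk \<alpha> v0 = 0" using z[of v0] \<delta>(1) by (simp add: lookup_add lookup_single)
      then show False using v0(1) by simp
    qed
    have "expo_le (sg v0 1) \<alpha>" using v0(1) by (simp add: expo_le_single_iff)
    then obtain \<delta> where \<delta>: "\<alpha> = sg v0 1 + \<delta>" by (auto simp: expo_le_iff)
    have "lk \<delta> w = 0" if "w < v0" for w using v0(2)[OF that] \<delta> by (simp add: lookup_add)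
    then have "sh (sg v0 1) (F v0) \<alpha> = f \<alpha>" using v0n by (simp add: \<delta> F_def)
    moreover have "(\<Sum>v\<in>{0..n}. sh (sg v 1) (F v) \<alpha>) = (\<Sum>v\<in>{0..n}. if v0 = v then sh (sg v0 1) (F v0) \<alpha> else 0)"
      using other by (intro sum.cong) auto
    ultimately show ?thesis using v0n by simp
  qed
  ultimately show ?thesis using that[of F] by blast
qed

lemma var_order_ge: "v \<le> n \<Longrightarrow> cps_var v \<in> order_ge n 1"
  using var_carrier[of "{0..n}" v] by (auto simp: order_ge_def cps_var_def One_nat_def split: if_splits)
    (metis One_nat_def expo_deg_single expo_deg_zero zero_neq_one)

lemma order_ge_carrier: "f \<in> order_ge n k \<Longrightarrow> f \<in> carrier R"
  by (simp add: order_ge_def)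

text \<open>One inclusion is additivity of orders. The other writes a series of order k + 1 as a
  combination of the variables with coefficients of order k.\<close>

lemma ideal_pow_L: "ideal_pow L (nonunits L) k = \<pi> ` order_ge n k"
proof (induction k)
  case 0
  have "order_ge n 0 = carrier R" by (simp add: order_ge_def)
  then show ?case by (simp add: carrier_L)
next
  case (Suc k)
  have "\<pi> ` order_ge n 1 \<cdot>\<^bsub>L\<^esub> \<pi> ` order_ge n k = \<pi> ` order_ge n (Suc k)"
  proof (intro equalityI subsetI)
    fix x assume "x \<in> \<pi> ` order_ge n 1 \<cdot>\<^bsub>L\<^esub> \<pi> ` order_ge n k"
    then show "x \<in> \<pi> ` order_ge n (Suc k)"
    proof induction
      case (prod i j)
      then obtain f g where fg: "f \<in> order_ge n 1" "g \<in> order_ge n k" "i = \<pi> f" "j = \<pi> g" by auto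
      then have "i \<otimes>\<^bsub>L\<^esub> j = \<pi> (cmul f g)" by (simp add: \<pi>_mult order_ge_carrier)
      then show ?case using order_ge_mult[OF fg(1,2)] by (simp add: One_nat_def)
    next
      case (sum s1 s2)
      then obtain f g where fg: "f \<in> order_ge n (Suc k)" "g \<in> order_ge n (Suc k)" "s1 = \<pi> f" "s2 = \<pi> g" by auto
      then have "s1 \<oplus>\<^bsub>L\<^esub> s2 = \<pi> (\<lambda>\<alpha>. f \<alpha> + g \<alpha>)" by (simp add: \<pi>_add order_ge_carrier)
      then show ?case using order_ge_lin(1)[OF fg(1,2)] by simp
    qed
  next
    fix x assume "x \<in> \<pi> ` order_ge n (Suc k)"
    then obtain f where f: "f \<in> order_ge n (Suc k)" "x = \<pi> f" by auto
    obtain F where F: "\<And>v. F v \<in> order_ge n k" "f = (\<lambda>\<alpha>. \<Sum>v\<in>{0..n}. sh (sg v 1) (F v) \<alpha>)"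
      using order_ge_decompose[OF f(1)] by blast
    have trm: "\<pi> (sh (sg v 1) (F v)) \<in> \<pi> ` order_ge n 1 \<cdot>\<^bsub>L\<^esub> \<pi> ` order_ge n k" if "v \<le> n" for v
    proof -
      have "\<pi> (sh (sg v 1) (F v)) = \<pi> (cps_var v) \<otimes>\<^bsub>L\<^esub> \<pi> (F v)"
        unfolding \<pi>_mult[OF order_ge_carrier[OF var_order_ge[OF that]] order_ge_carrier[OF F(1)]] cmul_var ..
      then show ?thesis using F(1) var_order_ge[OF that] by (auto intro: ideal_prod.prod)
    qed
    have sc: "sh (sg v 1) (F v) \<in> carrier R" if "v \<le> n" for v
      using F(1)[of v] that by (intro sh_carrier) (auto simp: order_ge_carrier)
    have "\<pi> (\<lambda>\<alpha>. \<Sum>v\<in>{0..m}. sh (sg v 1) (F v) \<alpha>) \<in> \<pi> ` order_ge n 1 \<cdot>\<^bsub>L\<^esub> \<pi> ` order_ge n k" if "m \<le> n" for m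
      using that
    proof (induction m)
      case 0
      then show ?case using trm[of 0] by simp
    next
      case (Suc m)
      have "\<pi> (\<lambda>\<alpha>. \<Sum>v\<in>{0..Suc m}. sh (sg v 1) (F v) \<alpha>) =
        \<pi> (\<lambda>\<alpha>. \<Sum>v\<in>{0..m}. sh (sg v 1) (F v) \<alpha>) \<oplus>\<^bsub>L\<^esub> \<pi> (sh (sg (Suc m) 1) (F (Suc m)))"
        using Suc.prems by (subst \<pi>_add) (auto intro!: lideal_sum[OF lideal_carrier] sc)
      then show ?case using Suc trm by (auto intro: ideal_prod.sum)
    qed
    then show "x \<in> \<pi> ` order_ge n 1 \<cdot>\<^bsub>L\<^esub> \<pi> ` order_ge n k" using F(2) f(2) by blast
  qed
  then show ?case using Suc.IH nonunits_L by simp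
qed

lemma pow_ideal: "ideal (\<pi> ` order_ge n k) L"
proof -
  interpret L: cring L by (rule cring_L)
  note oc = order_ge_carrier
  show ?thesis
  proof (rule idealI)
    show "subgroup (\<pi> ` order_ge n k) (add_monoid L)"
    proof (rule L.add.subgroupI)
      show "\<pi> ` order_ge n k \<subseteq> carrier L" by (auto simp: carrier_L oc)
      have "(\<lambda>\<alpha>. 0) \<in> order_ge n k" using carrier_lin(1) by (simp add: order_ge_def)
      then show "\<pi> ` order_ge n k \<noteq> {}" by blast
      fix x assume "x \<in> \<pi> ` order_ge n k"
      then obtain f where f: "f \<in> order_ge n k" "x = \<pi> f" by auto
      have m: "(\<lambda>\<alpha>. - 1 * f \<alpha>) \<in> order_ge n k" by (rule order_ge_lin(2)[OF f(1)])
      have "\<pi> (\<lambda>\<alpha>. - 1 * f \<alpha>) \<oplus>\<^bsub>L\<^esub> x = \<zero>\<^bsub>L\<^esub>"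
        unfolding f(2) quot_simps(5)[OF ideal] by (subst \<pi>_add) (use f m in \<open>auto simp: oc\<close>)
      then have "\<ominus>\<^bsub>L\<^esub> x = \<pi> (\<lambda>\<alpha>. - 1 * f \<alpha>)"
        using f m by (intro L.minus_equality) (auto simp: carrier_L oc)
      then show "\<ominus>\<^bsub>L\<^esub> x \<in> \<pi> ` order_ge n k" using m by simp
      fix y assume "y \<in> \<pi> ` order_ge n k"
      then obtain g where g: "g \<in> order_ge n k" "y = \<pi> g" by auto
      then show "x \<oplus>\<^bsub>L\<^esub> y \<in> \<pi> ` order_ge n k"
        using f order_ge_lin(1)[OF f(1) g(1)] by (simp add: \<pi>_add oc)
    qed
    have z: "carrier R = order_ge n 0" by (simp add: order_ge_def)
    show "x \<otimes>\<^bsub>L\<^esub> a \<in> \<pi> ` order_ge n k" "a \<otimes>\<^bsub>L\<^esub> x \<in> \<pi> ` order_ge n k"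
      if ax: "a \<in> \<pi> ` order_ge n k" "x \<in> carrier L" for a x
    proof -
      obtain f g where fg: "f \<in> order_ge n k" "a = \<pi> f" "g \<in> carrier R" "x = \<pi> g"
        using ax unfolding carrier_L by blast
      have "cmul g f \<in> order_ge n k" "cmul f g \<in> order_ge n k"
        using order_ge_mult[of g 0 f k] order_ge_mult[of f k g 0] fg z by auto
      then show "x \<otimes>\<^bsub>L\<^esub> a \<in> \<pi> ` order_ge n k" "a \<otimes>\<^bsub>L\<^esub> x \<in> \<pi> ` order_ge n k"
        unfolding fg(2,4) \<pi>_mult[OF fg(3) oc[OF fg(1)]] \<pi>_mult[OF oc[OF fg(1)] fg(3)] by blast+
    qed
  qed (rule L.ring_axioms)
qed

end


lemma Units_carrier_update_iff:
  "x \<in> Units (S\<lparr>carrier := K\<rparr>) \<longleftrightarrow> x \<in> K \<and> (\<exists>y\<in>K. y \<otimes>\<^bsub>S\<^esub> x = \<one>\<^bsub>S\<^esub> \<and> x \<otimes>\<^bsub>S\<^esub> y = \<one>\<^bsub>S\<^esub>)"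
  by (simp add: Units_def)

section \<open>Truncations of the local ring as vector spaces\<close>

context proper_cps_ideal
begin

abbreviation Q where "Q m \<equiv> L Quot (\<pi> ` order_ge n m)"
abbreviation \<rho> where "\<rho> m f \<equiv> (\<pi> ` order_ge n m) +>\<^bsub>L\<^esub> \<pi> f"

lemma cring_Q: "cring (Q m)"
  by (rule ideal.quotient_is_cring[OF pow_ideal cring_L])

lemma \<pi>_closed: "f \<in> carrier R \<Longrightarrow> \<pi> f \<in> carrier L"
  by (simp add: carrier_L)

lemma carrier_Q: "carrier (Q m) = \<rho> m ` carrier R"
  unfolding quot_simps(1)[OF pow_ideal] carrier_L image_image ..

lemma \<rho>_mult: "f \<in> carrier R \<Longrightarrow> g \<in> carrier R \<Longrightarrow> \<rho> m f \<otimes>\<^bsub>Q m\<^esub> \<rho> m g = \<rho> m (cmul f g)"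
  by (simp add: quot_simps(2)[OF pow_ideal \<pi>_closed \<pi>_closed] \<pi>_mult)

lemma \<rho>_add: "f \<in> carrier R \<Longrightarrow> g \<in> carrier R \<Longrightarrow> \<rho> m f \<oplus>\<^bsub>Q m\<^esub> \<rho> m g = \<rho> m (\<lambda>\<alpha>. f \<alpha> + g \<alpha>)"
  by (simp add: quot_simps(3)[OF pow_ideal \<pi>_closed \<pi>_closed] \<pi>_add)

lemma \<rho>_one: "\<one>\<^bsub>Q m\<^esub> = \<rho> m (cps_const 1)"
  by (simp add: quot_simps(4)[OF pow_ideal] quot_simps(4)[OF ideal] cps_const_def)

lemma \<rho>_zero: "\<zero>\<^bsub>Q m\<^esub> = \<rho> m (\<lambda>\<alpha>. 0)"
  by (simp add: quot_simps(5)[OF pow_ideal] quot_simps(5)[OF ideal])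

lemma \<rho>_eq_iff:
  assumes f: "f \<in> carrier R" and g: "g \<in> carrier R"
  shows "\<rho> m f = \<rho> m g \<longleftrightarrow> (\<exists>u\<in>order_ge n m. (\<lambda>\<alpha>. f \<alpha> - g \<alpha> - u \<alpha>) \<in> J)"
proof -
  interpret L: cring L by (rule cring_L)
  let ?d = "\<lambda>\<alpha>. f \<alpha> - g \<alpha>"
  have d: "?d \<in> carrier R" by (rule carrier_lin(5)[OF f g])
  have "\<pi> f = \<pi> ?d \<oplus>\<^bsub>L\<^esub> \<pi> g" using d g by (simp add: \<pi>_add)
  then have "\<pi> f \<ominus>\<^bsub>L\<^esub> \<pi> g = \<pi> ?d"
    using \<pi>_closed[OF d] \<pi>_closed[OF g] by (simp add: a_minus_def L.a_assoc L.r_neg)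
  then have "\<rho> m f = \<rho> m g \<longleftrightarrow> \<pi> ?d \<in> \<pi> ` order_ge n m"
    using L.quotient_eq_iff_same_a_r_cos[OF pow_ideal \<pi>_closed[OF f] \<pi>_closed[OF g], of m] by simp
  also have "\<dots> \<longleftrightarrow> (\<exists>u\<in>order_ge n m. \<pi> ?d = \<pi> u)" by (simp add: image_iff)
  also have "\<dots> \<longleftrightarrow> (\<exists>u\<in>order_ge n m. (\<lambda>\<alpha>. f \<alpha> - g \<alpha> - u \<alpha>) \<in> J)"
    by (rule bex_cong[OF refl]) (rule \<pi>_eq_iff[OF d order_ge_carrier])
  finally show ?thesis .
qed

lemma const_closed: "cps_const c \<in> carrier R"
  by (rule const_carrier) simp

lemma \<rho>_nontrivial:
  assumes "0 < m" "c \<noteq> 0"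
  shows "\<rho> m (cps_const c) \<noteq> \<zero>\<^bsub>Q m\<^esub>"
proof
  assume "\<rho> m (cps_const c) = \<zero>\<^bsub>Q m\<^esub>"
  then obtain u where u: "u \<in> order_ge n m" "(\<lambda>\<alpha>. cps_const c \<alpha> - 0 - u \<alpha>) \<in> J"
    unfolding \<rho>_zero using \<rho>_eq_iff[OF const_closed carrier_lin(1)] by auto
  then have "c - u 0 = 0" using nonunit_of_mem[OF u(2)] by (simp add: cps_const_def)
  moreover have "u 0 = 0" using u(1) assms by (simp add: order_ge_def)
  ultimately show False using assms by simp
qed

text \<open>For m = 0 the quotient is the zero ring, where the constants do not form a
  field.\<close>

lemma subfield_const:
  assumes m: "0 < m"
  shows "subfield (range (\<lambda>c. \<rho> m (cps_const c))) (Q m)"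
proof -
  interpret Q: cring "Q m" by (rule cring_Q)
  let ?K = "range (\<lambda>c. \<rho> m (cps_const c))"
  have add: "\<rho> m (cps_const a) \<oplus>\<^bsub>Q m\<^esub> \<rho> m (cps_const b) = \<rho> m (cps_const (a + b))" for a b
  proof -
    have "(\<lambda>\<alpha>. cps_const a \<alpha> + cps_const b \<alpha>) = (cps_const (a + b) :: expo \<Rightarrow> 'k)" by (auto simp: cps_const_def)
    then show ?thesis by (simp add: \<rho>_add const_closed)
  qed
  have mult: "\<rho> m (cps_const a) \<otimes>\<^bsub>Q m\<^esub> \<rho> m (cps_const b) = \<rho> m (cps_const (a * b))" for a b
  proof -
    have "cmul (cps_const a) (cps_const b) = (cps_const (a * b) :: expo \<Rightarrow> 'k)"
      by (simp only: cmul_const) (auto simp: cps_const_def)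
    then show ?thesis by (simp add: \<rho>_mult const_closed)
  qed
  have zero: "\<rho> m (cps_const 0) = \<zero>\<^bsub>Q m\<^esub>" unfolding \<rho>_zero by (simp add: cps_const_def)
  have closed: "\<rho> m (cps_const a) \<in> carrier (Q m)" for a unfolding carrier_Q using const_closed by blast
  have "subring ?K (Q m)"
  proof (rule Q.subringI)
    show "?K \<subseteq> carrier (Q m)" using closed by blast
    show "\<one>\<^bsub>Q m\<^esub> \<in> ?K" unfolding \<rho>_one by blast
    fix h assume "h \<in> ?K"
    then obtain a where a: "h = \<rho> m (cps_const a)" by blast
    have "\<ominus>\<^bsub>Q m\<^esub> h = \<rho> m (cps_const (- a))"
      unfolding a by (rule Q.minus_equality) (auto simp: add zero closed)
    then show "\<ominus>\<^bsub>Q m\<^esub> h \<in> ?K" by blast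
    fix h' assume "h' \<in> ?K"
    then obtain b where b: "h' = \<rho> m (cps_const b)" by blast
    show "h \<otimes>\<^bsub>Q m\<^esub> h' \<in> ?K" unfolding a b mult by blast
    show "h \<oplus>\<^bsub>Q m\<^esub> h' \<in> ?K" unfolding a b add by blast
  qed
  then have "subcring ?K (Q m)" by (rule Q.subcringI')
  moreover have "Units (Q m \<lparr>carrier := ?K\<rparr>) = ?K - {\<zero>\<^bsub>Q m\<^esub>}"
  proof (intro equalityI subsetI)
    fix x assume "x \<in> Units (Q m \<lparr>carrier := ?K\<rparr>)"
    then have "x \<in> ?K \<and> (\<exists>y\<in>?K. y \<otimes>\<^bsub>Q m\<^esub> x = \<one>\<^bsub>Q m\<^esub> \<and> x \<otimes>\<^bsub>Q m\<^esub> y = \<one>\<^bsub>Q m\<^esub>)"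
      unfolding Units_carrier_update_iff .
    then obtain y where xy: "x \<in> ?K" "y \<in> ?K" "x \<otimes>\<^bsub>Q m\<^esub> y = \<one>\<^bsub>Q m\<^esub>" by (elim conjE bexE)
    have y: "y \<in> carrier (Q m)" using xy(2) closed by blast
    have nontriv: "\<one>\<^bsub>Q m\<^esub> \<noteq> \<zero>\<^bsub>Q m\<^esub>" unfolding \<rho>_one by (rule \<rho>_nontrivial[OF m]) (rule one_neq_zero)
    have "x \<noteq> \<zero>\<^bsub>Q m\<^esub>"
    proof
      assume "x = \<zero>\<^bsub>Q m\<^esub>"
      with xy(3) have "\<one>\<^bsub>Q m\<^esub> = \<zero>\<^bsub>Q m\<^esub>" by (simp only: Q.l_null[OF y])
      with nontriv show False by (rule notE)
    qed
    then show "x \<in> ?K - {\<zero>\<^bsub>Q m\<^esub>}" using xy(1) by blast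
  next
    fix x assume "x \<in> ?K - {\<zero>\<^bsub>Q m\<^esub>}"
    then obtain a where a: "x = \<rho> m (cps_const a)" "x \<noteq> \<zero>\<^bsub>Q m\<^esub>" by blast
    then have "a \<noteq> 0" using zero by auto
    then have i: "x \<otimes>\<^bsub>Q m\<^esub> \<rho> m (cps_const (1 / a)) = \<one>\<^bsub>Q m\<^esub>" "\<rho> m (cps_const (1 / a)) \<otimes>\<^bsub>Q m\<^esub> x = \<one>\<^bsub>Q m\<^esub>"
      unfolding a(1) mult \<rho>_one by simp_all
    have "\<exists>y\<in>?K. y \<otimes>\<^bsub>Q m\<^esub> x = \<one>\<^bsub>Q m\<^esub> \<and> x \<otimes>\<^bsub>Q m\<^esub> y = \<one>\<^bsub>Q m\<^esub>"
      by (rule bexI[of _ "\<rho> m (cps_const (1 / a))"]) (use i in auto)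
    then show "x \<in> Units (Q m \<lparr>carrier := ?K\<rparr>)"
      using a(1) unfolding Units_carrier_update_iff by blast
  qed
  ultimately show ?thesis by (rule Q.subfieldI)
qed

section \<open>Standard monomials\<close>

definition std_monoms :: "nat \<Rightarrow> expo set" where
  "std_monoms m = {\<alpha> \<in> expos {0..n} - initial_diagram n J. expo_deg \<alpha> < m}"

definition monom_span :: "expo set \<Rightarrow> (expo \<Rightarrow> 'k) set" where
  "monom_span G = {c \<in> carrier R. \<forall>\<alpha>. c \<alpha> \<noteq> 0 \<longrightarrow> \<alpha> \<in> G}"

abbreviation mon :: "expo \<Rightarrow> expo \<Rightarrow> 'k" where
  "mon \<alpha> \<equiv> (\<lambda>\<gamma>. if \<gamma> = \<alpha> then 1 else 0)"

lemma mon_closed: "\<alpha> \<in> expos {0..n} \<Longrightarrow> mon \<alpha> \<in> carrier R"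
  by (rule monomial_carrier) auto

lemma finite_std_monoms: "finite (std_monoms m)"
  by (rule finite_subset[OF _ finite_expos_deg_le[of "{0..n}" m]]) (auto simp: std_monoms_def)

text \<open>\<open>h\<close> and \<open>h - u\<close> agree in degrees below m. If \<open>h\<close>
  were nonzero, the initial exponent of \<open>h - u\<close> would have degree below m and so occur
  in \<open>h\<close>, whose exponents avoid the diagram.\<close>

lemma std_monoms_independent:
  assumes h: "h \<in> monom_span (std_monoms m)" and u: "u \<in> order_ge n m" and J: "(\<lambda>\<alpha>. h \<alpha> - u \<alpha>) \<in> J"
  shows "h = (\<lambda>\<alpha>. 0)"
proof (rule ccontr)
  assume "h \<noteq> (\<lambda>\<alpha>. 0)"
  then obtain \<gamma> where \<gamma>: "h \<gamma> \<noteq> 0" by auto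
  then have "\<gamma> \<in> std_monoms m" using h by (auto simp: monom_span_def)
  then have \<gamma>E: "\<gamma> \<in> expos {0..n}" "expo_deg \<gamma> < m" by (auto simp: std_monoms_def)
  then have "u \<gamma> = 0" using u by (auto simp: order_ge_def)
  then have nz: "h \<gamma> - u \<gamma> \<noteq> 0" using \<gamma> by simp
  obtain \<alpha> where \<alpha>: "\<alpha> \<in> initial_diagram n J" "rank n \<alpha> < Suc (rank n \<gamma>)" "h \<alpha> - u \<alpha> \<noteq> 0"
    by (rule lideal_nonzero_meets_diagram[OF lideal J nz, of "Suc (rank n \<gamma>)"]) auto
  have "expo_deg \<alpha> \<le> expo_deg \<gamma>" using \<alpha>(2) by (intro rank_le_imp_deg_le[OF \<gamma>E(1)]) simp
  then have "u \<alpha> = 0" using u \<gamma>E(2) by (auto simp: order_ge_def)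
  then have "\<alpha> \<in> std_monoms m" using \<alpha>(3) h by (auto simp: monom_span_def)
  then show False using \<alpha>(1) by (simp add: std_monoms_def)
qed

text \<open>Division with remainder by increasing rank: the coefficient of rank r is removed by an
  element of \<open>J\<close> with that initial exponent or else by a standard monomial, and neither
  disturbs smaller ranks.\<close>

lemma std_monoms_reduce:
  assumes f: "f \<in> carrier R"
  shows "\<exists>c\<in>monom_span (std_monoms m). \<rho> m f = \<rho> m c"
proof -
  have step: "\<exists>c\<in>monom_span (std_monoms m). \<exists>j\<in>J. \<forall>\<beta>. rank n \<beta> < r \<and> expo_deg \<beta> < m \<longrightarrow> f \<beta> - c \<beta> - j \<beta> = 0" for r
  proof (induction r)
    case 0
    have "(\<lambda>\<alpha>. 0) \<in> monom_span (std_monoms m)" using carrier_lin(1) by (simp add: monom_span_def)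
    then show ?case using lidealD(2)[OF lideal] by auto
  next
    case (Suc r)
    then obtain c j where c: "c \<in> monom_span (std_monoms m)" and j: "j \<in> J"
      and z: "\<And>\<beta>. rank n \<beta> < r \<Longrightarrow> expo_deg \<beta> < m \<Longrightarrow> f \<beta> - c \<beta> - j \<beta> = 0" by blast
    have cc: "c \<in> carrier R" using c by (simp add: monom_span_def)
    define h where "h = (\<lambda>\<beta>. f \<beta> - c \<beta> - j \<beta>)"
    have "h \<in> carrier R" unfolding h_def using lidealD(1)[OF lideal] j by (intro carrier_lin(5) f cc) auto
    then have hs: "supp_in {0..n} h" by (rule supp_in_carrier)
    show ?case
    proof (cases "\<exists>\<alpha>. rank n \<alpha> = r \<and> expo_deg \<alpha> < m \<and> h \<alpha> \<noteq> 0")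
      case False
      then have z': "f \<beta> - c \<beta> - j \<beta> = 0" if "rank n \<beta> < Suc r" "expo_deg \<beta> < m" for \<beta>
        using that z[of \<beta>] by (cases "rank n \<beta> = r") (auto simp: h_def)
      show ?thesis by (rule bexI[OF bexI[OF _ j] c]) (intro allI impI, elim conjE, rule z')
    next
      case True
      then obtain \<alpha> where \<alpha>: "rank n \<alpha> = r" "expo_deg \<alpha> < m" "h \<alpha> \<noteq> 0" by blast
      have \<alpha>E: "\<alpha> \<in> expos {0..n}" using hs \<alpha>(3) by (auto simp: supp_in_def)
      have E: "\<beta> = \<alpha>" if "rank n \<beta> = r" "h \<beta> \<noteq> 0" for \<beta>
        using that hs rank_inj[OF _ \<alpha>E, of \<beta>] \<alpha>(1) by (auto simp: supp_in_def)
      show ?thesis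
      proof (cases "\<alpha> \<in> initial_diagram n J")
        case True
        then obtain g where g: "g \<in> J" "lead n g \<alpha>" using initial_diagram_iff[OF lideal] by blast
        define b where "b = h \<alpha> / g \<alpha>"
        have j': "(\<lambda>\<beta>. j \<beta> + b * g \<beta>) \<in> J" by (intro lidealD[OF lideal] j g)
        have z': "f \<beta> - c \<beta> - (j \<beta> + b * g \<beta>) = 0" if \<beta>: "rank n \<beta> < Suc r" "expo_deg \<beta> < m" for \<beta>
        proof (cases "\<beta> = \<alpha>")
          case True
          then show ?thesis using g(2) by (simp add: b_def h_def lead_def)
        next
          case False
          have gs: "supp_in {0..n} g" using g(1) lidealD(1)[OF lideal] by (intro supp_in_carrier) auto
          have "g \<beta> = 0"
          proof (rule ccontr)
            assume nz: "g \<beta> \<noteq> 0"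
            then have "rank n \<alpha> \<le> rank n \<beta>" using g(2) by (simp add: lead_def)
            then have "rank n \<beta> = rank n \<alpha>" using \<beta> \<alpha>(1) by simp
            then show False using rank_inj[OF _ \<alpha>E, of \<beta>] gs nz False by (auto simp: supp_in_def)
          qed
          moreover have "h \<beta> = 0" using z[of \<beta>] E[of \<beta>] \<beta> False by (auto simp: h_def less_Suc_eq)
          ultimately show ?thesis by (simp add: h_def)
        qed
        show ?thesis by (rule bexI[OF bexI[OF _ j'] c]) (intro allI impI, elim conjE, rule z')
      next
        case False
        then have \<alpha>S: "\<alpha> \<in> std_monoms m" using \<alpha>E \<alpha>(2) by (simp add: std_monoms_def)
        define c' where "c' = (\<lambda>\<beta>. c \<beta> + h \<alpha> * mon \<alpha> \<beta>)"
        have "c' \<in> carrier R" unfolding c'_def by (intro carrier_lin(2,3) cc mon_closed \<alpha>E)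
        then have c': "c' \<in> monom_span (std_monoms m)"
          using c \<alpha>S by (auto simp: monom_span_def c'_def split: if_splits)
        have z': "f \<beta> - c' \<beta> - j \<beta> = 0" if \<beta>: "rank n \<beta> < Suc r" "expo_deg \<beta> < m" for \<beta>
        proof (cases "\<beta> = \<alpha>")
          case True
          then show ?thesis by (simp add: c'_def h_def)
        next
          case False
          have "h \<beta> = 0" using z[of \<beta>] E[of \<beta>] \<beta> False by (auto simp: h_def less_Suc_eq)
          then show ?thesis using False by (simp add: c'_def h_def)
        qed
        show ?thesis by (rule bexI[OF bexI[OF _ j] c']) (intro allI impI, elim conjE, rule z')
      qed
    qed
  qed
  \<comment> \<open>Finitely many steps clear all degrees below m; what remains has order at least
    m.\<close>
  define r where "r = Suc (Max (insert 0 (rank n ` {\<alpha> \<in> expos {0..n}. expo_deg \<alpha> \<le> m})))"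
  have r: "rank n \<alpha> < r" if "\<alpha> \<in> expos {0..n}" "expo_deg \<alpha> \<le> m" for \<alpha>
    unfolding r_def less_Suc_eq_le using that by (intro Max_ge) (auto simp: finite_expos_deg_le)
  obtain c j where c: "c \<in> monom_span (std_monoms m)" and j: "j \<in> J"
    and z: "\<And>\<beta>. rank n \<beta> < r \<Longrightarrow> expo_deg \<beta> < m \<Longrightarrow> f \<beta> - c \<beta> - j \<beta> = 0"
    using step[of r] by blast
  have cc: "c \<in> carrier R" using c by (simp add: monom_span_def)
  define u where "u = (\<lambda>\<beta>. f \<beta> - c \<beta> - j \<beta>)"
  have uc: "u \<in> carrier R" unfolding u_def using lidealD(1)[OF lideal] j by (intro carrier_lin(5) f cc) auto
  have "u \<beta> = 0" if "expo_deg \<beta> < m" for \<beta>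
  proof (cases "\<beta> \<in> expos {0..n}")
    case True
    then show ?thesis using z[of \<beta>] r[of \<beta>] that by (simp add: u_def)
  next
    case False
    then show ?thesis using supp_in_carrier[OF uc] by (simp add: supp_inD)
  qed
  then have "u \<in> order_ge n m" using uc by (simp add: order_ge_def)
  moreover have "(\<lambda>\<alpha>. f \<alpha> - c \<alpha> - u \<alpha>) = j" by (simp add: u_def)
  ultimately have "\<rho> m f = \<rho> m c" unfolding \<rho>_eq_iff[OF f cc] using j by (intro bexI[of _ u]) simp_all
  then show ?thesis using c by blast
qed

text \<open>\<open>dimension\<close> is built up by line extensions, so monomials are added one at a
  time; independence shows that each is new.\<close>

lemma dimension_monom_span:
  assumes "finite G" "G \<subseteq> std_monoms m"
  shows "ring.dimension (Q m) (card G) (range (\<lambda>c. \<rho> m (cps_const c))) (\<rho> m ` monom_span G)"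
  using assms
proof (induction G)
  case empty
  interpret Q: cring "Q m" by (rule cring_Q)
  have "monom_span {} = {\<lambda>\<alpha>. 0}" using carrier_lin(1) by (auto simp: monom_span_def)
  then have "\<rho> m ` monom_span {} = {\<zero>\<^bsub>Q m\<^esub>}" by (simp add: \<rho>_zero)
  then show ?case using Q.zero_dim by simp
next
  case (insert \<alpha> G)
  interpret Q: cring "Q m" by (rule cring_Q)
  let ?K = "range (\<lambda>c. \<rho> m (cps_const c))"
  have \<alpha>E: "\<alpha> \<in> expos {0..n}" using insert.prems by (auto simp: std_monoms_def)
  have mc: "mon \<alpha> \<in> carrier R" by (rule mon_closed[OF \<alpha>E])
  have span_carrier: "c \<in> carrier R" if "c \<in> monom_span H" for c H using that by (simp add: monom_span_def)
  have notin: "\<rho> m (mon \<alpha>) \<notin> \<rho> m ` monom_span G"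
  proof
    assume "\<rho> m (mon \<alpha>) \<in> \<rho> m ` monom_span G"
    then obtain c where c: "c \<in> monom_span G" "\<rho> m (mon \<alpha>) = \<rho> m c" by blast
    then obtain u where u: "u \<in> order_ge n m" "(\<lambda>\<gamma>. mon \<alpha> \<gamma> - c \<gamma> - u \<gamma>) \<in> J"
      using \<rho>_eq_iff[OF mc span_carrier[OF c(1)]] by blast
    have "(\<lambda>\<gamma>. mon \<alpha> \<gamma> - c \<gamma>) \<in> monom_span (std_monoms m)"
      using carrier_lin(5)[OF mc span_carrier[OF c(1)]] c(1) insert.prems
      by (auto simp: monom_span_def split: if_splits)
    then have "(\<lambda>\<gamma>. mon \<alpha> \<gamma> - c \<gamma>) = (\<lambda>\<gamma>. 0)" by (rule std_monoms_independent[OF _ u])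
    from fun_cong[OF this, of \<alpha>] have "c \<alpha> = 1" by simp
    then show False using c(1) insert.hyps by (auto simp: monom_span_def)
  qed
  have lin: "\<rho> m (cps_const a) \<otimes>\<^bsub>Q m\<^esub> \<rho> m (mon \<alpha>) \<oplus>\<^bsub>Q m\<^esub> \<rho> m c = \<rho> m (\<lambda>\<gamma>. a * mon \<alpha> \<gamma> + c \<gamma>)"
    if "c \<in> carrier R" for a c
    using that carrier_lin(3)[OF mc, of a] by (simp add: \<rho>_mult \<rho>_add const_closed mc cmul_const del: mult_cancel_right1)
  have "Q.line_extension ?K (\<rho> m (mon \<alpha>)) (\<rho> m ` monom_span G) = \<rho> m ` monom_span (insert \<alpha> G)"
  proof (intro equalityI subsetI)
    fix x assume "x \<in> Q.line_extension ?K (\<rho> m (mon \<alpha>)) (\<rho> m ` monom_span G)"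
    then obtain a c where ac: "c \<in> monom_span G" "x = \<rho> m (cps_const a) \<otimes>\<^bsub>Q m\<^esub> \<rho> m (mon \<alpha>) \<oplus>\<^bsub>Q m\<^esub> \<rho> m c"
      unfolding Q.line_extension_mem_iff by blast
    have "(\<lambda>\<gamma>. a * mon \<alpha> \<gamma> + c \<gamma>) \<in> carrier R" by (intro carrier_lin(2,3) mc span_carrier[OF ac(1)])
    then have "(\<lambda>\<gamma>. a * mon \<alpha> \<gamma> + c \<gamma>) \<in> monom_span (insert \<alpha> G)"
      using ac(1) by (auto simp: monom_span_def split: if_splits)
    then show "x \<in> \<rho> m ` monom_span (insert \<alpha> G)"
      unfolding ac(2) lin[OF span_carrier[OF ac(1)]] by blast
  next
    fix x assume "x \<in> \<rho> m ` monom_span (insert \<alpha> G)"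
    then obtain c where c: "c \<in> monom_span (insert \<alpha> G)" "x = \<rho> m c" by blast
    define c' where "c' = (\<lambda>\<gamma>. c \<gamma> - c \<alpha> * mon \<alpha> \<gamma>)"
    have "c' \<in> carrier R" unfolding c'_def by (intro carrier_lin(3,5) mc span_carrier[OF c(1)])
    then have c': "c' \<in> monom_span G"
      using c(1) by (auto simp: monom_span_def c'_def split: if_splits)
    have "x = \<rho> m (cps_const (c \<alpha>)) \<otimes>\<^bsub>Q m\<^esub> \<rho> m (mon \<alpha>) \<oplus>\<^bsub>Q m\<^esub> \<rho> m c'"
      unfolding lin[OF span_carrier[OF c']] c(2) by (simp add: c'_def)
    then show "x \<in> Q.line_extension ?K (\<rho> m (mon \<alpha>)) (\<rho> m ` monom_span G)"
      unfolding Q.line_extension_mem_iff using c' by blast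
  qed
  moreover have "Q.dimension (Suc (card G)) ?K (Q.line_extension ?K (\<rho> m (mon \<alpha>)) (\<rho> m ` monom_span G))"
    using insert notin mc by (intro Q.Suc_dim) (auto simp: carrier_Q)
  ultimately show ?case using insert.hyps by simp
qed

lemma hilbert_samuel_eq:
  "hilbert_samuel L (\<lambda>c. \<pi> (cps_const c)) k = card (std_monoms (k + 1))"
proof -
  let ?m = "k + 1"
  interpret Q: cring "Q ?m" by (rule cring_Q)
  let ?K = "range (\<lambda>c. \<rho> ?m (cps_const c))"
  have "\<rho> ?m ` monom_span (std_monoms ?m) = carrier (Q ?m)"
  proof
    show "\<rho> ?m ` monom_span (std_monoms ?m) \<subseteq> carrier (Q ?m)" by (auto simp: carrier_Q monom_span_def)
    show "carrier (Q ?m) \<subseteq> \<rho> ?m ` monom_span (std_monoms ?m)"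
    proof
      fix x assume "x \<in> carrier (Q ?m)"
      then obtain f where f: "f \<in> carrier R" "x = \<rho> ?m f" unfolding carrier_Q by blast
      obtain c where c: "c \<in> monom_span (std_monoms ?m)" "\<rho> ?m f = \<rho> ?m c"
        using std_monoms_reduce[OF f(1), of ?m] by blast
      show "x \<in> \<rho> ?m ` monom_span (std_monoms ?m)" unfolding f(2) c(2) by (rule imageI[OF c(1)])
    qed
  qed
  then have dim: "Q.dimension (card (std_monoms ?m)) ?K (carrier (Q ?m))"
    using dimension_monom_span[OF finite_std_monoms order_refl, of ?m] by simp
  have "Q.dim ?K (carrier (Q ?m)) = card (std_monoms ?m)"
    unfolding Q.dim_def
  proof (rule the_equality)
    show "Q.dimension (card (std_monoms ?m)) ?K (carrier (Q ?m))" by (rule dim)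
    fix d assume "Q.dimension d ?K (carrier (Q ?m))"
    then show "d = card (std_monoms ?m)"
      by (rule Q.dimension_is_inj[OF subfield_const _ dim, rotated]) simp
  qed
  then show ?thesis unfolding hilbert_samuel_def Let_def ideal_pow_L by simp
qed

end

text \<open>An element with initial exponent 0 is a unit, so the diagram shows whether the strict
  transform misses the point.\<close>

lemma diagram_zero_iff:
  fixes J :: "(expo \<Rightarrow> 'k::real_normed_field) set"
  assumes J: "ideal J (cps {0..n})"
  shows "J = carrier (cps {0..n}) \<longleftrightarrow> 0 \<in> initial_diagram n J"
proof -
  have l: "lideal {0..n} J" by (rule ideal_imp_lideal[OF _ J]) simp
  show ?thesis
  proof
    assume eq: "J = carrier (cps {0..n})"
    have "(\<lambda>\<alpha>. if \<alpha> = 0 then 1 else 0) \<in> J"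
      unfolding eq by (rule monomial_carrier) auto
    moreover have "lead n (\<lambda>\<alpha>. if \<alpha> = 0 then 1 else (0::'k)) 0" by (simp add: lead_def)
    ultimately show "0 \<in> initial_diagram n J" using initial_diagram_iff[OF l] by blast
  next
    assume "0 \<in> initial_diagram n J"
    then obtain f where f: "f \<in> J" "f 0 \<noteq> 0" using initial_diagram_iff[OF l] by (auto simp: lead_def)
    show "J = carrier (cps {0..n})"
    proof (rule ccontr)
      assume "J \<noteq> carrier (cps {0..n})"
      then interpret proper_cps_ideal n J by (rule proper_cps_ideal.intro[OF J])
      show False using nonunit_of_mem[OF f(1)] f(2) by simp
    qed
  qed
qed


section \<open>Algebraic subvarieties\<close>

definition mpoly_funs :: "'v set \<Rightarrow> (('v \<Rightarrow> 'k::field) \<Rightarrow> 'k) set" where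
  "mpoly_funs V = {mpoly_eval q | q. \<forall>m\<in>Poly_Mapping.keys q. Poly_Mapping.keys m \<subseteq> V}"

definition mpoly_monom :: "('v \<Rightarrow>\<^sub>0 nat) \<Rightarrow> ('v \<Rightarrow> 'k::field) \<Rightarrow> 'k" where
  "mpoly_monom m A = (\<Prod>v\<in>Poly_Mapping.keys m. A v ^ Poly_Mapping.lookup m v)"

lemma mpoly_eval_eq: "mpoly_eval q A = (\<Sum>m\<in>Poly_Mapping.keys q. Poly_Mapping.lookup q m * mpoly_monom m A)"
  by (simp add: mpoly_eval_def mpoly_monom_def)

lemma mpoly_eval_superset:
  "finite G \<Longrightarrow> Poly_Mapping.keys q \<subseteq> G \<Longrightarrow> mpoly_eval q A = (\<Sum>m\<in>G. Poly_Mapping.lookup q m * mpoly_monom m A)"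
  unfolding mpoly_eval_eq by (rule sum.mono_neutral_left) (auto simp: in_keys_iff)

lemma mpoly_monom_superset:
  "finite G \<Longrightarrow> Poly_Mapping.keys m \<subseteq> G \<Longrightarrow> mpoly_monom m A = (\<Prod>v\<in>G. A v ^ Poly_Mapping.lookup m v)"
  unfolding mpoly_monom_def by (rule prod.mono_neutral_left) (auto simp: in_keys_iff)

lemma mpoly_monom_add: "mpoly_monom (m + m') A = mpoly_monom m A * mpoly_monom m' A"
proof -
  let ?G = "Poly_Mapping.keys m \<union> Poly_Mapping.keys m'"
  have "mpoly_monom (m + m') A = (\<Prod>v\<in>?G. A v ^ Poly_Mapping.lookup (m + m') v)"
    by (rule mpoly_monom_superset) (auto simp: keys_add)
  moreover have "mpoly_monom m A = (\<Prod>v\<in>?G. A v ^ Poly_Mapping.lookup m v)"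
    by (rule mpoly_monom_superset) auto
  moreover have "mpoly_monom m' A = (\<Prod>v\<in>?G. A v ^ Poly_Mapping.lookup m' v)"
    by (rule mpoly_monom_superset) auto
  ultimately show ?thesis by (simp add: lookup_add power_add prod.distrib)
qed

lemma mpoly_funs_monom: "Poly_Mapping.keys m \<subseteq> V \<Longrightarrow> (\<lambda>A. c * mpoly_monom m A) \<in> mpoly_funs V"
proof -
  assume m: "Poly_Mapping.keys m \<subseteq> V"
  let ?q = "Poly_Mapping.single m c"
  have "mpoly_eval ?q A = c * mpoly_monom m A" for A
    by (subst mpoly_eval_superset[of "{m}"]) auto
  then have "(\<lambda>A. c * mpoly_monom m A) = mpoly_eval ?q" by (simp add: fun_eq_iff)
  moreover have "\<forall>m'\<in>Poly_Mapping.keys ?q. Poly_Mapping.keys m' \<subseteq> V" using m by simp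
  ultimately show ?thesis unfolding mpoly_funs_def by blast
qed

lemma mpoly_funs_add:
  assumes "f \<in> mpoly_funs V" "g \<in> mpoly_funs V"
  shows "(\<lambda>A. f A + g A) \<in> mpoly_funs V"
proof -
  obtain p where p: "f = mpoly_eval p" "\<forall>m\<in>Poly_Mapping.keys p. Poly_Mapping.keys m \<subseteq> V"
    using assms(1) by (auto simp: mpoly_funs_def)
  obtain q where q: "g = mpoly_eval q" "\<forall>m\<in>Poly_Mapping.keys q. Poly_Mapping.keys m \<subseteq> V"
    using assms(2) by (auto simp: mpoly_funs_def)
  let ?G = "Poly_Mapping.keys p \<union> Poly_Mapping.keys q"
  have "mpoly_eval (p + q) A = f A + g A" for A
    using mpoly_eval_superset[of ?G p A] mpoly_eval_superset[of ?G q A]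
      mpoly_eval_superset[of ?G "p + q" A] Poly_Mapping.keys_add[of p q]
    by (simp add: p(1) q(1) lookup_add ring_distribs sum.distrib)
  then have "(\<lambda>A. f A + g A) = mpoly_eval (p + q)" by (simp add: fun_eq_iff)
  moreover have "\<forall>m\<in>Poly_Mapping.keys (p + q). Poly_Mapping.keys m \<subseteq> V"
    using p(2) q(2) Poly_Mapping.keys_add[of p q] by blast
  ultimately show ?thesis unfolding mpoly_funs_def by blast
qed

lemma mpoly_funs_sum:
  assumes "finite G" "\<And>i. i \<in> G \<Longrightarrow> f i \<in> mpoly_funs V"
  shows "(\<lambda>A. \<Sum>i\<in>G. f i A) \<in> mpoly_funs V"
  using assms
proof (induction G)
  case empty
  show ?case using mpoly_funs_monom[of 0 V 0] by simp
next
  case (insert i G)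
  then show ?case using mpoly_funs_add[of "f i" V] by simp
qed

lemma mpoly_funs_mult:
  assumes "f \<in> mpoly_funs V" "g \<in> mpoly_funs V"
  shows "(\<lambda>A. f A * g A) \<in> mpoly_funs V"
proof -
  obtain p where p: "f = mpoly_eval p" "\<forall>m\<in>Poly_Mapping.keys p. Poly_Mapping.keys m \<subseteq> V"
    using assms(1) by (auto simp: mpoly_funs_def)
  obtain q where q: "g = mpoly_eval q" "\<forall>m\<in>Poly_Mapping.keys q. Poly_Mapping.keys m \<subseteq> V"
    using assms(2) by (auto simp: mpoly_funs_def)
  have "f A * g A = (\<Sum>m\<in>Poly_Mapping.keys p. \<Sum>k\<in>Poly_Mapping.keys q.
      (Poly_Mapping.lookup p m * Poly_Mapping.lookup q k) * mpoly_monom (m + k) A)" for A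
    unfolding p(1) q(1) mpoly_eval_eq sum_product mpoly_monom_add by (simp only: mult.assoc mult.left_commute)
  moreover have "(\<lambda>A. \<Sum>m\<in>Poly_Mapping.keys p. \<Sum>k\<in>Poly_Mapping.keys q.
      (Poly_Mapping.lookup p m * Poly_Mapping.lookup q k) * mpoly_monom (m + k) A) \<in> mpoly_funs V"
  proof (rule mpoly_funs_sum[OF finite_keys], rule mpoly_funs_sum[OF finite_keys], rule mpoly_funs_monom)
    fix m k assume "m \<in> Poly_Mapping.keys p" "k \<in> Poly_Mapping.keys q"
    then show "Poly_Mapping.keys (m + k) \<subseteq> V"
      using p(2) q(2) Poly_Mapping.keys_add[of m k] by blast
  qed
  ultimately show ?thesis by simp
qed

text \<open>Matches the inductive description with the evaluations by which algebraic subvarieties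
  are defined.\<close>

lemma polyfun_eq_mpoly_funs: "polyfun V = mpoly_funs V"
proof (intro equalityI subsetI)
  fix p assume "p \<in> polyfun V"
  then show "p \<in> mpoly_funs V"
  proof induction
    case (const c)
    show ?case using mpoly_funs_monom[of 0 V c] by (simp add: mpoly_monom_def)
  next
    case (coord v)
    then show ?case using mpoly_funs_monom[of "Poly_Mapping.single v 1" V 1] by (simp add: mpoly_monom_def)
  qed (auto intro: mpoly_funs_add mpoly_funs_mult)
next
  fix p assume "p \<in> mpoly_funs V"
  then obtain q where q: "p = mpoly_eval q" "\<forall>m\<in>Poly_Mapping.keys q. Poly_Mapping.keys m \<subseteq> V"
    by (auto simp: mpoly_funs_def)
  have pow: "(\<lambda>A. A v ^ k) \<in> polyfun V" if "v \<in> V" for v k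
  proof (induction k)
    case (Suc k)
    then show ?case using polyfun.mult[OF polyfun.coord[OF that]] by simp
  qed (simp add: polyfun.const)
  have mon: "(\<lambda>A. \<Prod>v\<in>G. A v ^ Poly_Mapping.lookup m v) \<in> polyfun V" if "finite G" "G \<subseteq> V" for m G
    using that by induction (auto intro: polyfun.const polyfun.mult pow)
  have "mpoly_eval q = (\<lambda>A. \<Sum>m\<in>Poly_Mapping.keys q. Poly_Mapping.lookup q m * (\<Prod>v\<in>Poly_Mapping.keys m. A v ^ Poly_Mapping.lookup m v))"
    by (simp add: fun_eq_iff mpoly_eval_def)
  also have "\<dots> \<in> polyfun V"
    by (rule polyfun_sum, rule polyfun.mult[OF polyfun.const mon]) (use q(2) in auto)
  finally show "p \<in> polyfun V" unfolding q(1) .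
qed

lemma algebraic_subvariety_iff:
  "algebraic_subvariety n i Z \<longleftrightarrow> zclosed ({1..i} \<times> {1..n}) (arc_space n i) Z"
proof
  assume "algebraic_subvariety n i Z"
  then obtain P where P: "\<forall>p\<in>P. \<forall>m\<in>Poly_Mapping.keys p. Poly_Mapping.keys m \<subseteq> {1..i} \<times> {1..n}"
    "Z = {a \<in> arc_space n i. \<forall>p\<in>P. mpoly_eval p a = 0}" by (auto simp: algebraic_subvariety_def)
  have "mpoly_eval ` P \<subseteq> polyfun ({1..i} \<times> {1..n})"
    unfolding polyfun_eq_mpoly_funs mpoly_funs_def using P(1) by blast
  then show "zclosed ({1..i} \<times> {1..n}) (arc_space n i) Z"
    unfolding zclosed_def P(2) by (intro exI[of _ "mpoly_eval ` P"]) simp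
next
  assume "zclosed ({1..i} \<times> {1..n}) (arc_space n i) Z"
  then obtain F where F: "F \<subseteq> polyfun ({1..i} \<times> {1..n})" "Z = {A \<in> arc_space n i. \<forall>p\<in>F. p A = 0}"
    by (auto simp: zclosed_def)
  let ?P = "{q. mpoly_eval q \<in> F \<and> (\<forall>m\<in>Poly_Mapping.keys q. Poly_Mapping.keys m \<subseteq> {1..i} \<times> {1..n})}"
  have "(\<forall>p\<in>F. p A = 0) \<longleftrightarrow> (\<forall>q\<in>?P. mpoly_eval q A = 0)" for A
  proof
    assume z: "\<forall>q\<in>?P. mpoly_eval q A = 0"
    show "\<forall>p\<in>F. p A = 0"
    proof
      fix p assume p: "p \<in> F"
      then have "p \<in> mpoly_funs ({1..i} \<times> {1..n})" using F(1) unfolding polyfun_eq_mpoly_funs by blast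
      then obtain q where "p = mpoly_eval q"
        "\<forall>m\<in>Poly_Mapping.keys q. Poly_Mapping.keys m \<subseteq> {1..i} \<times> {1..n}"
        unfolding mpoly_funs_def by blast
      then show "p A = 0" using z p by simp
    qed
  qed simp
  then have "Z = {a \<in> arc_space n i. \<forall>p\<in>?P. mpoly_eval p a = 0}"
    by (simp only: F(2))
  then show "algebraic_subvariety n i Z"
    unfolding algebraic_subvariety_def by (intro exI[of _ ?P] conjI) auto
qed

text \<open>As \<open>X\<close> belongs to \<open>C\<close>, the intersection stays in the ambient
  set; its equations are those valid on some member of \<open>C\<close>.\<close>

lemma zclosed_Inter:
  assumes "\<And>Z. Z \<in> C \<Longrightarrow> zclosed V X Z" "X \<in> C"
  shows "zclosed V X (\<Inter>C)"
proof -
  define P where "P = {p \<in> polyfun V. \<exists>Z\<in>C. \<forall>A\<in>Z. p A = 0}"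
  have "\<Inter>C = {A \<in> X. \<forall>p\<in>P. p A = 0}"
  proof (intro equalityI subsetI)
    fix A assume "A \<in> \<Inter>C"
    then show "A \<in> {A \<in> X. \<forall>p\<in>P. p A = 0}" using assms(2) by (auto simp: P_def)
  next
    fix A assume A: "A \<in> {A \<in> X. \<forall>p\<in>P. p A = 0}"
    show "A \<in> \<Inter>C"
    proof
      fix Z assume Z: "Z \<in> C"
      then obtain Q where Q: "Q \<subseteq> polyfun V" "Z = {A \<in> X. \<forall>p\<in>Q. p A = 0}"
        using assms(1) unfolding zclosed_def by blast
      have "Q \<subseteq> P"
      proof
        fix p assume p: "p \<in> Q"
        then have "\<forall>A\<in>Z. p A = 0" using Q(2) by simp
        then show "p \<in> P" using p Q(1) Z unfolding P_def by auto
      qed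
      then show "A \<in> Z" unfolding Q(2) using A by auto
    qed
  qed
  moreover have "P \<subseteq> polyfun V" by (auto simp: P_def)
  ultimately show ?thesis unfolding zclosed_def by blast
qed

lemma zariski_closure_closed: "zclosed ({1..i} \<times> {1..n}) (arc_space n i) (zariski_closure n i (truncate_arc n i I ` H))"
  unfolding zariski_closure_def
proof (rule zclosed_Inter)
  have "truncate_arc n i I ` H \<subseteq> arc_space n i"
    by (auto simp: truncate_arc_def arc_space_def split: if_splits)
  then show "arc_space n i \<in> {Z. algebraic_subvariety n i Z \<and> truncate_arc n i I ` H \<subseteq> Z}"
    by (simp add: algebraic_subvariety_iff zclosed_whole)
qed (simp add: algebraic_subvariety_iff)


section \<open>Nash sequences\<close>

lemma nash_ideal_ideal:
  fixes I :: "(expo \<Rightarrow> 'k::real_normed_field) set"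
  assumes I: "ideal I (cps {1..n})"
  shows "ideal (nash_ideal n I A j) (cps {0..n})"
proof (induction j)
  case 0
  interpret R: cring "cps {0..n} :: (expo \<Rightarrow> 'k) ring" by (rule cring_cps) simp
  have "I \<subseteq> carrier (cps {1..n})" using lidealD(1)[OF ideal_imp_lideal[OF _ I]] by simp
  also have "\<dots> \<subseteq> carrier (cps {0..n})" by (rule carrier_cps_mono) auto
  finally show ?case by (simp add: R.genideal_ideal)
next
  case (Suc j)
  then show ?case by (simp add: strict_transform_ideal ideal_imp_lideal)
qed

text \<open>The convention of value 0 when the strict transform misses the point is recognized by 0
  \<in> \<open>nash_N\<close>; in the other case the count of standard monomials applies.\<close>

lemma nash_invariants_eq:
  fixes I :: "(expo \<Rightarrow> 'k::real_normed_field) set"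
  assumes I: "ideal I (cps {1..n})" and N: "nash_N n I A j = nash_N n I B j"
  shows "nash_H n I A j = nash_H n I B j" "nash_m n I A j = nash_m n I B j"
proof -
  let ?R = "cps {0..n} :: (expo \<Rightarrow> 'k) ring"
  have whole: "nash_ideal n I C j = carrier ?R \<longleftrightarrow> 0 \<in> nash_N n I C j" for C
    unfolding nash_N_def by (rule diagram_zero_iff[OF nash_ideal_ideal[OF I]])
  have H: "nash_H n I C j = (\<lambda>k. if 0 \<in> nash_N n I C j then 0
      else card {\<alpha> \<in> expos {0..n} - nash_N n I C j. expo_deg \<alpha> < k + 1})" for C
  proof (cases "0 \<in> nash_N n I C j")
    case True
    then show ?thesis using whole[of C] by (simp add: nash_H_def)
  next
    case False
    then have ne: "nash_ideal n I C j \<noteq> carrier ?R" using whole by blast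
    interpret proper_cps_ideal n "nash_ideal n I C j"
      by (rule proper_cps_ideal.intro[OF nash_ideal_ideal[OF I] ne])
    show ?thesis
      using False ne by (simp add: nash_H_def Let_def hilbert_samuel_eq std_monoms_def nash_N_def fun_eq_iff)
  qed
  show HH: "nash_H n I A j = nash_H n I B j" unfolding H N ..
  show "nash_m n I A j = nash_m n I B j" unfolding nash_m_def whole HH N ..
qed

text \<open>The induction carries regularity of the j-th ideals on each fibre of the sequence up to
  j. On such a fibre N_j is constant, as the passage to stage j + 1 requires, and the new diagram
  then cuts the fibre further. The bound \<open>j \<le> i\<close> ensures that each centre used is
  given by coordinates of the arc space.\<close>

lemma nash_strata:
  fixes I :: "(expo \<Rightarrow> 'k::real_normed_field) set" and i n :: nat
  defines "V \<equiv> {1..i} \<times> {1..n}" and "X \<equiv> arc_space n i"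
  assumes I: "ideal I (cps {1..n})" and T: "zclosed V X T" and "j \<le> i"
  shows "finite (nash_N_seq n j I ` T) \<and> (\<forall>A1\<in>T.
    (\<exists>U W. zclosed V X U \<and> zclosed V X W \<and> {A \<in> T. nash_N_seq n j I A = nash_N_seq n j I A1} = U - W) \<and>
    regular_family V {A \<in> T. nash_N_seq n j I A = nash_N_seq n j I A1} (\<lambda>A. nash_ideal n I A j))"
  using \<open>j \<le> i\<close>
proof (induction j)
  case 0
  have seq: "nash_N_seq n 0 I A = [initial_diagram n (genideal (cps {0..n}) I)]" for A
    by (simp add: nash_N_seq_def nash_N_def)
  have "finite (nash_N_seq n 0 I ` T)"
    by (rule finite_subset[of _ "{[initial_diagram n (genideal (cps {0..n}) I)]}"]) (auto simp: seq)
  \<comment> \<open>The ideal of stage 0 does not depend on A: there is a single stratum, written as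
    a difference with the empty set, and constant sections give regularity.\<close>
  moreover have "zclosed V X {}" unfolding zclosed_def
    by (intro exI[of _ "{\<lambda>_. 1}"]) (auto intro: polyfun.const)
  then have "\<exists>U W. zclosed V X U \<and> zclosed V X W \<and> T = U - W" using T by (intro exI[of _ T] exI[of _ "{}"]) simp
  moreover have "regular_family V T (\<lambda>A. nash_ideal n I A 0)"
    unfolding regular_family_def
  proof (intro ballI allI)
    fix A f k assume "f \<in> nash_ideal n I A 0"
    then have "poly_section V T (\<lambda>A. nash_ideal n I A 0) (\<lambda>_. f)"
      by (auto simp: poly_section_def intro: polyfun.const)
    then show "\<exists>s. poly_section V T (\<lambda>A. nash_ideal n I A 0) s \<and> (\<forall>\<alpha>. expo_deg \<alpha> \<le> k \<longrightarrow> s A \<alpha> = f \<alpha>)" by blast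
  qed
  moreover have "{A \<in> T. nash_N_seq n 0 I A = nash_N_seq n 0 I A1} = T" for A1 by (simp add: seq)
  ultimately show ?case by simp
next
  case (Suc j)
  have V: "finite V" by (simp add: V_def)
  have TX: "T \<subseteq> X" using T by (auto simp: zclosed_def)
  let ?F = "\<lambda>A1. {A \<in> T. nash_N_seq n j I A = nash_N_seq n j I A1}"
  have IH: "finite (nash_N_seq n j I ` T)"
    "\<And>A1. A1 \<in> T \<Longrightarrow> \<exists>U W. zclosed V X U \<and> zclosed V X W \<and> ?F A1 = U - W"
    "\<And>A1. A1 \<in> T \<Longrightarrow> regular_family V (?F A1) (\<lambda>A. nash_ideal n I A j)"
    using Suc by auto
  have seq: "nash_N_seq n (Suc j) I A = nash_N_seq n j I A @ [nash_N n I A (Suc j)]" for A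
    by (simp add: nash_N_seq_def)
  have lid: "lideal {0..n} (nash_ideal n I A k)" for A k
    by (rule ideal_imp_lideal[OF _ nash_ideal_ideal[OF I]]) simp
  have fam: "ideal_family n V (?F A1) (\<lambda>A. nash_ideal n I A (Suc j))" if A1: "A1 \<in> T" for A1
  proof -
    have f0: "ideal_family n V (?F A1) (\<lambda>A. nash_ideal n I A j)"
      by (rule ideal_family.intro[OF lid IH(3)[OF A1]])
    have last: "nash_N n I A j = last (nash_N_seq n j I A)" for A by (simp add: nash_N_seq_def)
    have "regular_family V (?F A1) (\<lambda>A. strict_transform n (\<lambda>l. A (Suc j, l)) (nash_ideal n I A j))"
    proof (rule ideal_family.strict_transform_regular[OF f0])
      fix A B assume "A \<in> ?F A1" "B \<in> ?F A1"
      then have "nash_N n I A j = nash_N n I B j" unfolding last by simp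
      then show "initial_diagram n (nash_ideal n I A j) = initial_diagram n (nash_ideal n I B j)"
        by (simp add: nash_N_def)
    next
      fix l assume "1 \<le> l" "l \<le> n"
      then show "(\<lambda>A. A (Suc j, l)) \<in> polyfun V"
        using Suc.prems by (intro polyfun.coord) (simp add: V_def)
    qed
    then have "regular_family V (?F A1) (\<lambda>A. nash_ideal n I A (Suc j))" by simp
    then show ?thesis by (rule ideal_family.intro[OF lid])
  qed
  have sub: "?F A1 \<subseteq> X" for A1 using TX by auto
  have fin: "finite ((\<lambda>A. nash_N n I A (Suc j)) ` ?F A1)" if "A1 \<in> T" for A1
    using ideal_family.finite_diagrams[OF fam[OF that] V sub] by (simp only: nash_N_def)
  have "nash_N_seq n (Suc j) I ` T \<subseteq>
      (\<Union>v\<in>nash_N_seq n j I ` T. (\<lambda>x. v @ [x]) ` (\<lambda>A. nash_N n I A (Suc j)) ` {A \<in> T. nash_N_seq n j I A = v})"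
    unfolding seq by blast
  moreover have "finite \<dots>"
    using IH(1) fin by (intro finite_UN_I) auto
  ultimately have "finite (nash_N_seq n (Suc j) I ` T)" by (rule finite_subset)
  moreover have "(\<exists>U W. zclosed V X U \<and> zclosed V X W \<and>
      {A \<in> T. nash_N_seq n (Suc j) I A = nash_N_seq n (Suc j) I A1} = U - W) \<and>
    regular_family V {A \<in> T. nash_N_seq n (Suc j) I A = nash_N_seq n (Suc j) I A1} (\<lambda>A. nash_ideal n I A (Suc j))"
    if A1: "A1 \<in> T" for A1
  proof -
    have eq: "{A \<in> T. nash_N_seq n (Suc j) I A = nash_N_seq n (Suc j) I A1} =
      {A \<in> ?F A1. nash_N n I A (Suc j) = nash_N n I A1 (Suc j)}"
      by (auto simp: seq)
    have mem: "A1 \<in> ?F A1" using A1 by simp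
    obtain U W where UW: "zclosed V X U" "zclosed V X W" "?F A1 = U - W" using IH(2)[OF A1] by blast
    obtain U' W' where UW': "zclosed V X U'" "zclosed V X W'"
      "{A \<in> ?F A1. nash_N n I A (Suc j) = nash_N n I A1 (Suc j)} = ?F A1 \<inter> (U' - W')"
      unfolding nash_N_def by (rule ideal_family.diagram_fibre_locally_closed[OF fam[OF A1] sub mem])
    \<comment> \<open>Differences of closed sets are stable under intersection, which preserves the
      form U - W from stage to stage.\<close>
    have "?F A1 \<inter> (U' - W') = (U \<inter> U') - (W \<union> W')" unfolding UW(3) by blast
    then have "\<exists>U W. zclosed V X U \<and> zclosed V X W \<and>
        {A \<in> T. nash_N_seq n (Suc j) I A = nash_N_seq n (Suc j) I A1} = U - W"
      unfolding eq UW'(3) using zclosed_Int[OF UW(1) UW'(1)] zclosed_Un[OF UW(2) UW'(2)] by blast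
    moreover have "regular_family V {A \<in> T. nash_N_seq n (Suc j) I A = nash_N_seq n (Suc j) I A1} (\<lambda>A. nash_ideal n I A (Suc j))"
      unfolding eq by (rule regular_family_subset[OF ideal_family.regular[OF fam[OF A1]]]) auto
    ultimately show ?thesis by blast
  qed
  ultimately show ?case by blast
qed


theorem mainTheorem5:
  fixes n i :: nat
    and I :: "(expo \<Rightarrow> 'k::{real_normed_field, banach}) set"
  assumes "ideal I (cps {1..n})"
    and "I \<noteq> carrier (cps {1..n})"
    and "i \<ge> 1"
  shows "\<exists>(l::nat) (S :: nat \<Rightarrow> (nat \<times> nat \<Rightarrow> 'k) set).
     zariski_closure n i (truncate_arc n i I ` arcs n I) = (\<Union>j\<in>{1..l}. S j) \<and>
     disjoint_family_on S {1..l} \<and>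
     (\<forall>j\<in>{1..l}. S j \<noteq> {}) \<and>
     (\<forall>j\<in>{1..l}. \<exists>U W. algebraic_subvariety n i U \<and> algebraic_subvariety n i W \<and> S j = U - W) \<and>
     (\<forall>j\<in>{1..l}. \<forall>A\<in>S j. \<forall>B\<in>S j.
        nash_M_seq n i I A = nash_M_seq n i I B \<and>
        nash_H_seq n i I A = nash_H_seq n i I B \<and>
        nash_N_seq n i I A = nash_N_seq n i I B) \<and>
     (\<forall>j\<in>{1..l}. \<forall>j'\<in>{1..l}. j \<noteq> j' \<longrightarrow>
        (\<forall>A\<in>S j. \<forall>B\<in>S j'. nash_N_seq n i I A \<noteq> nash_N_seq n i I B))"
proof -
  let ?V = "{1..i} \<times> {1..n}"
  define T where "T = zariski_closure n i (truncate_arc n i I ` arcs n I)"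
  have T: "zclosed ?V (arc_space n i) T" unfolding T_def by (rule zariski_closure_closed)
  note strata = nash_strata[OF assms(1) T order_refl]
  define vals where "vals = nash_N_seq n i I ` T"
  have "finite vals" using strata unfolding vals_def by (rule conjunct1)
  \<comment> \<open>Strata are indexed by the values of the diagram sequence, so that distinct
    strata have distinct values and none is empty.\<close>
  then obtain v where v: "bij_betw v {1..card vals} vals" using ex_bij_betw_nat_finite_1 by blast
  define S where "S j = {A \<in> T. nash_N_seq n i I A = v j}" for j
  have val: "v j \<in> vals" if "j \<in> {1..card vals}" for j using bij_betwE[OF v] that by blast
  have inj: "j = j'" if "v j = v j'" "j \<in> {1..card vals}" "j' \<in> {1..card vals}" for j j'
    using inj_onD[OF bij_betw_imp_inj_on[OF v]] that by blast
  have "T = (\<Union>j\<in>{1..card vals}. S j)"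
  proof (intro equalityI subsetI)
    fix A assume A: "A \<in> T"
    then have "nash_N_seq n i I A \<in> v ` {1..card vals}"
      using bij_betw_imp_surj_on[OF v] by (simp add: vals_def)
    then show "A \<in> (\<Union>j\<in>{1..card vals}. S j)" using A by (auto simp: S_def)
  qed (auto simp: S_def)
  moreover have "disjoint_family_on S {1..card vals}"
    unfolding disjoint_family_on_def S_def using inj by fastforce
  moreover have "S j \<noteq> {}" if "j \<in> {1..card vals}" for j
    using val[OF that] by (auto simp: vals_def S_def)
  moreover have "\<exists>U W. algebraic_subvariety n i U \<and> algebraic_subvariety n i W \<and> S j = U - W"
    if j: "j \<in> {1..card vals}" for j
  proof -
    obtain A1 where "A1 \<in> T" "v j = nash_N_seq n i I A1" using val[OF j] by (auto simp: vals_def)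
    then show ?thesis using strata unfolding S_def algebraic_subvariety_iff by simp
  qed
  moreover have "nash_M_seq n i I A = nash_M_seq n i I B \<and> nash_H_seq n i I A = nash_H_seq n i I B \<and>
      nash_N_seq n i I A = nash_N_seq n i I B" if "A \<in> S j" "B \<in> S j" for A B j
  proof -
    have eq: "nash_N_seq n i I A = nash_N_seq n i I B" using that by (simp add: S_def)
    then have "nash_N n I A k = nash_N n I B k" if "k \<in> set [0..<Suc i]" for k
      using that unfolding nash_N_seq_def map_eq_conv by blast
    note inv = nash_invariants_eq[OF assms(1) this]
    have "nash_M_seq n i I A = nash_M_seq n i I B" "nash_H_seq n i I A = nash_H_seq n i I B"
      unfolding nash_M_seq_def nash_H_seq_def map_eq_conv using inv by blast+
    with eq show ?thesis by blast
  qed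
  moreover have "nash_N_seq n i I A \<noteq> nash_N_seq n i I B"
    if "j \<in> {1..card vals}" "j' \<in> {1..card vals}" "j \<noteq> j'" "A \<in> S j" "B \<in> S j'" for A B j j'
    using that inj[OF _ that(1,2)] by (auto simp: S_def)
  ultimately show ?thesis
    unfolding T_def[symmetric] by (intro exI[of _ "card vals"] exI[of _ S] conjI ballI impI) blast+
qed

end
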